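(* Fix $d\ge4$. The number of (combinatorial types of) shellable simplicial $d$-spheres grows more than exponentially with respect to the number $n$ of vertices, but only exponentially with respect to the number $N$ of facets. That is: for every constant $C$, for all sufficiently large $n$ there are more than $C^n$ combinatorial types of shellable simplicial $d$-spheres with $n$ vertices; and there is a constant $C'=C'(d)$ such that, for every $N$, there are at most $C'^N$ combinatorial types of shellable simplicial $d$-spheres with $N$ facets.
   Context: All complexes are finite. A simplicial $d$-sphere is a simplicial complex whose underlying space is homeomorphic to the $d$-sphere; facets are its $d$-dimensional faces. Combinatorial types are isomorphism classes of simplicial complexes. Shellable: every simplex is shellable; a pure $d$-dimensional simplicial complex $C$ that is not a simplex is shellable iff $C=C_1\cup C_2$ with $C_1$ a shellable $d$-complex, $C_2$ a $d$-simplex, and $C_1\cap C_2$ a shellable $(d-1)$-complex. *)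

theory Defs
  imports "HOL-Analysis.Analysis"
begin

text \<open>
  Finite abstract simplicial complexes, given as their sets of faces. The empty face (of dimension
  \<open>-1\<close>) always belongs to a complex; consequently \<open>{{}}\<close>, the intersection of two disjoint
  simplices, is the simplex of dimension \<open>-1\<close>.
\<close>

definition simplicial_cplx :: "'a set set \<Rightarrow> bool" where
  "simplicial_cplx K \<longleftrightarrow>
     finite K \<and> {} \<in> K \<and> (\<forall>\<sigma>\<in>K. finite \<sigma> \<and> (\<forall>\<tau>. \<tau> \<subseteq> \<sigma> \<longrightarrow> \<tau> \<in> K))"

definition vertices :: "'a set set \<Rightarrow> 'a set" where
  "vertices K = \<Union>K"

definition faces_of_dim :: "int \<Rightarrow> 'a set set \<Rightarrow> 'a set set" where
  "faces_of_dim d K = {\<sigma> \<in> K. int (card \<sigma>) = d + 1}"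

definition pure_cplx :: "int \<Rightarrow> 'a set set \<Rightarrow> bool" where
  "pure_cplx d K \<longleftrightarrow>
     simplicial_cplx K \<and>
     (\<forall>\<sigma>\<in>K. int (card \<sigma>) \<le> d + 1 \<and> (\<exists>\<tau>\<in>faces_of_dim d K. \<sigma> \<subseteq> \<tau>))"

text \<open>
  The complex of a simplex with vertex set \<open>\<sigma>\<close> is \<open>Pow \<sigma>\<close>. In the base case \<open>\<sigma> = {}\<close> is
  allowed: this is what makes every nonempty 0-dimensional complex shellable.
\<close>

inductive shellable :: "'a set set \<Rightarrow> bool" where
  simplex: "finite \<sigma> \<Longrightarrow> shellable (Pow \<sigma>)"
| attach:
    "\<lbrakk>pure_cplx d K; \<nexists>\<rho>. K = Pow \<rho>;
      K = K1 \<union> Pow \<sigma>;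
      pure_cplx d K1; shellable K1;
      finite \<sigma>; int (card \<sigma>) = d + 1;
      pure_cplx (d - 1) (K1 \<inter> Pow \<sigma>); shellable (K1 \<inter> Pow \<sigma>)\<rbrakk>
     \<Longrightarrow> shellable K"

text \<open>
  The underlying space, in barycentric coordinates. As the complex is finite, the product topology
  on \<open>'a \<Rightarrow> real\<close> induces the usual topology. The support of a point is a face, hence finite.
\<close>

definition underlying_space :: "'a set set \<Rightarrow> ('a \<Rightarrow> real) topology" where
  "underlying_space K =
     subtopology (powertop_real UNIV)
       {x. (\<forall>v. 0 \<le> x v) \<and> {v. x v \<noteq> 0} \<in> K \<and> (\<Sum>v | x v \<noteq> 0. x v) = 1}"

definition simplicial_sphere :: "nat \<Rightarrow> 'a set set \<Rightarrow> bool" where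
  "simplicial_sphere d K \<longleftrightarrow>
     simplicial_cplx K \<and> underlying_space K homeomorphic_space nsphere d"

definition cplx_iso :: "'a set set \<Rightarrow> 'b set set \<Rightarrow> bool" where
  "cplx_iso K L \<longleftrightarrow> (\<exists>f. bij_betw f (vertices K) (vertices L) \<and> L = (\<lambda>\<sigma>. f ` \<sigma>) ` K)"

text \<open>
  Every finite complex is isomorphic to one with vertices in \<open>nat\<close>, so combinatorial types
  may be taken to be the isomorphism classes of complexes on \<open>nat\<close>.
\<close>

definition iso_rel :: "(nat set set \<times> nat set set) set" where
  "iso_rel = {(K, L). simplicial_cplx K \<and> simplicial_cplx L \<and> cplx_iso K L}"

lemma equiv_iso_rel: "equiv {K. simplicial_cplx K} iso_rel"
proof (rule equivI)
  show "refl_on {K. simplicial_cplx K} iso_rel"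
    by (auto simp: refl_on_def iso_rel_def cplx_iso_def intro!: exI[of _ id])
  show "iso_rel \<subseteq> {K. simplicial_cplx K} \<times> {K. simplicial_cplx K}"
    by (auto simp: iso_rel_def)
  show "sym iso_rel"
  proof (rule symI)
    fix K L assume "(K, L) \<in> iso_rel"
    then obtain f where s: "simplicial_cplx K" "simplicial_cplx L"
      and f: "bij_betw f (vertices K) (vertices L)" and L: "L = (\<lambda>\<sigma>. f ` \<sigma>) ` K"
      by (auto simp: iso_rel_def cplx_iso_def)
    let ?g = "inv_into (vertices K) f"
    have "?g ` f ` \<sigma> = \<sigma>" if "\<sigma> \<in> K" for \<sigma>
      using f that by (intro inv_into_image_cancel) (auto simp: bij_betw_def vertices_def)
    then have "K = (\<lambda>\<sigma>. ?g ` \<sigma>) ` L"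
      by (force simp: L image_image)
    then show "(L, K) \<in> iso_rel"
      using s bij_betw_inv_into[OF f] by (auto simp: iso_rel_def cplx_iso_def)
  qed
  show "trans iso_rel"
  proof (rule transI)
    fix K L M assume "(K, L) \<in> iso_rel" "(L, M) \<in> iso_rel"
    then obtain f g where s: "simplicial_cplx K" "simplicial_cplx M"
      and f: "bij_betw f (vertices K) (vertices L)" "L = (\<lambda>\<sigma>. f ` \<sigma>) ` K"
      and g: "bij_betw g (vertices L) (vertices M)" "M = (\<lambda>\<sigma>. g ` \<sigma>) ` L"
      by (auto simp: iso_rel_def cplx_iso_def)
    have "M = (\<lambda>\<sigma>. (g \<circ> f) ` \<sigma>) ` K"
      by (simp add: f(2) g(2) image_image image_comp)
    then show "(K, M) \<in> iso_rel"
      using s bij_betw_trans[OF f(1) g(1)] by (auto simp: iso_rel_def cplx_iso_def)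
  qed
qed

definition shellable_spheres :: "nat \<Rightarrow> nat set set set" where
  "shellable_spheres d = {K. simplicial_sphere d K \<and> shellable K}"

definition types_with_vertices :: "nat \<Rightarrow> nat \<Rightarrow> nat set set set set" where
  "types_with_vertices d n = {K \<in> shellable_spheres d. card (vertices K) = n} // iso_rel"

definition types_with_facets :: "nat \<Rightarrow> nat \<Rightarrow> nat set set set set" where
  "types_with_facets d N =
     {K \<in> shellable_spheres d. card (faces_of_dim (int d) K) = N} // iso_rel"

end

(* Upper bound. Invariance of domain, applied to the open cone over a triangulated d-sphere, shows
   that every ridge lies in at most two facets. Reading off a shelling, each facet after the first
       is
   attached along a ridge of an earlier one; this makes the facets the nodes of a tree of arity d+1,
   and such a tree with N nodes can be coded by N labels. The vertex identifications not implied by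
   the tree are recovered from local "folds": if the new facet meets the earlier ones in a second
   ridge, the two copies of that ridge are marked with the codimension-2 face F common to both
   ridges. Counting facets and ridges around F shows that at most one fold takes place at F, so the
   marks determine all identifications.

   Lower bound. Stellar subdivision preserves both the homeomorphism type and shellability. Starting
   from the boundary of the simplex, subdividing k times an edge and then k times a disjoint edge of
   the same facet gives about 2k vertices and at least k^2 facets. Stacking m of these facets can be
   done in (k^2 choose m) ways, and at most 2^n n^(d+1) of the resulting complexes on n vertices are
   isomorphic to a given one, since an automorphism of the base is determined by its values on a
   single facet. *)
theory Submission
  imports Defs "HOL-Homology.Invariance_of_Domain" "HOL-Library.Sublist"
begin

section \<open>Shellings and stellar subdivision\<close>

text \<open>In the upper bound the obstacle is that an identification not implied by the tree may
  join facets far apart in it, and naming the partner would cost about log N bits. A fold therefore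
  names no partner: both of its sides carry marks of bounded size, and they find each other because
  the vertices of F are already known to agree there. This is unambiguous only if F carries a single
  fold. The first facet through F brings two ridges through F, each later one brings one, or none if
  it folds; so ridges exceed facets by at most one, a fold uses up this surplus, and thinness
  forbids a deficit. One fold per facet suffices, because all vertices of a facet but one are
  inherited from its parent. In the lower bound, k is about n/4, which leaves about n/2 vertices for
  stackings among at least n^2/64 facets. This gives at least (n/64)^(n/4) choices: the quadratic
  facet count is what makes the base grow, whereas the overcount stays at 2^n n^(d+1).\<close>

text \<open>
  A complex shelled in the sense of \<^const>\<open>shellable\<close>, with facets of cardinality \<open>n\<close>. A new facet
  \<open>\<sigma>\<close> meets the earlier ones in the union of the ridges \<open>\<sigma> - {x}\<close>, \<open>x \<in> R\<close>.
\<close>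

inductive shelled :: "nat \<Rightarrow> 'a set set \<Rightarrow> bool" for n where
  simplex: "\<lbrakk>finite \<sigma>; card \<sigma> = n\<rbrakk> \<Longrightarrow> shelled n (Pow \<sigma>)"
| attach: "\<lbrakk>shelled n K; finite \<sigma>; card \<sigma> = n; R \<subseteq> \<sigma>; R \<noteq> {};
     K \<inter> Pow \<sigma> = {\<tau>. \<tau> \<subseteq> \<sigma> \<and> \<not> R \<subseteq> \<tau>}\<rbrakk> \<Longrightarrow> shelled n (K \<union> Pow \<sigma>)"

definition facets :: "nat \<Rightarrow> 'a set set \<Rightarrow> 'a set set" where
  "facets n K = {\<sigma>\<in>K. card \<sigma> = n}"

text \<open>The weak pseudomanifold condition. Unlike sphericity it passes to the partial complexes
  of a shelling, which is where it is applied.\<close>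

definition thin :: "nat \<Rightarrow> 'a set set \<Rightarrow> bool" where
  "thin n K \<longleftrightarrow> (\<forall>\<rho> \<sigma>1 \<sigma>2 \<sigma>3. Suc (card \<rho>) = n \<and> \<sigma>1 \<in> facets n K \<and> \<sigma>2 \<in> facets n K \<and> \<sigma>3 \<in> facets n K
     \<and> \<rho> \<subseteq> \<sigma>1 \<and> \<rho> \<subseteq> \<sigma>2 \<and> \<rho> \<subseteq> \<sigma>3 \<longrightarrow> \<sigma>1 = \<sigma>2 \<or> \<sigma>1 = \<sigma>3 \<or> \<sigma>2 = \<sigma>3)"

lemma shelled_cplx: "shelled n K \<Longrightarrow> simplicial_cplx K"
  by (induction rule: shelled.induct)
    (auto simp: simplicial_cplx_def dest: finite_subset)

lemma cplx_Pow: "finite \<sigma> \<Longrightarrow> simplicial_cplx (Pow \<sigma>)"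
  by (auto simp: simplicial_cplx_def dest: finite_subset)

lemma cplx_subset: "simplicial_cplx K \<Longrightarrow> \<sigma> \<in> K \<Longrightarrow> \<tau> \<subseteq> \<sigma> \<Longrightarrow> \<tau> \<in> K"
  by (auto simp: simplicial_cplx_def)

lemma shelled_subset: "shelled n K \<Longrightarrow> \<sigma> \<in> K \<Longrightarrow> \<tau> \<subseteq> \<sigma> \<Longrightarrow> \<tau> \<in> K"
  using cplx_subset shelled_cplx by blast

lemma shelled_finite: "shelled n K \<Longrightarrow> finite K"
  using shelled_cplx by (auto simp: simplicial_cplx_def)

lemma shelled_finite_face: "shelled n K \<Longrightarrow> \<sigma> \<in> K \<Longrightarrow> finite \<sigma>"
  using shelled_cplx by (auto simp: simplicial_cplx_def)

lemma shelled_in_facet: "shelled n K \<Longrightarrow> \<tau> \<in> K \<Longrightarrow> \<exists>\<sigma>\<in>facets n K. \<tau> \<subseteq> \<sigma>"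
  by (induction rule: shelled.induct) (auto simp: facets_def)

lemma shelled_card_le: "shelled n K \<Longrightarrow> \<tau> \<in> K \<Longrightarrow> card \<tau> \<le> n"
  by (induction rule: shelled.induct) (auto intro: card_mono)

lemma shelled_ex_facet: "shelled n K \<Longrightarrow> \<exists>\<sigma>. \<sigma> \<in> facets n K"
  by (induction rule: shelled.induct) (auto simp: facets_def)

lemma facets_attach:
  assumes "shelled n K" "finite \<sigma>" "card \<sigma> = n"
  shows "facets n (K \<union> Pow \<sigma>) = insert \<sigma> (facets n K)"
  using assms by (auto simp: facets_def dest: card_subset_eq)

lemma attach_notin:
  assumes "R \<subseteq> \<sigma>" "K \<inter> Pow \<sigma> = {\<tau>. \<tau> \<subseteq> \<sigma> \<and> \<not> R \<subseteq> \<tau>}"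
  shows "\<sigma> \<notin> K"
  using assms by blast

lemma shelled_pure:
  assumes "shelled n K" shows "pure_cplx (int n - 1) K"
proof -
  have "\<exists>\<tau>\<in>faces_of_dim (int n - 1) K. \<sigma> \<subseteq> \<tau>" if "\<sigma> \<in> K" for \<sigma>
    using shelled_in_facet[OF assms that] by (auto simp: facets_def faces_of_dim_def)
  then show ?thesis
    using assms by (auto simp: pure_cplx_def shelled_cplx shelled_card_le)
qed

text \<open>The ridges \<open>V - {x}\<close> may be added in any order: a new one meets the union
  of those for an earlier set \<open>X\<close> in the faces omitting a vertex of \<open>X\<close>,
  so \<open>X\<close> itself serves as attaching set. This shells both the intersections occurring
  in a shelling and the boundary of a simplex.\<close>

lemma shelled_ridges:
  assumes "finite V" "X \<subseteq> V" "X \<noteq> {}"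
  shows "shelled (card V - 1) {\<tau>. \<tau> \<subseteq> V \<and> \<not> X \<subseteq> \<tau>}"
proof -
  have "finite X" using assms(1,2) by (rule finite_subset[rotated])
  then show ?thesis using assms(3,2)
  proof (induction rule: finite_ne_induct)
    case (singleton x)
    have "{\<tau>. \<tau> \<subseteq> V \<and> \<not> {x} \<subseteq> \<tau>} = Pow (V - {x})" by auto
    then show ?case using singleton assms(1)
      by (simp add: shelled.simplex)
  next
    case (insert x X)
    have "{\<tau>. \<tau> \<subseteq> V \<and> \<not> insert x X \<subseteq> \<tau>} = {\<tau>. \<tau> \<subseteq> V \<and> \<not> X \<subseteq> \<tau>} \<union> Pow (V - {x})" by auto
    moreover have "shelled (card V - 1) ({\<tau>. \<tau> \<subseteq> V \<and> \<not> X \<subseteq> \<tau>} \<union> Pow (V - {x}))"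
      by (rule shelled.attach[where R=X]) (use insert assms(1) in auto)
    ultimately show ?case by simp
  qed
qed

text \<open>The outer induction is on \<open>n\<close>, because \<open>shellable\<close> asks for
  shellability of each intersection, and by \<open>shelled_ridges\<close> the intersection is
  shelled with facets of cardinality \<open>n - 1\<close>.\<close>

lemma shelled_imp_shellable: "shelled n K \<Longrightarrow> shellable K"
proof (induction n arbitrary: K rule: less_induct)
  case (less n)
  from less.prems show ?case
  proof (induction rule: shelled.induct)
    case (simplex \<sigma>)
    then show ?case by (simp add: shellable.simplex)
  next
    case (attach K \<sigma> R)
    let ?K = "K \<union> Pow \<sigma>"
    have sh: "shelled n ?K" using attach.hyps by (intro shelled.attach[where R=R])
    have n: "\<sigma> \<notin> K" using attach.hyps attach_notin by metis
    have ns: "?K \<noteq> Pow \<rho>" for \<rho>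
    proof
      assume eq: "?K = Pow \<rho>"
      have "card \<rho> \<le> n" using shelled_card_le[OF sh] eq by blast
      moreover have "finite \<rho>" using shelled_finite_face[OF sh] eq by blast
      moreover have "\<sigma> \<subseteq> \<rho>" using eq by blast
      ultimately have "\<sigma> = \<rho>" using attach.hyps by (metis card_seteq)
      obtain \<tau> where "\<tau> \<in> facets n K" using shelled_ex_facet[OF attach.hyps(1)] by blast
      then have "\<tau> \<subseteq> \<sigma>" "card \<tau> = n" "\<tau> \<in> K" using eq \<open>\<sigma> = \<rho>\<close> by (auto simp: facets_def)
      then have "\<tau> = \<sigma>" using attach.hyps by (metis card_subset_eq)
      then show False using \<open>\<tau> \<in> K\<close> n by simp
    qed
    have i: "shelled (n - 1) (K \<inter> Pow \<sigma>)"
      using shelled_ridges[of \<sigma> R] attach.hyps by simp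
    have "n > 0" using attach.hyps by (metis card_gt_0_iff finite_subset subset_empty)
    then have i': "shellable (K \<inter> Pow \<sigma>)" "pure_cplx (int n - 1 - 1) (K \<inter> Pow \<sigma>)"
      using less.IH[OF _ i] shelled_pure[OF i] by (simp_all add: of_nat_diff)
    have ns': "\<nexists>\<rho>. ?K = Pow \<rho>" and c: "int (card \<sigma>) = int n - 1 + 1"
      using ns attach.hyps by simp_all
    show ?case
      by (rule shellable.attach[OF shelled_pure[OF sh] ns' refl shelled_pure[OF attach.hyps(1)]
            attach.IH attach.hyps(2) c i'(2,1)])
  qed
qed

text \<open>The attaching set \<open>R\<close> is recovered as the set of vertices whose opposite
  ridge is already present; purity of the intersection puts every old face of
  \<open>\<sigma>\<close> into one of these ridges.\<close>

lemma shellable_imp_shelled: "shellable K \<Longrightarrow> \<exists>n. shelled n K"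
proof (induction rule: shellable.induct)
  case (simplex \<sigma>)
  then show ?case using shelled.simplex by blast
next
  case (attach d K K1 \<sigma>)
  obtain n where n: "shelled n K1" using attach by blast
  \<comment> \<open>The \<open>d\<close> of the rule is not tied to the \<open>n\<close> that the
    induction hypothesis supplies for \<open>K1\<close>; comparing a facet of the shelling with a
    \<open>d\<close>-face above it forces \<open>d = n - 1\<close>.\<close>
  obtain \<phi> where \<phi>: "\<phi> \<in> facets n K1" using shelled_ex_facet[OF n] by blast
  obtain \<psi> where \<psi>: "\<psi> \<in> K1" "int (card \<psi>) = d + 1" "\<phi> \<subseteq> \<psi>"
    using attach.hyps(4) \<phi> by (auto simp: pure_cplx_def facets_def faces_of_dim_def)
  have "int n \<le> d + 1" using attach.hyps(4) \<phi> by (auto simp: pure_cplx_def facets_def)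
  then have d: "d = int n - 1" using \<psi> shelled_card_le[OF n \<psi>(1)] by linarith
  define R where "R = {x\<in>\<sigma>. \<sigma> - {x} \<in> K1}"
  have c: "card \<sigma> = n" using attach.hyps d by simp
  have pure: "pure_cplx (d - 1) (K1 \<inter> Pow \<sigma>)" by fact
  have ridge: "\<exists>x\<in>R. \<tau> \<subseteq> \<sigma> - {x}" if \<tau>: "\<tau> \<in> K1" "\<tau> \<subseteq> \<sigma>" for \<tau>
  proof -
    obtain \<rho> where \<rho>: "\<rho> \<in> K1" "\<rho> \<subseteq> \<sigma>" "int (card \<rho>) = int n - 1" "\<tau> \<subseteq> \<rho>"
    proof -
      have "\<exists>\<rho>\<in>faces_of_dim (d - 1) (K1 \<inter> Pow \<sigma>). \<tau> \<subseteq> \<rho>"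
        using pure \<tau> unfolding pure_cplx_def by blast
      then show ?thesis using that d by (auto simp: faces_of_dim_def)
    qed
    have "card (\<sigma> - \<rho>) = 1"
      using \<rho> c attach.hyps by (subst card_Diff_subset) (auto dest: finite_subset)
    then obtain x where "\<sigma> - \<rho> = {x}" by (auto simp: card_1_singleton_iff)
    then have "\<rho> = \<sigma> - {x}" "x \<in> \<sigma>" using \<rho>(2) by auto
    then show ?thesis using \<rho> by (auto simp: R_def)
  qed
  have cp: "simplicial_cplx K1" by (rule shelled_cplx[OF n])
  have "K1 \<inter> Pow \<sigma> = {\<tau>. \<tau> \<subseteq> \<sigma> \<and> \<not> R \<subseteq> \<tau>}"
  proof (intro equalityI subsetI)
    fix \<tau> assume "\<tau> \<in> K1 \<inter> Pow \<sigma>"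
    then show "\<tau> \<in> {\<tau>. \<tau> \<subseteq> \<sigma> \<and> \<not> R \<subseteq> \<tau>}" using ridge[of \<tau>] by auto
  next
    fix \<tau> assume \<tau>: "\<tau> \<in> {\<tau>. \<tau> \<subseteq> \<sigma> \<and> \<not> R \<subseteq> \<tau>}"
    then obtain x where "x \<in> R" "x \<notin> \<tau>" by blast
    then have "\<tau> \<subseteq> \<sigma> - {x}" "\<sigma> - {x} \<in> K1" using \<tau> by (auto simp: R_def)
    then show "\<tau> \<in> K1 \<inter> Pow \<sigma>" using cplx_subset[OF cp] by auto
  qed
  moreover have "R \<noteq> {}" using ridge[of "{}"] cp by (auto simp: simplicial_cplx_def)
  ultimately have "shelled n (K1 \<union> Pow \<sigma>)"
    using n c attach.hyps by (intro shelled.attach[where R=R]) (auto simp: R_def)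
  then show ?case using attach.hyps by auto
qed

text \<open>The second part is the cone with apex \<open>w\<close> over the faces of the closed star
  of \<open>F\<close> that do not contain \<open>F\<close>. An edge as \<open>F\<close> gives edge
  subdivision, a facet gives stacking; the lower bound uses both.\<close>

definition stellar :: "'a set \<Rightarrow> 'a \<Rightarrow> 'a set set \<Rightarrow> 'a set set" where
  "stellar F w K = {\<tau>\<in>K. \<not> F \<subseteq> \<tau>} \<union> insert w ` {\<tau>\<in>K. \<not> F \<subseteq> \<tau> \<and> \<tau> \<union> F \<in> K}"

lemma stellar_Un:
  assumes "simplicial_cplx K" "simplicial_cplx L"
  shows "stellar F w (K \<union> L) = stellar F w K \<union> stellar F w L"
proof -
  have "\<tau> \<in> K" if "\<tau> \<union> F \<in> K" for \<tau> using cplx_subset[OF assms(1) that] by auto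
  moreover have "\<tau> \<in> L" if "\<tau> \<union> F \<in> L" for \<tau> using cplx_subset[OF assms(2) that] by auto
  ultimately have "{\<tau>\<in>K \<union> L. \<not> F \<subseteq> \<tau> \<and> \<tau> \<union> F \<in> K \<union> L}
    = {\<tau>\<in>K. \<not> F \<subseteq> \<tau> \<and> \<tau> \<union> F \<in> K} \<union> {\<tau>\<in>L. \<not> F \<subseteq> \<tau> \<and> \<tau> \<union> F \<in> L}"
    by blast
  then show ?thesis unfolding stellar_def by (simp add: image_Un) blast
qed

lemma card_swap: "\<lbrakk>finite \<sigma>; x \<in> \<sigma>; w \<notin> \<sigma>\<rbrakk> \<Longrightarrow> card (insert w (\<sigma> - {x})) = card \<sigma>"
  by (simp add: card_Suc_Diff1 del: card_Diff_insert)

lemma stellar_Pow: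
  assumes "F \<subseteq> \<sigma>"
  shows "stellar F w (Pow \<sigma>) = (\<Union>x\<in>F. Pow (insert w (\<sigma> - {x})))"
proof (intro equalityI subsetI)
  fix \<tau> assume "\<tau> \<in> stellar F w (Pow \<sigma>)"
  then show "\<tau> \<in> (\<Union>x\<in>F. Pow (insert w (\<sigma> - {x})))" by (auto simp: stellar_def)
next
  fix \<tau> assume "\<tau> \<in> (\<Union>x\<in>F. Pow (insert w (\<sigma> - {x})))"
  then obtain x where x: "x \<in> F" "\<tau> \<subseteq> insert w (\<sigma> - {x})" by auto
  show "\<tau> \<in> stellar F w (Pow \<sigma>)"
  proof (cases "w \<in> \<tau>")
    case True
    then have "\<tau> = insert w (\<tau> - {w})" by auto
    then show ?thesis using x assms unfolding stellar_def by blast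
  next
    case False
    then show ?thesis using x assms unfolding stellar_def by blast
  qed
qed

text \<open>Any order of the pieces works: the piece exchanging \<open>x\<close> for
  \<open>w\<close> meets those for an earlier set \<open>X\<close> in the faces omitting a vertex of
  \<open>X\<close>.\<close>

lemma shelled_stellar_Pow:
  assumes "finite \<sigma>" "F \<subseteq> \<sigma>" "w \<notin> \<sigma>" "X \<subseteq> F" "X \<noteq> {}"
  shows "shelled (card \<sigma>) (\<Union>x\<in>X. Pow (insert w (\<sigma> - {x})))"
proof -
  have "finite X" using assms(1,2,4) by (meson finite_subset)
  then show ?thesis using assms(5,4)
  proof (induction rule: finite_ne_induct)
    case (singleton x)
    then have "card (insert w (\<sigma> - {x})) = card \<sigma>"
      using assms(1-3) by (intro card_swap) auto
    then show ?case using assms(1) by (simp add: shelled.simplex)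
  next
    case (insert x X)
    have c: "card (insert w (\<sigma> - {x})) = card \<sigma>"
      using insert.prems assms(1-3) by (intro card_swap) auto
    have "w \<notin> X" "x \<in> \<sigma>" "X \<subseteq> \<sigma>" using insert.prems assms(2,3) by auto
    then have I: "(\<Union>z\<in>X. Pow (insert w (\<sigma> - {z}))) \<inter> Pow (insert w (\<sigma> - {x}))
        = {\<tau>. \<tau> \<subseteq> insert w (\<sigma> - {x}) \<and> \<not> X \<subseteq> \<tau>}"
      by blast
    have "shelled (card \<sigma>) ((\<Union>x\<in>X. Pow (insert w (\<sigma> - {x}))) \<union> Pow (insert w (\<sigma> - {x})))"
      by (rule shelled.attach[OF _ _ c _ _ I])
        (use insert assms(1) \<open>X \<subseteq> \<sigma>\<close> in auto)
    then show ?case by (simp add: Un_commute)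
  qed
qed

text \<open>The piece exchanging \<open>x\<close> for \<open>w\<close> is attached along the ridges
  opposite \<open>S\<close>: those opposite \<open>z \<in> X\<close> lie in the piece for
  \<open>z\<close>, those opposite \<open>R - F\<close> in subdivided old ridges of
  \<open>\<sigma>\<close>, and the one opposite \<open>w\<close> is \<open>\<sigma> - {x}\<close>,
  which is old just when \<open>x \<in> R\<close>. The last condition on \<open>X\<close> secures
  purity: if \<open>x \<notin> R\<close>, a vertex \<open>y\<close> of
  \<open>R \<inter> F - X\<close> would give the old face \<open>\<sigma> - {x, y}\<close>, of
  codimension two in the piece and contained in no old ridge of it.\<close>

lemma stellar_attach_step:
  assumes R: "R \<subseteq> \<sigma>" and I: "K \<inter> Pow \<sigma> = {\<tau>. \<tau> \<subseteq> \<sigma> \<and> \<not> R \<subseteq> \<tau>}"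
    and F: "F \<subseteq> \<sigma>" and w: "w \<notin> \<Union>K" "w \<notin> \<sigma>"
    and X: "X \<subseteq> F" "x \<in> F" "x \<notin> X" "x \<notin> R \<Longrightarrow> R \<inter> F \<subseteq> X"
  defines "S \<equiv> X \<union> (R - F) \<union> (if x \<in> R then {w} else {})"
  shows "(stellar F w K \<union> (\<Union>z\<in>X. Pow (insert w (\<sigma> - {z})))) \<inter> Pow (insert w (\<sigma> - {x}))
       = {\<tau>. \<tau> \<subseteq> insert w (\<sigma> - {x}) \<and> \<not> S \<subseteq> \<tau>}"
proof -
  have Kiff: "\<tau> \<in> K \<longleftrightarrow> \<not> R \<subseteq> \<tau>" if "\<tau> \<subseteq> \<sigma>" for \<tau> using I that by blast
  have "\<tau> \<in> stellar F w K \<union> (\<Union>z\<in>X. Pow (insert w (\<sigma> - {z}))) \<longleftrightarrow> \<not> S \<subseteq> \<tau>"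
    if \<tau>: "\<tau> \<subseteq> insert w (\<sigma> - {x})" for \<tau>
  proof (cases "w \<in> \<tau>")
    case False
    then have "\<tau> \<subseteq> \<sigma> - {x}" using \<tau> by auto
    then have "\<tau> \<in> stellar F w K \<longleftrightarrow> \<not> R \<subseteq> \<tau>"
      using Kiff[of \<tau>] X False by (auto simp: stellar_def)
    moreover have "\<tau> \<in> (\<Union>z\<in>X. Pow (insert w (\<sigma> - {z}))) \<longleftrightarrow> \<not> X \<subseteq> \<tau>"
      using \<open>\<tau> \<subseteq> \<sigma> - {x}\<close> w(2) X(1) F by (auto simp: subset_insert_iff)
    ultimately have "\<tau> \<in> stellar F w K \<union> (\<Union>z\<in>X. Pow (insert w (\<sigma> - {z})))
        \<longleftrightarrow> \<not> R \<subseteq> \<tau> \<or> \<not> X \<subseteq> \<tau>"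
      by (simp only: Un_iff)
    also have "\<dots> \<longleftrightarrow> \<not> S \<subseteq> \<tau>"
    proof (cases "x \<in> R")
      case True
      then show ?thesis using False \<open>\<tau> \<subseteq> \<sigma> - {x}\<close> by (auto simp: S_def)
    next
      case False
      then show ?thesis using X(4) unfolding S_def by simp blast
    qed
    finally show ?thesis .
  next
    case True
    define \<tau>' where "\<tau>' = \<tau> - {w}"
    have t: "\<tau> = insert w \<tau>'" "w \<notin> \<tau>'" "\<tau>' \<subseteq> \<sigma> - {x}" using True \<tau> by (auto simp: \<tau>'_def)
    have "\<tau> \<in> stellar F w K \<longleftrightarrow> \<tau>' \<in> K \<and> \<not> F \<subseteq> \<tau>' \<and> \<tau>' \<union> F \<in> K"
    proof
      assume "\<tau> \<in> stellar F w K"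
      moreover have "\<tau> \<notin> K" using w True by auto
      ultimately obtain \<rho> where "\<tau> = insert w \<rho>" "\<rho> \<in> K" "\<not> F \<subseteq> \<rho>" "\<rho> \<union> F \<in> K"
        by (auto simp: stellar_def)
      moreover have "w \<notin> \<rho>" using w \<open>\<rho> \<in> K\<close> by auto
      ultimately have "\<rho> = \<tau>'" using t by (metis insert_ident)
      then show "\<tau>' \<in> K \<and> \<not> F \<subseteq> \<tau>' \<and> \<tau>' \<union> F \<in> K"
        using \<open>\<rho> \<in> K\<close> \<open>\<not> F \<subseteq> \<rho>\<close> \<open>\<rho> \<union> F \<in> K\<close> by simp
    qed (auto simp: stellar_def t)
    also have "\<dots> \<longleftrightarrow> \<not> R - F \<subseteq> \<tau>'"
    proof -
      have "\<tau>' \<subseteq> \<sigma>" "\<tau>' \<union> F \<subseteq> \<sigma>" "\<not> F \<subseteq> \<tau>'" using t(3) F X(2) by auto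
      then show ?thesis using Kiff[of \<tau>'] Kiff[of "\<tau>' \<union> F"] by blast
    qed
    finally have "\<tau> \<in> stellar F w K \<longleftrightarrow> \<not> R - F \<subseteq> \<tau>'" .
    moreover have "\<tau> \<subseteq> insert w (\<sigma> - {z}) \<longleftrightarrow> z \<notin> \<tau>'" if "z \<in> X" for z
    proof -
      have "z \<noteq> w" using that w(2) X(1) F by blast
      then show ?thesis using t by blast
    qed
    then have "\<tau> \<in> (\<Union>z\<in>X. Pow (insert w (\<sigma> - {z}))) \<longleftrightarrow> \<not> X \<subseteq> \<tau>'"
      by blast
    moreover have "\<not> S \<subseteq> \<tau> \<longleftrightarrow> \<not> X \<union> (R - F) \<subseteq> \<tau>'" using t w X F R by (auto simp: S_def)
    ultimately show ?thesis by auto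
  qed
  then show ?thesis by blast
qed

lemma shelled_stellar:
  assumes "shelled n K" "F \<noteq> {}" "w \<notin> \<Union>K"
  shows "shelled n (stellar F w K)"
  using assms(1,3)
proof (induction rule: shelled.induct)
  case (simplex \<sigma>)
  show ?case
  proof (cases "F \<subseteq> \<sigma>")
    case True
    then show ?thesis
      using shelled_stellar_Pow[of \<sigma> F w F] simplex assms(2) by (simp add: stellar_Pow)
  next
    case False
    then have "stellar F w (Pow \<sigma>) = Pow \<sigma>" by (auto simp: stellar_def)
    then show ?thesis using simplex shelled.simplex by metis
  qed
next
  case (attach K \<sigma> R)
  have cp: "simplicial_cplx K" "simplicial_cplx (Pow \<sigma>)"
    using shelled_cplx[OF attach.hyps(1)] cplx_Pow[OF attach.hyps(2)] by auto
  have IH: "shelled n (stellar F w K)" using attach by auto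
  have w: "w \<notin> \<Union>K" "w \<notin> \<sigma>" using attach.prems by auto
  show ?case
  proof (cases "F \<subseteq> \<sigma>")
    case False
    then have "stellar F w (Pow \<sigma>) = Pow \<sigma>" by (auto simp: stellar_def)
    moreover have "stellar F w K \<inter> Pow \<sigma> = K \<inter> Pow \<sigma>"
      using False w by (auto simp: stellar_def)
    ultimately show ?thesis
      using attach IH shelled.attach[OF IH, of \<sigma> R] by (simp add: stellar_Un[OF cp])
  next
    case True
    define Y where "Y X = stellar F w K \<union> (\<Union>z\<in>X. Pow (insert w (\<sigma> - {z})))" for X
    have step: "shelled n (Y (insert x X))"
      if Y: "shelled n (Y X)" and X: "X \<subseteq> F" "x \<in> F" "x \<notin> X" "x \<notin> R \<Longrightarrow> R \<inter> F \<subseteq> X" for x X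
    proof -
      define S where "S = X \<union> (R - F) \<union> (if x \<in> R then {w} else {})"
      have "Y X \<inter> Pow (insert w (\<sigma> - {x})) = {\<tau>. \<tau> \<subseteq> insert w (\<sigma> - {x}) \<and> \<not> S \<subseteq> \<tau>}"
        unfolding Y_def S_def 
        by (rule stellar_attach_step[OF attach.hyps(4,6) True w X])
      moreover have "card (insert w (\<sigma> - {x})) = n"
        using X(2) True w(2) attach.hyps(2,3) card_swap[of \<sigma> x w] by auto
      moreover have "S \<noteq> {}" using X(4) attach.hyps(5) by (auto simp: S_def)
      moreover have "S \<subseteq> insert w (\<sigma> - {x})" using X(1,2,3) True attach.hyps(4)
          by (auto simp: S_def)
      moreover have "finite (insert w (\<sigma> - {x}))" using attach.hyps(2) by simp
      ultimately have "shelled n (Y X \<union> Pow (insert w (\<sigma> - {x})))"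
        by (intro shelled.attach[OF Y])
      then show ?thesis by (simp add: Y_def Un_ac)
    qed
    have fF: "finite F" using True attach.hyps(2) by (rule finite_subset)
    \<comment> \<open>The pieces with \<open>x \<in> R\<close> come first; once all of
      \<open>R \<inter> F\<close> is present, the side condition of \<open>step\<close> holds for
      every remaining \<open>x\<close>.\<close>
    have "shelled n (Y X)" if "X \<subseteq> R \<inter> F" for X
    proof -
      have "finite X" using that fF by (meson finite_subset Int_lower2 Diff_subset order_trans)
      then show ?thesis using that
        by (induction) (use IH step in \<open>auto simp: Y_def\<close>)
    qed
    then have b: "shelled n (Y (R \<inter> F))" by simp
    have "shelled n (Y (R \<inter> F \<union> X))" if "X \<subseteq> F - R" for X
    proof -
      have "finite X" using that fF by (meson finite_subset Int_lower2 Diff_subset order_trans)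
      then show ?thesis using that
      proof (induction)
        case empty then show ?case using b by simp
      next
        case (insert x X)
        then have "shelled n (Y (insert x (R \<inter> F \<union> X)))" by (intro step) auto
        then show ?case by simp
      qed
    qed
    then have "shelled n (Y (R \<inter> F \<union> (F - R)))" by blast
    moreover have "R \<inter> F \<union> (F - R) = F" by auto
    ultimately have "shelled n (Y F)" by simp
    then show ?thesis using True by (simp add: Y_def stellar_Un[OF cp] stellar_Pow)
  qed
qed

section \<open>Underlying spaces\<close>

definition geom :: "'a set set \<Rightarrow> ('a \<Rightarrow> real) set" where
  "geom K = {x. (\<forall>v. 0 \<le> x v) \<and> {v. x v \<noteq> 0} \<in> K \<and> (\<Sum>v | x v \<noteq> 0. x v) = 1}"

definition sph :: "nat \<Rightarrow> (nat \<Rightarrow> real) set" where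
  "sph d = {x. (\<Sum>i\<le>d. x i ^ 2) = 1 \<and> (\<forall>i>d. x i = 0)}"

lemma homeomorphic_maps_top_of_set:
  "homeomorphic_maps (top_of_set S) (top_of_set T) f g \<longleftrightarrow> homeomorphism S T f g"
proof
  assume "homeomorphic_maps (top_of_set S) (top_of_set T) f g"
  then show "homeomorphism S T f g"
    by (intro homeomorphismI) (auto simp: homeomorphic_maps_def continuous_map_subtopology_eu)
next
  assume "homeomorphism S T f g"
  then show "homeomorphic_maps (top_of_set S) (top_of_set T) f g"
    by (auto simp: homeomorphic_maps_def continuous_map_subtopology_eu homeomorphism_def)
qed

lemma homeomorphic_space_top_of_set:
  "top_of_set S homeomorphic_space top_of_set T \<longleftrightarrow> S homeomorphic T"
  by (simp add: homeomorphic_space_def homeomorphic_def homeomorphic_maps_top_of_set)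

lemma simplicial_sphere_iff:
  "simplicial_sphere d K \<longleftrightarrow> simplicial_cplx K \<and> geom K homeomorphic sph d"
  unfolding simplicial_sphere_def underlying_space_def nsphere geom_def sph_def
    euclidean_product_topology homeomorphic_space_top_of_set ..

lemma continuous_on_coord [continuous_intros]: "continuous_on S (\<lambda>x::'a \<Rightarrow> real. x v)"
  by (rule continuous_on_subset[OF continuous_on_product_coordinates]) simp

lemma continuous_on_if_const:
  "\<lbrakk>c \<Longrightarrow> continuous_on S f; \<not> c \<Longrightarrow> continuous_on S g\<rbrakk>
    \<Longrightarrow> continuous_on S (\<lambda>x. if c then f x else g x)"
  by (cases c) auto

lemma continuous_on_Min:
  fixes f :: "'b \<Rightarrow> 'c::topological_space \<Rightarrow> real"
  assumes "finite F" "F \<noteq> {}" "\<And>i. i \<in> F \<Longrightarrow> continuous_on S (f i)"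
  shows "continuous_on S (\<lambda>x. Min ((\<lambda>i. f i x) ` F))"
  using assms
proof (induction F rule: finite_ne_induct)
  case (insert i F)
  then have "continuous_on S (\<lambda>x. min (f i x) (Min ((\<lambda>i. f i x) ` F)))"
    by (intro continuous_intros) auto
  then show ?case using insert.hyps by simp
qed simp

lemma geom_iff:
  assumes "simplicial_cplx K" "finite V" "\<Union>K \<subseteq> V"
  shows "x \<in> geom K \<longleftrightarrow> (\<forall>v. 0 \<le> x v) \<and> {v. x v \<noteq> 0} \<in> K \<and> sum x V = 1"
proof -
  have "(\<Sum>v | x v \<noteq> 0. x v) = sum x V" if "{v. x v \<noteq> 0} \<in> K"
    using assms that by (intro sum.mono_neutral_left) auto
  then show ?thesis by (auto simp: geom_def)
qed

lemma finite_vertices: "simplicial_cplx K \<Longrightarrow> finite (\<Union>K)"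
  by (auto simp: simplicial_cplx_def)

section \<open>Stellar subdivision leaves the underlying space unchanged\<close>

lemma cplx_stellar:
  assumes "simplicial_cplx K" "F \<noteq> {}"
  shows "simplicial_cplx (stellar F w K)"
proof -
  have "\<tau> \<in> stellar F w K" if \<tau>: "\<tau> \<subseteq> \<sigma>" and \<sigma>: "\<sigma> \<in> stellar F w K" for \<sigma> \<tau>
  proof (cases "\<sigma> \<in> K \<and> \<not> F \<subseteq> \<sigma>")
    case True
    then show ?thesis using \<tau> cplx_subset[OF assms(1), of \<sigma> \<tau>] by (auto simp: stellar_def)
  next
    case False
    then obtain \<sigma>' where s: "\<sigma> = insert w \<sigma>'" "\<sigma>' \<in> K" "\<not> F \<subseteq> \<sigma>'" "\<sigma>' \<union> F \<in> K"
      using \<sigma> by (auto simp: stellar_def)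
    define \<tau>' where "\<tau>' = \<tau> \<inter> \<sigma>'"
    have "\<tau>' \<in> K" "\<not> F \<subseteq> \<tau>'" "\<tau>' \<union> F \<in> K"
      using s cplx_subset[OF assms(1) s(2), of \<tau>'] cplx_subset[OF assms(1) s(4), of "\<tau>' \<union> F"]
      by (auto simp: \<tau>'_def)
    moreover have "\<tau> = \<tau>' \<or> \<tau> = insert w \<tau>'" using \<tau> s by (auto simp: \<tau>'_def)
    ultimately show ?thesis by (auto simp: stellar_def)
  qed
  then show ?thesis using assms by (auto simp: simplicial_cplx_def stellar_def)
qed

text \<open>\<open>h\<close> sends \<open>w\<close> to the barycentre of \<open>F\<close>, spreading
  the weight of \<open>w\<close> evenly over \<open>F\<close>. A face of the subdivision misses some
  vertex of \<open>F\<close>, so after spreading the least coordinate on \<open>F\<close> is exactly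
  the share \<open>x w / c\<close>; hence \<open>g\<close> undoes \<open>h\<close> by subtracting
  the minimum \<open>m\<close>.\<close>

lemma geom_stellar:
  assumes K: "simplicial_cplx K" and F: "F \<in> K" "F \<noteq> {}" and w: "w \<notin> \<Union>K"
  shows "geom (stellar F w K) homeomorphic geom K"
proof -
  let ?S = "stellar F w K"
  have S: "simplicial_cplx ?S" using K F by (intro cplx_stellar)
  define V where "V = insert w (\<Union>K)"
  have V: "finite V" "\<Union>K \<subseteq> V" "\<Union>?S \<subseteq> V"
    using finite_vertices[OF K] by (auto simp: V_def stellar_def)
  have fF: "finite F" using F K by (auto simp: simplicial_cplx_def)
  have FV: "F \<subseteq> V - {w}" using F w by (auto simp: V_def)
  have wF: "w \<notin> F" using F w by auto
  define c where "c = real (card F)"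
  have c: "c > 0" using F fF by (simp add: c_def card_gt_0_iff)
  define m where "m y = Min ((\<lambda>v. y v) ` F)" for y :: "'a \<Rightarrow> real"
  define h where "h x = (\<lambda>v. if v = w then 0 else if v \<in> F then x v + x w / c else x v)" for x
  define g where "g y = (\<lambda>v. if v = w then c * m y else if v \<in> F then y v - m y else y v)" for y
  have mle: "m y \<le> y v" if "v \<in> F" for y v using that fF by (auto simp: m_def)
  have mex: "\<exists>v\<in>F. m y = y v" for y
  proof -
    have "m y \<in> (\<lambda>v. y v) ` F" unfolding m_def by (rule Min_in) (use fF F in auto)
    then show ?thesis by auto
  qed
  have sum_FV: "(\<Sum>v\<in>V - {w}. if v \<in> F then t else 0) = c * t" for t :: real
    using FV V fF by (simp add: c_def sum.If_cases Int_absorb1)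
  have gK: "x \<in> geom K \<longleftrightarrow> (\<forall>v. 0 \<le> x v) \<and> {v. x v \<noteq> 0} \<in> K \<and> sum x V = 1" for x
    by (rule geom_iff[OF K V(1,2)])
  have gS: "x \<in> geom ?S \<longleftrightarrow> (\<forall>v. 0 \<le> x v) \<and> {v. x v \<noteq> 0} \<in> ?S \<and> sum x V = 1" for x
    by (rule geom_iff[OF S V(1,3)])
  have sumV: "sum x V = x w + sum x (V - {w})" for x :: "'a \<Rightarrow> real"
    using finite_vertices[OF K] by (simp add: V_def sum.insert_remove)
  have sum_h: "sum (h x) V = sum x V" for x
  proof -
    have "sum (h x) (V - {w}) = (\<Sum>v\<in>V - {w}. x v + (if v \<in> F then x w / c else 0))"
      by (intro sum.cong) (auto simp: h_def)
    then show ?thesis using c by (simp add: sumV sum.distrib sum_FV) (simp add: h_def)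
  qed
  have sum_g: "sum (g y) V = sum y V" if "y w = 0" for y
  proof -
    have "sum (g y) (V - {w}) = (\<Sum>v\<in>V - {w}. y v - (if v \<in> F then m y else 0))"
      by (intro sum.cong) (auto simp: g_def)
    then show ?thesis using that by (simp add: sumV sum_subtractf sum_FV) (simp add: g_def)
  qed
  have suppS: "\<exists>\<tau>. w \<notin> \<tau> \<and> \<tau> \<in> K \<and> \<not> F \<subseteq> \<tau> \<and> ({v. x v \<noteq> 0} = \<tau> \<and> x w = 0 \<or> \<tau> \<union> F \<in> K
      \<and> {v. x v \<noteq> 0} = insert w \<tau> \<and> x w \<noteq> 0)"
    if "x \<in> geom ?S" for x
  proof -
    have "{v. x v \<noteq> 0} \<in> ?S" using that gS by auto
    then consider "{v. x v \<noteq> 0} \<in> K" "\<not> F \<subseteq> {v. x v \<noteq> 0}"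
      | \<tau> where "{v. x v \<noteq> 0} = insert w \<tau>" "\<tau> \<in> K" "\<not> F \<subseteq> \<tau>" "\<tau> \<union> F \<in> K"
      by (auto simp: stellar_def)
    then show ?thesis
    proof cases
      case 1
      then have "x w = 0" using w by auto
      then show ?thesis using 1 by (intro exI[of _ "{v. x v \<noteq> 0}"]) auto
    next
      case 2
      have "w \<notin> \<tau>" using 2 w by auto
      moreover have "x w \<noteq> 0" using 2 by auto
      ultimately show ?thesis using 2 by (intro exI[of _ \<tau>]) auto
    qed
  qed
  have hin: "h x \<in> geom K" if x: "x \<in> geom ?S" for x
  proof -
    have nn: "\<forall>v. 0 \<le> x v" and s1: "sum x V = 1" using x gS by auto
    obtain \<tau> where t: "w \<notin> \<tau>" "\<tau> \<in> K" "\<not> F \<subseteq> \<tau>" and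
      d: "{v. x v \<noteq> 0} = \<tau> \<and> x w = 0 \<or> \<tau> \<union> F \<in> K \<and> {v. x v \<noteq> 0} = insert w \<tau> \<and> x w \<noteq> 0"
      using suppS[OF x] by metis
    have "{v. h x v \<noteq> 0} \<in> K"
      using d
    proof
      assume "{v. x v \<noteq> 0} = \<tau> \<and> x w = 0"
      then have "{v. h x v \<noteq> 0} = \<tau>" by (auto simp: h_def split: if_splits)
      then show ?thesis using t by simp
    next
      assume a: "\<tau> \<union> F \<in> K \<and> {v. x v \<noteq> 0} = insert w \<tau> \<and> x w \<noteq> 0"
      have xw: "x w > 0" using a nn by (simp add: order_less_le)
      have "h x v \<noteq> 0 \<longleftrightarrow> v \<in> \<tau> \<union> F" for v
      proof (cases "v \<in> F")
        case True
        have "x v + x w / c > 0" using xw c nn by (simp add: add_nonneg_pos)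
        then show ?thesis using True wF by (auto simp: h_def)
      next
        case False
        then show ?thesis using a t by (auto simp: h_def)
      qed
      then have "{v. h x v \<noteq> 0} = \<tau> \<union> F" by auto
      then show ?thesis using a by simp
    qed
    moreover have "\<forall>v. 0 \<le> h x v" using nn c by (auto simp: h_def)
    ultimately show ?thesis using gK sum_h s1 by auto
  qed
  have gin: "g y \<in> geom ?S" if y: "y \<in> geom K" for y
  proof -
    have nn: "\<forall>v. 0 \<le> y v" and s1: "sum y V = 1" and sp: "{v. y v \<noteq> 0} \<in> K" using y gK by auto
    have yw: "y w = 0" using sp w by blast
    obtain u where u: "u \<in> F" "m y = y u" using mex by blast
    have m0: "m y \<ge> 0" using u nn by auto
    have "{v. g y v \<noteq> 0} \<in> ?S"
    proof (cases "m y = 0")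
      case True
      then have "{v. g y v \<noteq> 0} = {v. y v \<noteq> 0}" using yw by (auto simp: g_def)
      moreover have "\<not> F \<subseteq> {v. y v \<noteq> 0}" using u True by auto
      ultimately show ?thesis using sp by (auto simp: stellar_def)
    next
      case False
      \<comment> \<open>The vertices of \<open>F\<close> at which the minimum is attained drop out
        of the support, and \<open>w\<close> enters it.\<close>
      define \<tau> where "\<tau> = {v. y v \<noteq> 0 \<and> \<not> (v \<in> F \<and> y v = m y)}"
      have "y v \<noteq> 0" if "v \<in> F" for v using False m0 mle[OF that, of y] by auto
      then have "\<tau> \<union> F \<subseteq> {v. y v \<noteq> 0}" by (auto simp: \<tau>_def)
      then have "\<tau> \<union> F \<in> K" "\<tau> \<in> K" using cplx_subset[OF K sp] by auto
      moreover have "\<not> F \<subseteq> \<tau>" using u by (auto simp: \<tau>_def)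
      moreover have "{v. g y v \<noteq> 0} = insert w \<tau>"
        using False c \<open>\<tau> \<union> F \<subseteq> {v. y v \<noteq> 0}\<close> by (auto simp: g_def \<tau>_def)
      ultimately show ?thesis by (auto simp: stellar_def)
    qed
    moreover have "\<forall>v. 0 \<le> g y v" using nn m0 c mle[of _ y] by (auto simp: g_def)
    ultimately show ?thesis using gS[of "g y"] sum_g[of y] yw s1 by auto
  qed
  have hg: "h (g y) = y" if y: "y \<in> geom K" for y
  proof -
    have "{v. y v \<noteq> 0} \<in> K" using y gK by auto
    then have yw: "y w = 0" using w by blast
    then show ?thesis using c by (auto simp: h_def g_def wF fun_eq_iff)
  qed
  have gh: "g (h x) = x" if x: "x \<in> geom ?S" for x
  proof -
    have nn: "\<forall>v. 0 \<le> x v" using x gS by auto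
    obtain u where u: "u \<in> F" "x u = 0"
    proof -
      obtain \<tau> where t: "w \<notin> \<tau>" "\<not> F \<subseteq> \<tau>" "{v. x v \<noteq> 0} \<subseteq> insert w \<tau>"
        using suppS[OF x] by (metis subset_insertI order_refl)
      then obtain u where "u \<in> F" "u \<notin> \<tau>" by blast
      then have "x u = 0" using t wF by auto
      then show ?thesis using that \<open>u \<in> F\<close> by blast
    qed
    have "m (h x) = x w / c"
      unfolding m_def
    proof (rule Min_eqI)
      show "x w / c \<le> t" if "t \<in> h x ` F" for t
        using that nn wF by (auto simp: h_def)
      show "x w / c \<in> h x ` F"
        using u wF by (intro image_eqI[of _ _ u]) (auto simp: h_def)
    qed (use fF in simp)
    then show ?thesis using c wF by (auto simp: g_def h_def fun_eq_iff)
  qed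
  have "homeomorphism (geom ?S) (geom K) h g"
  proof (rule homeomorphismI)
    show "continuous_on (geom ?S) h" unfolding h_def
      by (intro continuous_on_coordinatewise_then_product continuous_on_if_const continuous_intros)
        (use c in auto)
    show "continuous_on (geom K) g" unfolding g_def m_def
      by (intro continuous_on_coordinatewise_then_product continuous_on_if_const continuous_intros
          continuous_on_Min F fF)
  qed (use hin gin hg gh in auto)
  then show ?thesis by (auto simp: homeomorphic_def)
qed

section \<open>The boundary of a simplex as the initial sphere\<close>

definition simplex_boundary :: "'a set \<Rightarrow> 'a set set" where
  "simplex_boundary V = {\<tau>. \<tau> \<subset> V}"

lemma shelled_simplex_boundary:
  assumes "finite V" "V \<noteq> {}"
  shows "shelled (card V - 1) (simplex_boundary V)"
proof -
  have "simplex_boundary V = {\<tau>. \<tau> \<subseteq> V \<and> \<not> V \<subseteq> \<tau>}" by (auto simp: simplex_boundary_def)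
  then show ?thesis using shelled_ridges[OF assms(1) subset_refl assms(2)] by simp
qed

text \<open>Both sets are cross-sections of the rays in real (d+2)-space modulo constant vectors. A
  nonzero class has a representative with last coordinate 0, which \<open>h\<close> scales to
  Euclidean norm 1, and one with minimum 0, which \<open>g\<close> scales to coordinate sum
  1.\<close>

lemma geom_simplex_boundary: "geom (simplex_boundary {..Suc d}) homeomorphic sph d"
proof -
  let ?K = "simplex_boundary {..Suc d}"
  have K: "simplicial_cplx ?K"
    using shelled_cplx[OF shelled_simplex_boundary[of "{..Suc d}"]] by simp
  have gK: "x \<in> geom ?K \<longleftrightarrow> (\<forall>v. 0 \<le> x v) \<and> {v. x v \<noteq> 0} \<subset> {..Suc d} \<and> sum x {..Suc d} = 1" for x
    using geom_iff[OF K, of "{..Suc d}" x] by (auto simp: simplex_boundary_def)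
  define N where "N x = sqrt (\<Sum>i\<le>d. (x i - x (Suc d))\<^sup>2)" for x :: "nat \<Rightarrow> real"
  define h where "h x = (\<lambda>i. if i \<le> d then (x i - x (Suc d)) / N x else 0)" for x :: "nat \<Rightarrow> real"
  define m where "m y = Min ((\<lambda>v. y v) ` {..Suc d})" for y :: "nat \<Rightarrow> real"
  define s where "s y = (\<Sum>i\<le>Suc d. y i - m y)" for y :: "nat \<Rightarrow> real"
  define g where "g y = (\<lambda>i. if i \<le> Suc d then (y i - m y) / s y else 0)" for y :: "nat \<Rightarrow> real"
  have mle: "m y \<le> y v" if "v \<le> Suc d" for y v using that by (auto simp: m_def)
  have mex: "\<exists>v\<le>Suc d. m y = y v" for y
  proof -
    have "m y \<in> (\<lambda>v. y v) ` {..Suc d}" unfolding m_def by (rule Min_in) auto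
    then show ?thesis by auto
  qed
  have mI: "m y = t" if "\<And>i. i \<le> Suc d \<Longrightarrow> t \<le> y i" "j \<le> Suc d" "y j = t" for y t j
    unfolding m_def using that by (intro Min_eqI) auto
  have spos: "s y > 0" if "i \<le> Suc d" "y i \<noteq> y (Suc d)" for y i
  proof -
    have "s y \<ge> 0" unfolding s_def by (intro sum_nonneg) (auto simp: mle)
    moreover have "s y \<noteq> 0"
    proof
      assume "s y = 0"
      then have "\<forall>i\<in>{..Suc d}. y i - m y = 0"
        unfolding s_def by (subst (asm) sum_nonneg_eq_0_iff) (auto simp: mle)
      then have "y i = m y" "y (Suc d) = m y" using that(1) by auto
      then show False using that by simp
    qed
    ultimately show ?thesis by simp
  qed
  have Npos: "N x > 0" if "i \<le> d" "x i \<noteq> x (Suc d)" for x i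
  proof -
    have "0 < (x i - x (Suc d))\<^sup>2" using that by simp
    also have "\<dots> \<le> (\<Sum>i\<le>d. (x i - x (Suc d))\<^sup>2)"
      using that by (intro member_le_sum) auto
    finally show ?thesis by (simp add: N_def)
  qed
  have noneq: "\<exists>i\<le>d. x i \<noteq> x (Suc d)" if x: "x \<in> geom ?K" for x
  proof (rule ccontr)
    assume "\<not> ?thesis"
    then have eq: "x i = x (Suc d)" if "i \<le> Suc d" for i using that le_Suc_eq by blast
    obtain j where "j \<le> Suc d" "x j = 0" using x gK by blast
    then have "sum x {..Suc d} = 0" using eq by (intro sum.neutral) (metis atMost_iff)
    then show False using x gK by auto
  qed
  have noneqS: "\<exists>i\<le>d. y i \<noteq> y (Suc d)" if y: "y \<in> sph d" for y
  proof (rule ccontr)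
    assume "\<not> ?thesis"
    moreover have "y (Suc d) = 0" using y by (simp add: sph_def)
    ultimately have "(\<Sum>i\<le>d. (y i)\<^sup>2) = 0" by (intro sum.neutral) auto
    then show False using y by (simp add: sph_def)
  qed
  have NS: "N y = 1" if y: "y \<in> sph d" for y using y by (simp add: N_def sph_def)
  have Ndiv: "N (\<lambda>i. (y i - a) / b) = N y / b" if "b > 0" for y and a b :: real
  proof -
    have "(\<Sum>i\<le>d. ((y i - a) / b - (y (Suc d) - a) / b)\<^sup>2) = (\<Sum>i\<le>d. (y i - y (Suc d))\<^sup>2) / b\<^sup>2"
      by (simp add: sum_divide_distrib flip: diff_divide_distrib) (simp add: power_divide)
    then show ?thesis using that by (simp add: N_def real_sqrt_divide)
  qed
  have hin: "h x \<in> sph d" if x: "x \<in> geom ?K" for x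
  proof -
    have "N x > 0" using noneq[OF x] Npos by blast
    then have "(\<Sum>i\<le>d. (x i - x (Suc d))\<^sup>2) > 0" by (simp add: N_def)
    then have "(\<Sum>i\<le>d. (h x i)\<^sup>2) = 1"
      by (simp add: h_def N_def power_divide flip: sum_divide_distrib)
    then show ?thesis by (auto simp: sph_def h_def)
  qed
  have gin: "g y \<in> geom ?K" if y: "y \<in> sph d" for y
  proof -
    have s: "s y > 0" using noneqS[OF y] spos by (meson le_SucI)
    obtain u where u: "u \<le> Suc d" "m y = y u" using mex by blast
    have "(\<Sum>i\<le>Suc d. (y i - m y) / s y) = 1"
      using s by (simp add: s_def flip: sum_divide_distrib del: sum.atMost_Suc)
    then have "sum (g y) {..Suc d} = 1" by (simp add: g_def del: sum.atMost_Suc)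
    moreover have "g y u = 0" using u by (simp add: g_def)
    moreover have "\<forall>v. 0 \<le> g y v" using s mle by (auto simp: g_def)
    moreover have "{v. g y v \<noteq> 0} \<subseteq> {..Suc d}" by (auto simp: g_def)
    ultimately show ?thesis using gK u by auto
  qed
  have hg: "h (g y) = y" if y: "y \<in> sph d" for y
  proof -
    have s: "s y > 0" using noneqS[OF y] spos by (meson le_SucI)
    have y0: "y (Suc d) = 0" "\<And>i. i > d \<Longrightarrow> y i = 0" using y by (auto simp: sph_def)
    have "N (g y) = N (\<lambda>i. (y i - m y) / s y)" by (simp add: N_def g_def)
    then have N: "N (g y) = 1 / s y" using Ndiv[OF s] NS[OF y] by simp
    show ?thesis
    proof
      fix i
      show "h (g y) i = y i"
      proof (cases "i \<le> d")
        case True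
        then have "h (g y) i = ((y i - m y) / s y - (y (Suc d) - m y) / s y) * s y"
          by (simp add: h_def N) (simp add: g_def)
        also have "\<dots> = y i" using s y0 by (simp add: field_simps)
        finally show ?thesis .
      qed (simp add: h_def y0)
    qed
  qed
  have gh: "g (h x) = x" if x: "x \<in> geom ?K" for x
  proof -
    have N: "N x > 0" using noneq[OF x] Npos by blast
    have nn: "\<forall>v. 0 \<le> x v" and sp: "{v. x v \<noteq> 0} \<subset> {..Suc d}" and s1: "sum x {..Suc d} = 1"
      using x gK by auto
    have x0: "x i = 0" if "i > Suc d" for i using sp that
        by (metis (mono_tags, lifting) atMost_iff mem_Collect_eq not_le psubsetD)
    have hx: "h x i = (x i - x (Suc d)) / N x" if "i \<le> Suc d" for i
      using that by (cases "i = Suc d") (auto simp: h_def)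
    obtain u where u: "u \<le> Suc d" "x u = 0" using sp by blast
    have m: "m (h x) = - x (Suc d) / N x"
    proof (rule mI)
      show "h x u = - x (Suc d) / N x" using u by (simp add: hx)
      show "- x (Suc d) / N x \<le> h x i" if "i \<le> Suc d" for i
        unfolding hx[OF that] by (rule divide_right_mono) (use nn N in auto)
    qed (rule u)
    have d: "h x i - m (h x) = x i / N x" if "i \<le> Suc d" for i
      using that by (simp add: hx m diff_divide_distrib)
    have "s (h x) = (\<Sum>i\<le>Suc d. x i / N x)" unfolding s_def by (intro sum.cong) (auto simp: d)
    also have "\<dots> = 1 / N x" using s1 by (simp del: sum.atMost_Suc flip: sum_divide_distrib)
    finally have s: "s (h x) = 1 / N x" .
    show ?thesis
    proof
      fix i
      show "g (h x) i = x i"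
        using N by (cases "i \<le> Suc d") (simp_all add: g_def d s x0)
    qed
  qed
  have "homeomorphism (geom ?K) (sph d) h g"
  proof (rule homeomorphismI)
    have "N x \<noteq> 0" if "x \<in> geom ?K" for x using noneq[OF that] Npos by (metis less_irrefl)
    then show "continuous_on (geom ?K) h" unfolding h_def N_def
      by (intro continuous_on_coordinatewise_then_product continuous_on_if_const continuous_intros)
        auto
    have "s y \<noteq> 0" if "y \<in> sph d" for y
      using noneqS[OF that] spos by (metis le_SucI less_irrefl)
    moreover have cm: "continuous_on (sph d) m" unfolding m_def
      by (rule continuous_on_Min) (auto intro: continuous_intros)
    moreover have "continuous_on (sph d) s" unfolding s_def
      by (intro continuous_intros cm)
    ultimately show "continuous_on (sph d) g" unfolding g_def
      by (intro continuous_on_coordinatewise_then_product continuous_on_if_const continuous_intros)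
        auto
  qed (use hin gin hg gh in auto)
  then show ?thesis by (auto simp: homeomorphic_def)
qed

section \<open>Consequences of invariance of domain\<close>

text \<open>Spaces of all dimensions live in one type, with \<open>euc n \<subseteq> euc m\<close>
  for \<open>n \<le> m\<close>, so the dimension may be a variable.\<close>

definition euc :: "nat \<Rightarrow> (nat \<Rightarrow> real) set" where
  "euc n = {x. \<forall>i\<ge>n. x i = 0}"

text \<open>
  The open cone over the underlying space, without its apex. For a \<open>d\<close>-sphere it is a punctured
  \<open>(d+1)\<close>-space, so no charts of the sphere are needed.
\<close>

definition ocone :: "'a set set \<Rightarrow> ('a \<Rightarrow> real) set" where
  "ocone K = {x. (\<forall>v. 0 \<le> x v) \<and> {v. x v \<noteq> 0} \<in> K \<and> x \<noteq> (\<lambda>_. 0)}"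

lemma invariance_of_domain_euc:
  assumes "n \<le> m" "openin (top_of_set (euc m)) U" "continuous_on U f" "f ` U \<subseteq> euc n" "inj_on f U"
  shows "openin (top_of_set (euc n)) (f ` U)"
proof -
  have E: "Euclidean_space k = top_of_set (euc k)" for k
    by (simp add: Euclidean_space_def euc_def euclidean_product_topology)
  have U: "U \<subseteq> euc m" using assms(2) by (rule openin_imp_subset)
  have "continuous_map (subtopology (Euclidean_space m) U) (Euclidean_space n) f"
    using assms(3,4) U by (simp add: E subtopology_subtopology Int_absorb1
        continuous_map_subtopology_eu Pi_iff image_subset_iff)
  then show ?thesis
    using invariance_of_domain_Euclidean_space_gen[OF assms(1)] assms(2,5) by (simp add: E)
qed

text \<open>The device for refuting openness: an open set cannot be left at once along a path. The
  half-line as parameter range suits coordinates that can only grow from 0.\<close>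

lemma path_in_openin:
  fixes \<gamma> :: "real \<Rightarrow> 'b::topological_space"
  assumes "openin (top_of_set S) W" "continuous_on {0..} \<gamma>" "\<gamma> ` {0..} \<subseteq> S" "\<gamma> 0 \<in> W"
  shows "\<exists>e>0. \<gamma> e \<in> W"
proof -
  have "openin (top_of_set {0..}) ({0..} \<inter> \<gamma> -` W)"
    using continuous_openin_preimage[OF assms(2) _ assms(1)] assms(3) by auto
  then obtain T where T: "open T" "{0..} \<inter> \<gamma> -` W = {0..} \<inter> T" by (auto simp: openin_open)
  have "0 \<in> T" using T(2) assms(4) by auto
  then obtain e where e: "e > 0" "ball 0 e \<subseteq> T" using T(1) open_contains_ball by blast
  have "e / 2 \<in> ball 0 e" using e(1) by (simp add: dist_real_def)
  then have "e / 2 \<in> {0..} \<inter> T" using e by auto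
  then have "\<gamma> (e / 2) \<in> W" using T(2) by blast
  then show ?thesis using e(1) by (intro exI[of _ "e/2"]) simp
qed

text \<open>By invariance of domain the image would be open in \<open>euc m\<close>; but it lies in
  \<open>euc n\<close>, and every move in coordinate \<open>n\<close> leaves it.\<close>

lemma no_embedding_euc:
  assumes "n < m" "openin (top_of_set (euc m)) U" "continuous_on U f" "f ` U \<subseteq> euc n" "inj_on f U"
  shows "U = {}"
proof (rule ccontr)
  assume "U \<noteq> {}"
  then obtain x where x: "x \<in> U" by auto
  have "euc n \<subseteq> euc m" using assms(1) by (auto simp: euc_def)
  then have op: "openin (top_of_set (euc m)) (f ` U)"
    using invariance_of_domain_euc[of m m U f] assms by auto
  have fx: "f x \<in> euc n" using x assms(4) by auto
  have "continuous_on {0..} (\<lambda>t. (f x)(n := t))"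
    unfolding fun_upd_def by (intro continuous_on_coordinatewise_then_product
        continuous_on_if_const continuous_intros)
  moreover have "(\<lambda>t. (f x)(n := t)) ` {0..} \<subseteq> euc m" using fx assms(1) by (auto simp: euc_def)
  moreover have "(f x)(n := 0) = f x" using fx by (auto simp: euc_def)
  ultimately obtain e where "e > 0" "(f x)(n := e) \<in> f ` U"
    using path_in_openin[OF op, of "\<lambda>t. (f x)(n := t)"] x by auto
  then have "(f x)(n := e) \<in> euc n" using assms(4) by auto
  then show False using \<open>e > 0\<close> by (auto simp: euc_def dest!: spec[of _ n])
qed

text \<open>Radial extension of the given homeomorphism: the coordinate sum \<open>s\<close> is the
  radius in the cone, the Euclidean norm \<open>N\<close> the radius in the target, and
  \<open>\<Phi>\<close> preserves the radius.\<close>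

lemma ocone_homeomorphic:
  assumes K: "simplicial_cplx K" and h: "geom K homeomorphic sph d"
  shows "ocone K homeomorphic (euc (Suc d) - {\<lambda>_. 0})"
proof -
  obtain \<phi> \<psi> where pp: "homeomorphism (geom K) (sph d) \<phi> \<psi>" using h by (auto simp: homeomorphic_def)
  define V where "V = \<Union>K"
  have V: "finite V" using finite_vertices[OF K] by (simp add: V_def)
  have gK: "x \<in> geom K \<longleftrightarrow> (\<forall>v. 0 \<le> x v) \<and> {v. x v \<noteq> 0} \<in> K \<and> sum x V = 1" for x
    by (rule geom_iff[OF K V]) (simp add: V_def)
  define s where "s x = sum x V" for x :: "'a \<Rightarrow> real"
  define N where "N y = sqrt (\<Sum>i\<le>d. (y i)\<^sup>2)" for y :: "nat \<Rightarrow> real"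
  define \<Phi> where "\<Phi> x = (\<lambda>i. s x * \<phi> (\<lambda>v. x v / s x) i)" for x
  define \<Psi> where "\<Psi> y = (\<lambda>v. N y * \<psi> (\<lambda>i. y i / N y) v)" for y
  have spos: "s x > 0" if "x \<in> ocone K" for x
  proof -
    have nn: "\<forall>v. 0 \<le> x v" and "x \<noteq> (\<lambda>_. 0)" and K': "{v. x v \<noteq> 0} \<in> K"
        using that by (auto simp: ocone_def)
    then obtain v where "x v \<noteq> 0" by (auto simp: fun_eq_iff)
    then have "v \<in> V" "x v > 0" using K' nn by (auto simp: V_def order_less_le)
    then show ?thesis unfolding s_def using V nn by (intro sum_pos2[of V v]) auto
  qed
  have Npos: "N y > 0" if "y \<in> euc (Suc d) - {\<lambda>_. 0}" for y
  proof -
    have "y \<noteq> (\<lambda>_. 0)" using that by simp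
    then obtain i where i: "y i \<noteq> 0" by (auto simp: fun_eq_iff)
    then have "i \<le> d" using that by (auto simp: euc_def not_less_eq_eq intro: ccontr)
    then have "(\<Sum>i\<le>d. (y i)\<^sup>2) > 0" using i by (intro sum_pos2[of _ i]) auto
    then show ?thesis by (simp add: N_def)
  qed
  have a: "(\<lambda>v. x v / s x) \<in> geom K" if "x \<in> ocone K" for x
    using spos[OF that] that by (auto simp: gK ocone_def s_def simp flip: sum_divide_distrib)
  have b: "(\<lambda>i. y i / N y) \<in> sph d" if "y \<in> euc (Suc d) - {\<lambda>_. 0}" for y
    using Npos[OF that] that
    by (auto simp: sph_def euc_def N_def power_divide simp flip: sum_divide_distrib)
  have \<phi>: "\<phi> x \<in> sph d" "\<psi> (\<phi> x) = x" if "x \<in> geom K" for x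
    using pp that by (auto simp: homeomorphism_def)
  have \<psi>: "\<psi> y \<in> geom K" "\<phi> (\<psi> y) = y" if "y \<in> sph d" for y
    using pp that by (auto simp: homeomorphism_def)
  have sc: "s (\<lambda>v. c * x v) = c * s x" for c x by (simp add: s_def sum_distrib_left)
  have Nc: "N (\<lambda>v. c * x v) = c * N x" if "c > 0" for c x
    using that by (simp add: N_def power_mult_distrib real_sqrt_mult flip: sum_distrib_left)
  have N1: "N y = 1" if "y \<in> sph d" for y using that by (simp add: N_def sph_def)
  have s1: "s x = 1" if "x \<in> geom K" for x using that gK by (simp add: s_def)
  have "homeomorphism (ocone K) (euc (Suc d) - {\<lambda>_. 0}) \<Phi> \<Psi>"
  proof (rule homeomorphismI)
    show "continuous_on (ocone K) \<Phi>"
    proof -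
      have cs: "continuous_on (ocone K) s" unfolding s_def by (intro continuous_intros)
      have c1: "continuous_on (ocone K) (\<lambda>x v. x v / s x)"
        by (intro continuous_on_coordinatewise_then_product continuous_intros cs) (use spos in
            force)
      have c2: "continuous_on (geom K) \<phi>" using pp by (auto simp: homeomorphism_def)
      have "continuous_on (ocone K) (\<lambda>x. \<phi> (\<lambda>v. x v / s x))"
        by (rule continuous_on_compose2[OF c2 c1]) (use a in auto)
      then have "continuous_on (ocone K) (\<lambda>x. \<phi> (\<lambda>v. x v / s x) i)" for i
        by (rule continuous_on_product_then_coordinatewise)
      then show ?thesis unfolding \<Phi>_def
        by (intro continuous_on_coordinatewise_then_product continuous_intros cs)
    qed
    show "continuous_on (euc (Suc d) - {\<lambda>_. 0}) \<Psi>"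
    proof -
      have cs: "continuous_on (euc (Suc d) - {\<lambda>_. 0}) N" unfolding N_def
          by (intro continuous_intros)
      have c1: "continuous_on (euc (Suc d) - {\<lambda>_. 0}) (\<lambda>x v. x v / N x)"
        by (intro continuous_on_coordinatewise_then_product continuous_intros cs) (use Npos in
            force)
      have c2: "continuous_on (sph d) \<psi>" using pp by (auto simp: homeomorphism_def)
      have "continuous_on (euc (Suc d) - {\<lambda>_. 0}) (\<lambda>x. \<psi> (\<lambda>v. x v / N x))"
        by (rule continuous_on_compose2[OF c2 c1]) (use b in auto)
      then have "continuous_on (euc (Suc d) - {\<lambda>_. 0}) (\<lambda>x. \<psi> (\<lambda>v. x v / N x) i)" for i
        by (rule continuous_on_product_then_coordinatewise)
      then show ?thesis unfolding \<Psi>_def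
        by (intro continuous_on_coordinatewise_then_product continuous_intros cs)
    qed
    show "\<Phi> ` ocone K \<subseteq> euc (Suc d) - {\<lambda>_. 0}"
    proof (rule image_subsetI)
      fix x assume x: "x \<in> ocone K"
      have p: "\<phi> (\<lambda>v. x v / s x) \<in> sph d" using \<phi> a[OF x] by auto
      have "N (\<Phi> x) = s x" unfolding \<Phi>_def using Nc[OF spos[OF x]] N1[OF p] by simp
      then have "\<Phi> x \<noteq> (\<lambda>_. 0)" using spos[OF x] by (auto simp: N_def)
      then show "\<Phi> x \<in> euc (Suc d) - {\<lambda>_. 0}" using p by (auto simp: \<Phi>_def euc_def sph_def)
    qed
    show "\<Psi> ` (euc (Suc d) - {\<lambda>_. 0}) \<subseteq> ocone K"
    proof (rule image_subsetI)
      fix y assume y: "y \<in> euc (Suc d) - {\<lambda>_. 0}"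
      have p: "\<psi> (\<lambda>v. y v / N y) \<in> geom K" using \<psi> b[OF y] by auto
      have "s (\<Psi> y) = N y" unfolding \<Psi>_def using sc s1[OF p] by simp
      then have "\<Psi> y \<noteq> (\<lambda>_. 0)" using Npos[OF y] by (auto simp: s_def)
      then show "\<Psi> y \<in> ocone K" using p Npos[OF y] by (auto simp: \<Psi>_def ocone_def gK)
    qed
    show "\<Psi> (\<Phi> x) = x" if x: "x \<in> ocone K" for x
    proof -
      have p: "\<phi> (\<lambda>v. x v / s x) \<in> sph d" using \<phi> a[OF x] by auto
      have N: "N (\<Phi> x) = s x" unfolding \<Phi>_def using Nc[OF spos[OF x]] N1[OF p] by simp
      have "(\<lambda>i. \<Phi> x i / N (\<Phi> x)) = \<phi> (\<lambda>v. x v / s x)"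
        unfolding N using spos[OF x] by (simp add: \<Phi>_def)
      then show ?thesis unfolding \<Psi>_def using spos[OF x] \<phi>(2)[OF a[OF x]] by (simp add: N)
    qed
    show "\<Phi> (\<Psi> y) = y" if y: "y \<in> euc (Suc d) - {\<lambda>_. 0}" for y
    proof -
      have p: "\<psi> (\<lambda>v. y v / N y) \<in> geom K" using \<psi> b[OF y] by auto
      have s: "s (\<Psi> y) = N y" unfolding \<Psi>_def using sc s1[OF p] by simp
      have "(\<lambda>i. \<Psi> y i / s (\<Psi> y)) = \<psi> (\<lambda>v. y v / N y)"
        unfolding s using Npos[OF y] by (simp add: \<Psi>_def)
      then show ?thesis unfolding \<Phi>_def using Npos[OF y] \<psi>(2)[OF b[OF y]] by (simp add: s)
    qed
  qed
  then show ?thesis by (auto simp: homeomorphic_def)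
qed

section \<open>Facet dimension and thinness of shelled spheres\<close>

lemma openin_positive:
  "openin (top_of_set S) {x\<in>S. \<forall>v\<in>\<sigma>. 0 < x v}" if "finite \<sigma>" for S :: "('a \<Rightarrow> real) set"
proof -
  have "open {x. \<forall>v\<in>\<sigma>. (0::real) < x v}"
  proof -
    have "open (\<Inter>v\<in>\<sigma>. {x. (0::real) < x v})"
      using that by (intro open_INT ballI open_Collect_less continuous_intros) auto
    moreover have "(\<Inter>v\<in>\<sigma>. {x. (0::real) < x v}) = {x. \<forall>v\<in>\<sigma>. 0 < x v}" by auto
    ultimately show ?thesis by simp
  qed
  then show ?thesis by (auto simp: openin_open)
qed

text \<open>Each inequality yields an embedding into too small a dimension. If \<open>m < n\<close>,
  the open cone over a facet is an open orthant of \<open>euc n\<close> mapped into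
  \<open>euc m\<close>. If \<open>n < m\<close>, the points positive on a facet form an open set of
  the cone; as no face is larger, their support is exactly that facet, so \<open>n\<close>
  coordinates determine them.\<close>

lemma sphere_facet_card:
  assumes K: "shelled n K" and h: "ocone K homeomorphic (euc m - {\<lambda>_. 0})" and "m > 0"
  shows "n = m"
proof -
  have op0: "openin (top_of_set (euc m)) (euc m - {\<lambda>_. 0})"
    by (auto simp: openin_open intro!: exI[of _ "- {\<lambda>_. 0}"])
  obtain \<Phi> \<Psi> where pp: "homeomorphism (ocone K) (euc m - {\<lambda>_. 0}) \<Phi> \<Psi>"
      using h by (auto simp: homeomorphic_def)
  have \<Phi>: "\<Phi> x \<in> euc m - {\<lambda>_. 0}" "\<Psi> (\<Phi> x) = x" if "x \<in> ocone K" for x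
    using pp that by (auto simp: homeomorphism_def)
  obtain \<sigma> where s: "\<sigma> \<in> K" "card \<sigma> = n" using shelled_ex_facet[OF K] by (auto simp: facets_def)
  have fs: "finite \<sigma>" using shelled_finite_face[OF K s(1)] .
  obtain b where b: "bij_betw b {..<n} \<sigma>" using ex_bij_betw_nat_finite[OF fs] s
      by (auto simp: atLeast0LessThan)
  have bi: "b i \<in> \<sigma>" if "i < n" for i using b that by (auto simp: bij_betw_def)
  have "n \<noteq> 0"
  proof
    assume "n = 0"
    then have "\<tau> = {}" if "\<tau> \<in> K" for \<tau>
      using shelled_card_le[OF K that] shelled_finite_face[OF K that] by simp
    then have "ocone K = {}" by (fastforce simp: ocone_def fun_eq_iff)
    moreover have "(\<lambda>i. if i = 0 then 1 else 0) \<in> euc m - {\<lambda>_. 0}"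
      using \<open>m > 0\<close> by (auto simp: euc_def fun_eq_iff)
    ultimately show False using pp by (auto simp: homeomorphism_def)
  qed
  have "\<not> m < n"
  proof
    assume "m < n"
    define U where "U = {y\<in>euc n. \<forall>i\<in>{..<n}. 0 < y i}"
    define j where "j y = (\<lambda>v. if v \<in> \<sigma> then y (inv_into {..<n} b v) else 0)" for y :: "nat \<Rightarrow> real"
    have jb: "j y (b i) = y i" if "i < n" for y i
      using that b bi by (simp add: j_def bij_betw_inv_into_left)
    have ij: "inv_into {..<n} b v < n" if "v \<in> \<sigma>" for v
      using that b by (metis bij_betw_def inv_into_into lessThan_iff)
    have jc: "j y \<in> ocone K" if "y \<in> U" for y
    proof -
      have pos: "0 < j y v" if "v \<in> \<sigma>" for v using that \<open>y \<in> U\<close> ij by (auto simp: j_def U_def)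
      have "{v. j y v \<noteq> 0} = \<sigma>"
      proof (intro equalityI subsetI)
        show "v \<in> \<sigma>" if "v \<in> {v. j y v \<noteq> 0}" for v using that by (auto simp: j_def split: if_splits)
        show "v \<in> {v. j y v \<noteq> 0}" if "v \<in> \<sigma>" for v using pos[OF that] by simp
      qed
      moreover have "\<sigma> \<noteq> {}" using s \<open>n \<noteq> 0\<close> by auto
      moreover have "0 \<le> j y v" for v
        using pos[of v] by (cases "v \<in> \<sigma>") (auto simp: j_def)
      ultimately show ?thesis using s by (auto simp: ocone_def)
    qed
    have cj: "continuous_on U j" unfolding j_def
      by (intro continuous_on_coordinatewise_then_product continuous_on_if_const continuous_intros)
    have "U = {}"
    proof (rule no_embedding_euc[OF \<open>m < n\<close>])
      show "openin (top_of_set (euc n)) U" unfolding U_def by (rule openin_positive) simp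
      show "continuous_on U (\<lambda>y. \<Phi> (j y))"
        by (rule continuous_on_compose2[OF _ cj]) (use pp jc in \<open>auto simp: homeomorphism_def\<close>)
      show "(\<lambda>y. \<Phi> (j y)) ` U \<subseteq> euc m" using jc \<Phi> by auto
      show "inj_on (\<lambda>y. \<Phi> (j y)) U"
      proof (rule inj_onI)
        fix x y assume xy: "x \<in> U" "y \<in> U" "\<Phi> (j x) = \<Phi> (j y)"
        then have "j x = j y" using \<Phi>(2) jc by metis
        then have "x i = y i" if "i < n" for i using jb that by metis
        moreover have "x i = y i" if "i \<ge> n" for i using xy that by (auto simp: U_def euc_def)
        ultimately show "x = y" by (metis ext not_le)
      qed
    qed
    moreover have "(\<lambda>i. if i < n then 1 else 0) \<in> U" by (auto simp: U_def euc_def)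
    ultimately show False by auto
  qed
  moreover have "\<not> n < m"
  proof
    assume "n < m"
    define W where "W = {x\<in>ocone K. \<forall>v\<in>\<sigma>. 0 < x v}"
    define r where "r x = (\<lambda>i. if i < n then x (b i) else 0)" for x :: "'a \<Rightarrow> real"
    have supp: "x v = 0" if "x \<in> W" "v \<notin> \<sigma>" for x v
    proof -
      have t: "{v. x v \<noteq> 0} \<in> K" and "\<sigma> \<subseteq> {v. x v \<noteq> 0}" using that by (force simp: W_def ocone_def)+
      then have "\<sigma> = {v. x v \<noteq> 0}"
        using shelled_card_le[OF K t] shelled_finite_face[OF K t] s by (metis card_seteq)
      then show ?thesis using that by auto
    qed
    have W: "openin (top_of_set (ocone K)) W" unfolding W_def by (rule openin_positive[OF fs])
    have cr: "continuous_on A r" for A unfolding r_def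
      by (intro continuous_on_coordinatewise_then_product continuous_on_if_const continuous_intros)
    have "\<Phi> ` W = {}"
    proof (rule no_embedding_euc[OF \<open>n < m\<close>])
      have "openin (top_of_set (euc m - {\<lambda>_. 0})) (\<Phi> ` W)"
        using homeomorphism_imp_open_map[OF pp W] .
      then show "openin (top_of_set (euc m)) (\<Phi> ` W)" using op0 by (rule openin_trans)
      have "\<Phi> ` W \<subseteq> euc m - {\<lambda>_. 0}" using \<Phi> by (auto simp: W_def)
      then show "continuous_on (\<Phi> ` W) (\<lambda>y. r (\<Psi> y))"
        using pp by (intro continuous_on_compose2[OF cr[of UNIV]])
          (auto simp: homeomorphism_def intro: continuous_on_subset)
      show "(\<lambda>y. r (\<Psi> y)) ` \<Phi> ` W \<subseteq> euc n" by (auto simp: r_def euc_def)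
      show "inj_on (\<lambda>y. r (\<Psi> y)) (\<Phi> ` W)"
      proof (rule inj_onI)
        fix y y' assume "y \<in> \<Phi> ` W" "y' \<in> \<Phi> ` W" and e: "r (\<Psi> y) = r (\<Psi> y')"
        then obtain x x' where x: "x \<in> W" "x' \<in> W" "y = \<Phi> x" "y' = \<Phi> x'" by auto
        then have "\<Psi> y = x" "\<Psi> y' = x'" using \<Phi>(2) by (auto simp: W_def)
        then have r: "r x = r x'" using e by simp
        have "x v = x' v" for v
        proof (cases "v \<in> \<sigma>")
          case True
          then obtain i where "i < n" "v = b i" using b by (auto simp: bij_betw_def)
          then show ?thesis using fun_cong[OF r, of i] by (simp add: r_def)
        qed (simp add: supp x)
        then show "y = y'" using x by (metis ext)
      qed
    qed
    moreover have "(\<lambda>v. if v \<in> \<sigma> then 1 else 0) \<in> W"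
      using s \<open>n \<noteq> 0\<close> by (auto simp: W_def ocone_def fun_eq_iff intro: ccontr) 
    ultimately show False by auto
  qed
  ultimately show ?thesis by simp
qed

text \<open>The map \<open>j\<close> unfolds two of the facets along the ridge: coordinate
  \<open>d\<close> is the weight at \<open>a1\<close> where positive, and its negative is the weight
  at \<open>a2\<close> where negative. Invariance of domain makes the image of \<open>j\<close> open
  in the cone, yet from a point of the ridge one leaves it at once towards
  \<open>a3\<close>.\<close>

lemma sphere_ridge:
  assumes K: "simplicial_cplx K" and h: "ocone K homeomorphic (euc (Suc d) - {\<lambda>_. 0})" and "d > 0"
    and \<rho>: "finite \<rho>" "card \<rho> = d" and a: "a1 \<notin> \<rho>" "a2 \<notin> \<rho>" "a3 \<notin> \<rho>" "a1 \<noteq> a2" "a1 \<noteq> a3" "a2 \<noteq> a3"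
    and f: "insert a1 \<rho> \<in> K" "insert a2 \<rho> \<in> K" "insert a3 \<rho> \<in> K"
  shows False
proof -
  have op0: "openin (top_of_set (euc (Suc d))) (euc (Suc d) - {\<lambda>_. 0})"
    by (auto simp: openin_open intro!: exI[of _ "- {\<lambda>_. 0}"])
  obtain \<Phi> \<Psi> where pp: "homeomorphism (ocone K) (euc (Suc d) - {\<lambda>_. 0}) \<Phi> \<Psi>"
      using h by (auto simp: homeomorphic_def)
  have \<Phi>: "\<Phi> x \<in> euc (Suc d) - {\<lambda>_. 0}" "\<Psi> (\<Phi> x) = x" if "x \<in> ocone K" for x
    using pp that by (auto simp: homeomorphism_def)
  obtain b where b: "bij_betw b {..<d} \<rho>" using ex_bij_betw_nat_finite[OF \<rho>(1)] \<rho>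
      by (auto simp: atLeast0LessThan)
  have bi: "b i \<in> \<rho>" if "i < d" for i using b that by (auto simp: bij_betw_def)
  define U where "U = {y\<in>euc (Suc d). \<forall>i\<in>{..<d}. 0 < y i}"
  define j where "j y = (\<lambda>v. if v \<in> \<rho> then y (inv_into {..<d} b v)
     else if v = a1 then max (y d) 0 else if v = a2 then max (- y d) 0 else 0)"
         for y :: "nat \<Rightarrow> real"
  have jb: "j y (b i) = y i" if "i < d" for y i
    using that b bi by (simp add: j_def bij_betw_inv_into_left)
  have ij: "inv_into {..<d} b v < d" if "v \<in> \<rho>" for v
    using that b by (metis bij_betw_def inv_into_into lessThan_iff)
  have \<rho>0: "\<rho> \<noteq> {}" using \<rho> \<open>d > 0\<close> by auto
  have jc: "j y \<in> ocone K" if y: "y \<in> U" for y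
  proof -
    have pos: "0 < j y v" if "v \<in> \<rho>" for v using that y ij by (auto simp: j_def U_def)
    have "\<forall>v. 0 \<le> j y v" using y ij by (auto simp: j_def U_def order_less_le)
    moreover have "{v. j y v \<noteq> 0} \<subseteq> insert a1 \<rho> \<or> {v. j y v \<noteq> 0} \<subseteq> insert a2 \<rho>"
      by (cases "y d \<ge> 0") (auto simp: j_def max_def split: if_splits)
    then have "{v. j y v \<noteq> 0} \<in> K" using f cplx_subset[OF K] by blast
    moreover have "j y \<noteq> (\<lambda>_. 0)" using pos \<rho>0 by force
    ultimately show ?thesis by (auto simp: ocone_def)
  qed
  have cj: "continuous_on U j" unfolding j_def
    by (intro continuous_on_coordinatewise_then_product continuous_on_if_const continuous_intros)
  have "openin (top_of_set (euc (Suc d))) ((\<lambda>y. \<Phi> (j y)) ` U)"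
  proof (rule invariance_of_domain_euc[OF order_refl])
    show "openin (top_of_set (euc (Suc d))) U" unfolding U_def by (rule openin_positive) simp
    show "continuous_on U (\<lambda>y. \<Phi> (j y))"
      by (rule continuous_on_compose2[OF _ cj]) (use pp jc in \<open>auto simp: homeomorphism_def\<close>)
    show "(\<lambda>y. \<Phi> (j y)) ` U \<subseteq> euc (Suc d)" using jc \<Phi>(1) by auto
    show "inj_on (\<lambda>y. \<Phi> (j y)) U"
    proof (rule inj_onI)
      fix x y assume xy: "x \<in> U" "y \<in> U" "\<Phi> (j x) = \<Phi> (j y)"
      then have e: "j x = j y" using \<Phi>(2) jc by metis
      then have "x i = y i" if "i < d" for i using jb that by metis
      moreover have "x d = y d"
        using fun_cong[OF e, of a1] fun_cong[OF e, of a2] a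
            by (simp add: j_def max_def split: if_splits)
      moreover have "x i = y i" if "i > d" for i using xy that by (auto simp: U_def euc_def)
      ultimately show "x = y" by (metis ext linorder_neqE_nat)
    qed
  qed
  moreover have sub: "(\<lambda>y. \<Phi> (j y)) ` U \<subseteq> euc (Suc d) - {\<lambda>_. 0}"
    by (intro image_subsetI \<Phi>(1) jc)
  ultimately have "openin (top_of_set (euc (Suc d) - {\<lambda>_. 0})) ((\<lambda>y. \<Phi> (j y)) ` U)"
    by (meson Diff_subset openin_subset_trans)
  then have "openin (top_of_set (ocone K)) (\<Psi> ` (\<lambda>y. \<Phi> (j y)) ` U)"
    using homeomorphism_imp_open_map[OF homeomorphism_symD[OF pp]] by blast
  moreover have "\<Psi> ` (\<lambda>y. \<Phi> (j y)) ` U = j ` U"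
    unfolding image_image by (intro image_cong refl \<Phi>(2) jc)
  ultimately have op: "openin (top_of_set (ocone K)) (j ` U)" by simp
  \<comment> \<open>Coordinate \<open>d\<close> vanishes, so \<open>j p\<close> is interior to the
    ridge itself.\<close>
  define p where "p = (\<lambda>i. if i < d then 1 else (0::real))"
  have p: "p \<in> U" by (auto simp: U_def euc_def p_def)
  have jp: "j p v = (if v \<in> \<rho> then 1 else 0)" for v
    using ij by (auto simp: j_def p_def)
  have "continuous_on {0..} (\<lambda>t. (j p)(a3 := t))"
    unfolding fun_upd_def by (intro continuous_on_coordinatewise_then_product
        continuous_on_if_const continuous_intros)
  moreover have "(\<lambda>t. (j p)(a3 := t)) ` {0..} \<subseteq> ocone K"
  proof (rule image_subsetI)
    fix t :: real assume "t \<in> {0..}"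
    moreover have "{v. ((j p)(a3 := t)) v \<noteq> 0} \<subseteq> insert a3 \<rho>" by (auto simp: jp)
    then have "{v. ((j p)(a3 := t)) v \<noteq> 0} \<in> K" using f(3) cplx_subset[OF K] by blast
    moreover obtain u where "u \<in> \<rho>" using \<rho>0 by auto
    then have "((j p)(a3 := t)) u \<noteq> 0" using a by (auto simp: jp)
    then have "(j p)(a3 := t) \<noteq> (\<lambda>_. 0)" by metis
    ultimately show "(j p)(a3 := t) \<in> ocone K" unfolding ocone_def by (auto simp: jp)
  qed
  moreover have "(j p)(a3 := 0) = j p" using a by (auto simp: jp)
  ultimately obtain e where e: "e > 0" "(j p)(a3 := e) \<in> j ` U"
    using path_in_openin[OF op, of "\<lambda>t. (j p)(a3 := t)"] p by auto
  then obtain y where "(j p)(a3 := e) = j y" by auto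
  then have "e = j y a3" by (metis fun_upd_same)
  then show False using e a by (simp add: j_def)
qed

lemma shelled_sphere:
  assumes "shelled n K" "simplicial_sphere d K" "d > 0"
  shows "n = Suc d" "thin (Suc d) K"
proof -
  have K: "simplicial_cplx K" and h: "geom K homeomorphic sph d"
    using assms(2) by (auto simp: simplicial_sphere_iff)
  have c: "ocone K homeomorphic (euc (Suc d) - {\<lambda>_. 0})" by (rule ocone_homeomorphic[OF K h])
  show "n = Suc d" by (rule sphere_facet_card[OF assms(1) c]) simp
  show "thin (Suc d) K"
    unfolding thin_def
  proof (intro allI impI, elim conjE)
    fix \<rho> \<sigma>1 \<sigma>2 \<sigma>3
    assume r: "Suc (card \<rho>) = Suc d" "\<rho> \<subseteq> \<sigma>1" "\<rho> \<subseteq> \<sigma>2" "\<rho> \<subseteq> \<sigma>3"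
      and s: "\<sigma>1 \<in> facets (Suc d) K" "\<sigma>2 \<in> facets (Suc d) K" "\<sigma>3 \<in> facets (Suc d) K"
    have ex: "\<exists>a. a \<notin> \<rho> \<and> \<sigma> = insert a \<rho>" if "\<sigma> \<in> facets (Suc d) K" "\<rho> \<subseteq> \<sigma>" for \<sigma>
    proof -
      have "finite \<sigma>" "card \<sigma> = Suc d" using that shelled_finite_face[OF assms(1)]
          by (auto simp: facets_def)
      then have "card (\<sigma> - \<rho>) = 1" using r that
          by (subst card_Diff_subset) (auto dest: finite_subset)
      then obtain a where "\<sigma> - \<rho> = {a}" by (auto simp: card_1_singleton_iff)
      then show ?thesis using that by (intro exI[of _ a]) auto
    qed
    obtain a1 a2 a3 where a: "a1 \<notin> \<rho>" "\<sigma>1 = insert a1 \<rho>" "a2 \<notin> \<rho>" "\<sigma>2 = insert a2 \<rho>" "a3 \<notin> \<rho>" "\<sigma>3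
        = insert a3 \<rho>"
      using ex[OF s(1) r(2)] ex[OF s(2) r(3)] ex[OF s(3) r(4)] by blast
    have "finite \<rho>" "insert a1 \<rho> \<in> K" "insert a2 \<rho> \<in> K" "insert a3 \<rho> \<in> K"
      using s a shelled_finite_face[OF assms(1), of \<sigma>1] by (auto simp: facets_def)
    then show "\<sigma>1 = \<sigma>2 \<or> \<sigma>1 = \<sigma>3 \<or> \<sigma>2 = \<sigma>3"
      using sphere_ridge[OF K c assms(3), of \<rho> a1 a2 a3] a r(1) by auto
  qed
qed

section \<open>Recovering a complex from its folds\<close>

definition ridges :: "nat \<Rightarrow> 'a set set \<Rightarrow> 'a set \<Rightarrow> 'a set set" where
  "ridges n K F = {\<rho>\<in>K. Suc (card \<rho>) = n \<and> F \<subseteq> \<rho>}"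

definition star :: "nat \<Rightarrow> 'a set set \<Rightarrow> 'a set \<Rightarrow> 'a set set" where
  "star n K F = {\<sigma>\<in>facets n K. F \<subseteq> \<sigma>}"

lemma thin_subset: "thin n K \<Longrightarrow> L \<subseteq> K \<Longrightarrow> thin n L"
  unfolding thin_def facets_def by blast

lemma card_le_2I:
  assumes "\<And>x y z. \<lbrakk>x \<in> S; y \<in> S; z \<in> S\<rbrakk> \<Longrightarrow> x = y \<or> x = z \<or> y = z"
  shows "card S \<le> 2"
proof (rule ccontr)
  assume "\<not> ?thesis"
  then have "3 \<le> card S" by simp
  then obtain T where "T \<subseteq> S" "card T = 3" by (meson obtain_subset_with_card_n)
  then obtain x y z where "T = {x, y, z}" "x \<noteq> y" "x \<noteq> z" "y \<noteq> z"
    by (auto simp: card_3_iff)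
  then show False using assms[of x y z] \<open>T \<subseteq> S\<close> by auto
qed

lemma diff_card_two:
  assumes "finite \<sigma>" "F \<subseteq> \<sigma>" "Suc (Suc (card F)) = card \<sigma>"
  obtains x y where "x \<noteq> y" "x \<in> \<sigma>" "y \<in> \<sigma>" "F = \<sigma> - {x, y}"
proof -
  have "card (\<sigma> - F) = 2" using assms by (subst card_Diff_subset) (auto dest: finite_subset)
  then obtain x y where "\<sigma> - F = {x, y}" "x \<noteq> y" by (auto simp: card_2_iff)
  then show thesis using assms(2) by (intro that[of x y]) auto
qed

lemma ridges_Pow:
  assumes "finite \<sigma>" "card \<sigma> = n" "x \<noteq> y" "x \<in> \<sigma>" "y \<in> \<sigma>"
  shows "ridges n (Pow \<sigma>) (\<sigma> - {x, y}) = {\<sigma> - {x}, \<sigma> - {y}}"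
proof (intro equalityI subsetI)
  fix \<rho> assume "\<rho> \<in> ridges n (Pow \<sigma>) (\<sigma> - {x, y})"
  then have r: "\<rho> \<subseteq> \<sigma>" "Suc (card \<rho>) = n" "\<sigma> - {x, y} \<subseteq> \<rho>" by (auto simp: ridges_def)
  have "card (\<sigma> - \<rho>) = 1" using assms r by (subst card_Diff_subset) (auto dest: finite_subset)
  then obtain z where "\<sigma> - \<rho> = {z}" by (auto simp: card_1_singleton_iff)
  then have "\<rho> = \<sigma> - {z}" "z = x \<or> z = y" using r by auto
  then show "\<rho> \<in> {\<sigma> - {x}, \<sigma> - {y}}" by auto
next
  fix \<rho> assume "\<rho> \<in> {\<sigma> - {x}, \<sigma> - {y}}"
  then show "\<rho> \<in> ridges n (Pow \<sigma>) (\<sigma> - {x, y})"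
    using assms by (auto simp: ridges_def card_Suc_Diff1 simp del: card_Diff_insert)
qed

text \<open>Double count of incidences: each facet through \<open>F\<close> contains exactly two
  ridges through \<open>F\<close>, and by thinness each ridge lies in at most two facets.\<close>

lemma star_le_ridges:
  assumes K: "shelled n K" "thin n K" and F: "Suc (Suc (card F)) = n"
  shows "card (star n K F) \<le> card (ridges n K F)"
proof -
  have fin: "finite (star n K F)" "finite (ridges n K F)"
    using shelled_finite[OF K(1)] by (auto simp: star_def ridges_def facets_def)
  have two: "card {\<rho>\<in>ridges n K F. \<rho> \<subseteq> \<sigma>} = 2" if s: "\<sigma> \<in> star n K F" for \<sigma>
  proof -
    have \<sigma>: "\<sigma> \<in> K" "card \<sigma> = n" "F \<subseteq> \<sigma>" using s by (auto simp: star_def facets_def)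
    have fs: "finite \<sigma>" using shelled_finite_face[OF K(1) \<sigma>(1)] .
    obtain x y where xy: "x \<noteq> y" "x \<in> \<sigma>" "y \<in> \<sigma>" "F = \<sigma> - {x, y}"
      using diff_card_two[OF fs \<sigma>(3)] F \<sigma>(2) by metis
    have "{\<rho>\<in>ridges n K F. \<rho> \<subseteq> \<sigma>} = ridges n (Pow \<sigma>) F"
      using shelled_subset[OF K(1) \<sigma>(1)] by (auto simp: ridges_def)
    also have "\<dots> = {\<sigma> - {x}, \<sigma> - {y}}" unfolding xy(4) by (rule ridges_Pow[OF fs \<sigma>(2) xy(1-3)])
    finally have "{\<rho>\<in>ridges n K F. \<rho> \<subseteq> \<sigma>} = {\<sigma> - {x}, \<sigma> - {y}}" .
    moreover have "\<sigma> - {x} \<noteq> \<sigma> - {y}" using xy(1,2) by blast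
    ultimately show ?thesis by simp
  qed
  have "2 * card (star n K F) = (\<Sum>\<rho>\<in>ridges n K F. card {\<sigma>\<in>star n K F. \<rho> \<subseteq> \<sigma>})"
    using sum_multicount_gen[OF fin(2,1), of "\<lambda>\<rho> \<sigma>. \<rho> \<subseteq> \<sigma>" "\<lambda>_. 2"] two by simp
  also have "\<dots> \<le> (\<Sum>\<rho>\<in>ridges n K F. 2)"
  proof (rule sum_mono, rule card_le_2I)
    fix \<rho> x y z assume "\<rho> \<in> ridges n K F" "x \<in> {\<sigma>\<in>star n K F. \<rho> \<subseteq> \<sigma>}"
      "y \<in> {\<sigma>\<in>star n K F. \<rho> \<subseteq> \<sigma>}" "z \<in> {\<sigma>\<in>star n K F. \<rho> \<subseteq> \<sigma>}"
    then show "x = y \<or> x = z \<or> y = z"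
      using K(2)[unfolded thin_def, rule_format, of \<rho> x y z] by (auto simp: ridges_def star_def)
  qed
  finally show ?thesis by simp
qed

text \<open>
  \<open>D\<close> is the set of codimension-2 faces at which a fold took place. In a shelling, a new facet
  containing \<open>F\<close> brings at least one new ridge through \<open>F\<close>, except when it folds at \<open>F\<close>.
\<close>

definition fold_bound :: "nat \<Rightarrow> 'a set set \<Rightarrow> 'a set set \<Rightarrow> bool" where
  "fold_bound n K D \<longleftrightarrow> (\<forall>F. Suc (Suc (card F)) = n \<longrightarrow>
     card (ridges n K F) + of_bool (F \<in> D) \<le> Suc (card (star n K F)))"

lemma fold_bound_Pow:
  assumes "finite \<sigma>" "card \<sigma> = n"
  shows "fold_bound n (Pow \<sigma>) {}"
  unfolding fold_bound_def
proof (intro allI impI)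
  fix F :: "'a set" assume F: "Suc (Suc (card F)) = n"
  show "card (ridges n (Pow \<sigma>) F) + of_bool (F \<in> {}) \<le> Suc (card (star n (Pow \<sigma>) F))"
  proof (cases "F \<subseteq> \<sigma>")
    case True
    obtain x y where xy: "x \<noteq> y" "x \<in> \<sigma>" "y \<in> \<sigma>" "F = \<sigma> - {x, y}"
      using diff_card_two[OF assms(1) True] F assms(2) by metis
    have "card (ridges n (Pow \<sigma>) F) \<le> 2"
      unfolding xy(4) ridges_Pow[OF assms xy(1-3)] by (rule card_le_2I) auto
    moreover have "star n (Pow \<sigma>) F = {\<sigma>}"
      using assms True by (auto simp: star_def facets_def dest: card_subset_eq)
    ultimately show ?thesis by simp
  next
    case False
    then have "ridges n (Pow \<sigma>) F = {}" by (auto simp: ridges_def)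
    then show ?thesis by simp
  qed
qed

context
  fixes n :: nat and K :: "'a set set" and \<sigma> R :: "'a set"
  assumes K: "shelled n K" and fs: "finite \<sigma>" and cs: "card \<sigma> = n" and R: "R \<subseteq> \<sigma>" "R \<noteq> {}"
    and I: "K \<inter> Pow \<sigma> = {\<tau>. \<tau> \<subseteq> \<sigma> \<and> \<not> R \<subseteq> \<tau>}" and thin: "thin n (K \<union> Pow \<sigma>)"
begin

lemma attach_in_iff: "\<tau> \<subseteq> \<sigma> \<Longrightarrow> \<tau> \<in> K \<longleftrightarrow> \<not> R \<subseteq> \<tau>"
  using I by blast

lemma attach_shelled: "shelled n (K \<union> Pow \<sigma>)"
  by (rule shelled.attach[OF K fs cs R I])

lemma card_star_attach:
  assumes "F \<subseteq> \<sigma>"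
  shows "card (star n (K \<union> Pow \<sigma>) F) = Suc (card (star n K F))"
proof -
  have "star n (K \<union> Pow \<sigma>) F = insert \<sigma> (star n K F)"
    using assms facets_attach[OF K fs cs] by (auto simp: star_def)
  moreover have "\<sigma> \<notin> star n K F" using attach_notin[OF R(1) I] by (auto simp: star_def facets_def)
  moreover have "finite (star n K F)" using shelled_finite[OF K] by (auto simp: star_def facets_def)
  ultimately show ?thesis by simp
qed

lemma ridges_attach:
  assumes "x \<noteq> y" "x \<in> \<sigma>" "y \<in> \<sigma>"
  shows "ridges n (K \<union> Pow \<sigma>) (\<sigma> - {x, y}) = ridges n K (\<sigma> - {x, y}) \<union> {\<sigma> - {x}, \<sigma> - {y}}"
  using ridges_Pow[OF fs cs assms] by (auto simp: ridges_def)

lemma ridge_in_iff: "x \<in> \<sigma> \<Longrightarrow> \<sigma> - {x} \<in> K \<longleftrightarrow> x \<in> R"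
  using attach_in_iff[of "\<sigma> - {x}"] R by blast

lemma ridges_attach_fold:
  assumes "x \<noteq> y" "x \<in> R" "y \<in> R"
  shows "ridges n (K \<union> Pow \<sigma>) (\<sigma> - {x, y}) = ridges n K (\<sigma> - {x, y})"
proof -
  have xy: "x \<in> \<sigma>" "y \<in> \<sigma>" using assms R by auto
  then have "\<sigma> - {x} \<in> K" "\<sigma> - {y} \<in> K" using ridge_in_iff assms by auto
  then have "{\<sigma> - {x}, \<sigma> - {y}} \<subseteq> ridges n K (\<sigma> - {x, y})"
    using ridges_Pow[OF fs cs assms(1) xy] by (auto simp: ridges_def)
  then show ?thesis using ridges_attach[OF assms(1) xy] by auto
qed

text \<open>For \<open>F = \<sigma> - {x, y}\<close> the number of facets grows by one. With both
  \<open>x\<close> and \<open>y\<close> in \<open>R\<close> no ridge is new, which leaves room to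
  mark \<open>F\<close>; with just one of them in \<open>R\<close> one ridge is new; with neither,
  \<open>F\<close> is a new face.\<close>

lemma fold_bound_attach:
  assumes b: "fold_bound n K D" and D: "D \<subseteq> K"
    and D': "D' \<subseteq> D \<union> {\<sigma> - {x, y} | x y. x \<in> R \<and> y \<in> R \<and> x \<noteq> y}"
  shows "fold_bound n (K \<union> Pow \<sigma>) D'"
  unfolding fold_bound_def
proof (intro allI impI)
  fix F :: "'a set" assume F: "Suc (Suc (card F)) = n"
  have bF: "card (ridges n K F) + of_bool (F \<in> D) \<le> Suc (card (star n K F))"
    using b F by (auto simp: fold_bound_def)
  have fr: "finite (ridges n K F)" using shelled_finite[OF K] by (auto simp: ridges_def)
  show "card (ridges n (K \<union> Pow \<sigma>) F) + of_bool (F \<in> D') \<le> Suc (card (star n (K \<union> Pow \<sigma>) F))"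
  proof (cases "F \<subseteq> \<sigma>")
    case False
    then have "ridges n (K \<union> Pow \<sigma>) F = ridges n K F" "star n (K \<union> Pow \<sigma>) F = star n K F"
      by (auto simp: ridges_def star_def facets_def)
    moreover have "F \<in> D" if "F \<in> D'" using that D' False by auto
    ultimately show ?thesis using bF by (auto simp: of_bool_def split: if_splits)
  next
    case True
    obtain x y where xy: "x \<noteq> y" "x \<in> \<sigma>" "y \<in> \<sigma>" "F = \<sigma> - {x, y}"
      using diff_card_two[OF fs True] F cs by metis
    have st: "card (star n (K \<union> Pow \<sigma>) F) = Suc (card (star n K F))"
        by (rule card_star_attach[OF True])
    have inR: "x' \<in> {x, y}" if "F = \<sigma> - {x', y'}" "x' \<in> \<sigma>" "y' \<in> \<sigma>" for x' y' using that xy by blast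
    have DR: "x \<in> R \<and> y \<in> R" if "F \<in> D'" "F \<notin> D"
    proof -
      obtain x' y' where "F = \<sigma> - {x', y'}" "x' \<in> R" "y' \<in> R" "x' \<noteq> y'"
          using D' \<open>F \<in> D'\<close> \<open>F \<notin> D\<close> by blast
      then have "{x', y'} = {x, y}" using xy R by blast
      then show ?thesis using \<open>x' \<in> R\<close> \<open>y' \<in> R\<close> by auto
    qed
    consider "x \<in> R" "y \<in> R" | z where "x \<notin> R
        \<or> y \<notin> R" "ridges n (K \<union> Pow \<sigma>) F \<subseteq> insert z (ridges n K F)" | "x \<notin> R" "y \<notin> R"
    proof -
      have "\<sigma> - {u} \<in> ridges n K F" if "u \<in> {x, y}" "u \<in> R" for u
        using that ridge_in_iff[of u] xy ridges_Pow[OF fs cs xy(1-3)] by (auto simp: ridges_def)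
      then have *: "\<sigma> - {u} \<in> ridges n K F" if "u = x \<or> u = y" "u \<in> R" for u using that by blast
      have r: "ridges n (K \<union> Pow \<sigma>) F = ridges n K F \<union> {\<sigma> - {x}, \<sigma> - {y}}"
        using ridges_attach[OF xy(1-3)] xy(4) by simp
      show ?thesis
      proof (cases "x \<in> R")
        case True
        show ?thesis
        proof (cases "y \<in> R")
          case True
          then show ?thesis using \<open>x \<in> R\<close> that(1) by simp
        next
          case False
          then show ?thesis using r *[of x] True by (intro that(2)[of "\<sigma> - {y}"]) auto
        qed
      next
        case False
        show ?thesis
        proof (cases "y \<in> R")
          case True
          then show ?thesis using r *[of y] False by (intro that(2)[of "\<sigma> - {x}"]) auto
        next
          case False
          then show ?thesis using \<open>x \<notin> R\<close> that(3) by simp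
        qed
      qed
    qed
    then show ?thesis
    proof cases
      case 1
      then show ?thesis using ridges_attach_fold[OF xy(1)] bF st xy(4)
        by (simp add: of_bool_def split: if_splits)
    next
      case 2
      then have "F \<in> D" if "F \<in> D'" using that DR by blast
      moreover have "card (ridges n (K \<union> Pow \<sigma>) F) \<le> card (insert z (ridges n K F))"
        using 2 fr by (intro card_mono) auto
      then have "card (ridges n (K \<union> Pow \<sigma>) F) \<le> Suc (card (ridges n K F))"
        using card_insert_le_m1 fr by (metis card_insert_if le_SucI order_trans le_refl)
      ultimately show ?thesis using bF st by (auto simp: of_bool_def split: if_splits)
    next
      \<comment> \<open>All of \<open>R\<close> lies in \<open>F\<close>, so \<open>F\<close> is not
        in \<open>K\<close>: the count starts here, with two ridges and one facet.\<close>
      case 3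
      then have "R \<subseteq> F" using R xy by blast
      then have "F \<notin> K" using attach_in_iff[OF True] by simp
      then have "ridges n K F = {}" "F \<notin> D"
        using shelled_subset[OF K] D by (auto simp: ridges_def)
      then have "card (ridges n (K \<union> Pow \<sigma>) F) \<le> 2"
        using ridges_attach[OF xy(1-3)] xy(4) by (auto intro: card_le_2I)
      moreover have "F \<notin> D'" using DR 3 \<open>F \<notin> D\<close> by blast
      ultimately show ?thesis using st by simp
    qed
  qed
qed

text \<open>An earlier fold at this face leaves no more ridges than facets. A second one would add a
  facet and no ridge, contradicting \<open>star_le_ridges\<close>.\<close>

lemma fold_unique:
  assumes b: "fold_bound n K D" and xy: "x \<noteq> y" "x \<in> R" "y \<in> R"
  shows "\<sigma> - {x, y} \<notin> D"
proof
  assume "\<sigma> - {x, y} \<in> D"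
  let ?F = "\<sigma> - {x, y}"
  have s: "x \<in> \<sigma>" "y \<in> \<sigma>" using xy R by auto
  have "card \<sigma> \<ge> card {x, y}" using s fs by (intro card_mono) auto
  then have F: "Suc (Suc (card ?F)) = n" using s xy cs fs by (simp add: card_Diff_subset)
  then have "card (ridges n K ?F) + 1 \<le> Suc (card (star n K ?F))"
    using b \<open>?F \<in> D\<close> by (auto simp: fold_bound_def dest: spec[of _ ?F])
  moreover have "card (star n (K \<union> Pow \<sigma>) ?F) \<le> card (ridges n (K \<union> Pow \<sigma>) ?F)"
    by (rule star_le_ridges[OF attach_shelled thin F])
  ultimately show False using ridges_attach_fold[OF xy] card_star_attach[of ?F] by simp
qed

end

section \<open>Addresses of facets and the identifications derived from marks\<close>

text \<open>
  The vertex identifications that can be derived from the tree \<open>A\<close> of facets and the fold marks \<open>M\<close>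
  alone. The node \<open>j # a\<close> is the facet obtained from the facet \<open>a\<close> by exchanging its \<open>j\<close>-th vertex.
  A mark \<open>(i, k) \<in> M a\<close> refers to the ridge of \<open>a\<close> opposite its \<open>i\<close>-th vertex, folded at the face
  that this ridge leaves after removal of its \<open>k\<close>-th vertex.
\<close>

inductive ident :: "nat \<Rightarrow> nat list set \<Rightarrow> (nat list \<Rightarrow> (nat \<times> nat) set) \<Rightarrow> nat list \<times> nat
    \<Rightarrow> nat list \<times> nat \<Rightarrow> bool"
  for n A M where
  ident_refl: "\<lbrakk>a \<in> A; p < n\<rbrakk> \<Longrightarrow> ident n A M (a, p) (a, p)"
| ident_sym: "ident n A M x y \<Longrightarrow> ident n A M y x"
| ident_trans: "\<lbrakk>ident n A M x y; ident n A M y z\<rbrakk> \<Longrightarrow> ident n A M x z"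
| ident_tree: "\<lbrakk>j # a \<in> A; p < n; p \<noteq> j\<rbrakk> \<Longrightarrow> ident n A M (j # a, p) (a, p)"
| ident_fold: "\<lbrakk>a \<in> A; b \<in> A; (i, k) \<in> M a; (j, l) \<in> M b;
     \<forall>p\<in>{..<n} - {i, k}. \<exists>q\<in>{..<n} - {j, l}. ident n A M (a, p) (b, q)\<rbrakk>
     \<Longrightarrow> ident n A M (a, k) (b, l)"

lemma ident_mono:
  assumes "ident n A M x y" "A \<subseteq> A'" "\<And>a. a \<in> A \<Longrightarrow> M a \<subseteq> M' a"
  shows "ident n A' M' x y"
  using assms(1)
proof (induction rule: ident.induct)
  case (ident_fold a b i k j l)
  show ?case
    by (rule ident.ident_fold[of a _ b i k _ j l]) (use ident_fold assms(2,3) in blast)+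
qed (use assms(2) in \<open>blast intro: ident.intros\<close>)+

text \<open>\<open>v a p\<close> is the vertex at position \<open>p\<close> of the facet at node
  \<open>a\<close>. A node lists the exchanged positions on the way to the root \<open>[]\<close>,
  latest first, so a facet has at most one child per position, and common vertices keep their
  positions.\<close>

definition address_system :: "nat \<Rightarrow> 'a set set \<Rightarrow> nat list set \<Rightarrow> (nat list \<Rightarrow> nat \<Rightarrow> 'a) \<Rightarrow> bool" where
  "address_system n K A v \<longleftrightarrow> [] \<in> A \<and> (\<forall>j a. j # a \<in> A \<longrightarrow> a \<in> A \<and> j < n)
     \<and> (\<forall>a\<in>A. inj_on (v a) {..<n})
     \<and> (\<forall>j a p. j # a \<in> A \<and> p < n \<and> p \<noteq> j \<longrightarrow> v (j # a) p = v a p)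
     \<and> bij_betw (\<lambda>a. v a ` {..<n}) A (facets n K)"

lemma address_facet: "\<lbrakk>address_system n K A v; a \<in> A\<rbrakk> \<Longrightarrow> v a ` {..<n} \<in> facets n K"
  by (auto simp: address_system_def bij_betw_def)

text \<open>
  \<open>\<Phi>\<close> assigns to each face \<open>F\<close> carrying a fold the vertex \<open>x\<close> whose copies the fold identifies.
\<close>

definition fold_marks :: "nat \<Rightarrow> nat list set \<Rightarrow> (nat list \<Rightarrow> nat \<Rightarrow> 'a)
    \<Rightarrow> (nat list \<Rightarrow> (nat \<times> nat) set) \<Rightarrow> ('a set \<times> 'a) set \<Rightarrow> bool" where
  "fold_marks n A v M \<Phi> \<longleftrightarrow>
     (\<forall>a\<in>A. \<forall>(i, k)\<in>M a. i < n \<and> k < n \<and> i \<noteq> k \<and> (v a ` ({..<n} - {i, k}), v a k) \<in> \<Phi>)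
     \<and> (\<forall>F x y. (F, x) \<in> \<Phi> \<and> (F, y) \<in> \<Phi> \<longrightarrow> x = y)"

text \<open>Only the fold rule needs an argument: its premise maps the \<open>n - 2\<close> vertices
  of one marked face into the other, so the faces are equal by cardinality, and then the vertices
  are, because \<open>\<Phi>\<close> is single-valued.\<close>

lemma ident_sound:
  assumes S: "address_system n K A v" and M: "fold_marks n A v M \<Phi>"
    and "ident n A M x y"
  shows "v (fst x) (snd x) = v (fst y) (snd y)"
  using assms(3)
proof (induction rule: ident.induct)
  case (ident_tree j a p)
  then show ?case using S by (auto simp: address_system_def)
next
  case (ident_fold a b i k j l)
  have ik: "i < n" "k < n" "i \<noteq> k" "(v a ` ({..<n} - {i, k}), v a k) \<in> \<Phi>"
    and jl: "j < n" "l < n" "j \<noteq> l" "(v b ` ({..<n} - {j, l}), v b l) \<in> \<Phi>"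
    using M ident_fold.hyps unfolding fold_marks_def by auto
  have inj: "inj_on (v a) ({..<n} - {i, k})" "inj_on (v b) ({..<n} - {j, l})"
    using S ident_fold.hyps by (auto simp: address_system_def intro: inj_on_subset)
  have c: "card ({..<n} - {i, k}) = n - 2" "card ({..<n} - {j, l}) = n - 2"
    using ik jl by (auto simp: card_Diff_subset)
  have "v a ` ({..<n} - {i, k}) \<subseteq> v b ` ({..<n} - {j, l})"
    using ident_fold.IH by fastforce
  then have "v a ` ({..<n} - {i, k}) = v b ` ({..<n} - {j, l})"
    by (rule card_subset_eq[rotated]) (simp_all add: card_image inj c)
  then show ?case using M ik jl unfolding fold_marks_def by simp
qed simp_all

text \<open>The converse of \<open>ident_sound\<close>. Together they make the coincidences of
  vertices depend on \<open>A\<close> and \<open>M\<close> alone.\<close>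

definition complete_code :: "nat \<Rightarrow> nat list set \<Rightarrow> (nat list \<Rightarrow> nat \<Rightarrow> 'a)
    \<Rightarrow> (nat list \<Rightarrow> (nat \<times> nat) set) \<Rightarrow> bool" where
  "complete_code n A v M \<longleftrightarrow> (\<forall>a\<in>A. \<forall>b\<in>A. \<forall>p<n. \<forall>q<n. v a p = v b q \<longrightarrow> ident n A M (a, p) (b, q))"

lemma facet_address:
  assumes S: "address_system n K A v" and K: "shelled n K"
    and r: "\<rho> \<in> K" "Suc (card \<rho>) = n"
  obtains a j where "a \<in> A" "j < n" "v a ` ({..<n} - {j}) = \<rho>" "v a j \<notin> \<rho>"
proof -
  obtain \<tau> where t: "\<tau> \<in> facets n K" "\<rho> \<subseteq> \<tau>" using shelled_in_facet[OF K r(1)] by blast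
  then have "\<tau> \<in> (\<lambda>a. v a ` {..<n}) ` A"
    using S by (simp add: address_system_def bij_betw_def)
  then obtain a where a: "a \<in> A" "v a ` {..<n} = \<tau>" by auto
  have inj: "inj_on (v a) {..<n}" using S a by (auto simp: address_system_def)
  have ft: "finite \<tau>" "card \<tau> = n" using t shelled_finite_face[OF K] by (auto simp: facets_def)
  then have "card (\<tau> - \<rho>) = 1" using t r by (subst card_Diff_subset) (auto dest: finite_subset)
  then obtain y where y: "\<tau> - \<rho> = {y}" by (auto simp: card_1_singleton_iff)
  then have "y \<in> v a ` {..<n}" using a(2) by auto
  then obtain j where j: "j < n" "v a j = y" by auto
  have "v a ` ({..<n} - {j}) = v a ` {..<n} - {v a j}"
    using inj j by (subst inj_on_image_set_diff[of _ "{..<n}"]) auto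
  also have "\<dots> = \<rho>" using a j y t by auto
  finally show thesis using that[of a j] a j y by auto
qed

definition coded :: "nat \<Rightarrow> 'a set set \<Rightarrow> nat list set \<Rightarrow> (nat list \<Rightarrow> (nat \<times> nat) set) \<Rightarrow> bool" where
  "coded n K A M \<longleftrightarrow> (\<exists>v \<Phi>. address_system n K A v \<and> fold_marks n A v M \<Phi> \<and> complete_code n A v M)"

lemma image_remove:
  assumes "inj_on f {..<n}" "i < n" "k < n"
  shows "f ` ({..<n} - {i, k}) = f ` {..<n} - {f i, f k}"
  using assms by (subst inj_on_image_set_diff[of f "{..<n}"]) auto

text \<open>All positions of the new facet except \<open>j\<close> are linked to the parent by the
  tree rule, so a single link for position \<open>j\<close>, if its vertex is old at all, suffices;
  the rest is transitivity through the old complete code.\<close>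

lemma ident_new_vertices:
  assumes S: "address_system n K A v" and cA: "c = j # a0" "a0 \<in> A" "j < n"
    and v': "v' = v(c := (v a0)(j := x0))"
    and id: "\<And>x y. ident n A M x y \<Longrightarrow> ident n (insert c A) M' x y"
    and new: "x0 \<in> \<Union>K \<Longrightarrow> \<exists>b\<in>A. \<exists>l<n. v b l = x0 \<and> ident n (insert c A) M' (c, j) (b, l)"
    and C: "complete_code n A v M" and c: "c \<notin> A" and inj: "inj_on (v' c) {..<n}"
  shows "complete_code n (insert c A) v' M'"
proof -
  have v'A: "v' a = v a" if "a \<in> A" for a using that c v' by auto
  have inK: "v a p \<in> \<Union>K" if "a \<in> A" "p < n" for a p
  proof -
    have "v a ` {..<n} \<in> K" using address_facet[OF S that(1)] by (simp add: facets_def)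
    then show ?thesis using that(2) by blast
  qed
  have old: "ident n (insert c A) M' (a, p) (b, q)"
      if "a \<in> A" "b \<in> A" "p < n" "q < n" "v a p = v b q" for a b p q
    using C that by (intro id) (auto simp: complete_code_def)
  have link: "\<exists>b\<in>A. \<exists>l<n. v b l = v' c p \<and> ident n (insert c A) M' (c, p) (b, l)"
    if "p < n" "v' c p \<in> \<Union>K" for p
  proof (cases "p = j")
    case True
    then show ?thesis using new that v' by auto
  next
    case False
    have "ident n (insert c A) M' (c, p) (a0, p)"
      unfolding cA by (rule ident_tree) (use that False in auto)
    then show ?thesis using cA that False v' by (intro bexI[of _ a0] exI[of _ p]) auto
  qed
  have mixed: "ident n (insert c A) M' (c, p) (b, q)"
      if m: "b \<in> A" "p < n" "q < n" "v' c p = v b q" for b p q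
  proof -
    have "v' c p \<in> \<Union>K" using inK m by metis
    then obtain b' l where "b' \<in> A" "l < n" "v b' l
        = v' c p" "ident n (insert c A) M' (c, p) (b', l)"
      using link[OF m(2)] by auto
    then show ?thesis using old[of b' b l q] m by (metis ident_trans)
  qed
  show ?thesis
    unfolding complete_code_def
  proof (intro ballI allI impI)
    fix a b p q assume ab: "a \<in> insert c A" "b \<in> insert c A" and pq: "p < n" "q < n" "v' a p
        = v' b q"
    consider "a \<in> A" "b \<in> A" | "a = c" "b \<in> A" | "a \<in> A" "b = c" | "a = c" "b = c" using ab by auto
    then show "ident n (insert c A) M' (a, p) (b, q)"
    proof cases
      case 1 then show ?thesis using old pq v'A by auto
    next
      case 2 then show ?thesis using mixed pq v'A by auto
    next
      case 3 then show ?thesis using mixed[of a q p] pq v'A ident_sym by metis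
    next
      case 4
      then have "p = q" using inj pq by (auto simp: inj_on_def)
      then show ?thesis using 4 pq by (simp add: ident_refl)
    qed
  qed
qed

text \<open>Thinness guarantees that the slot is free: were \<open>j # a0\<close> already a node,
  its facet, that of \<open>a0\<close> and \<open>\<sigma>\<close> would be three distinct facets
  through the ridge \<open>\<sigma> - {x0}\<close>.\<close>

lemma address_system_attach:
  assumes K: "shelled n K" and \<sigma>: "finite \<sigma>" "card \<sigma> = n" and R: "R \<subseteq> \<sigma>"
    and I: "K \<inter> Pow \<sigma> = {\<tau>. \<tau> \<subseteq> \<sigma> \<and> \<not> R \<subseteq> \<tau>}" and thin: "thin n (K \<union> Pow \<sigma>)"
    and S: "address_system n K A v" and x0: "x0 \<in> R"
  obtains j a0 where "a0 \<in> A" "j < n" "j # a0 \<notin> A" "v a0 ` ({..<n} - {j}) = \<sigma> - {x0}"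
    "address_system n (K \<union> Pow \<sigma>) (insert (j # a0) A) (v(j # a0 := (v a0)(j := x0)))"
proof -
  have "\<sigma> \<notin> K" by (rule attach_notin[OF R I])
  have x0s: "x0 \<in> \<sigma>" using R x0 by auto
  have \<rho>: "\<sigma> - {x0} \<in> K" "Suc (card (\<sigma> - {x0})) = n"
    using I x0 x0s \<sigma> by (auto simp: card_Suc_Diff1 simp del: card_Diff_insert)
  obtain a0 j where a: "a0 \<in> A" "j < n" "v a0 ` ({..<n} - {j}) = \<sigma> - {x0}" "v a0 j \<notin> \<sigma> - {x0}"
    using facet_address[OF S K \<rho>] by metis
  have fc: "v b ` {..<n} \<in> facets n K" if "b \<in> A" for b
    by (rule address_facet[OF S that])
  have injA: "inj_on (\<lambda>a. v a ` {..<n}) A" and im: "(\<lambda>a. v a ` {..<n}) ` A = facets n K"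
    using S by (auto simp: address_system_def bij_betw_def)
  define c where "c = j # a0"
  have cA: "c \<notin> A"
  proof
    assume c: "c \<in> A"
    have "v c ` ({..<n} - {j}) = v a0 ` ({..<n} - {j})"
      using S c by (intro image_cong) (auto simp: address_system_def c_def)
    then have sub: "\<sigma> - {x0} \<subseteq> v c ` {..<n}" "\<sigma> - {x0} \<subseteq> v a0 ` {..<n}" "\<sigma> - {x0} \<subseteq> \<sigma>"
        using a by auto
    have fac: "facets n (K \<union> Pow \<sigma>) = insert \<sigma> (facets n K)" by (rule facets_attach[OF K \<sigma>])
    have "v c ` {..<n} = v a0 ` {..<n} \<or> v c ` {..<n} = \<sigma> \<or> v a0 ` {..<n} = \<sigma>"
      by (rule thin[unfolded thin_def, rule_format, of "\<sigma> - {x0}" "v c ` {..<n}" "v a0 ` {..<n}" \<sigma>])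
        (use sub \<rho>(2) fc[OF c] fc[OF a(1)] fac in simp)
    moreover have "v c ` {..<n} \<noteq> \<sigma>" "v a0 ` {..<n} \<noteq> \<sigma>"
      using fc[OF c] fc[OF a(1)] \<open>\<sigma> \<notin> K\<close> by (auto simp: facets_def)
    ultimately have "c = a0" using injA c a(1) by (auto simp: inj_on_def)
    then show False by (simp add: c_def)
  qed
  define v' where "v' = v(c := (v a0)(j := x0))"
  have v'A: "v' b = v b" if "b \<in> A" for b using that cA by (auto simp: v'_def)
  have v'c: "v' c ` {..<n} = \<sigma>"
  proof -
    have "{..<n} = insert j ({..<n} - {j})" using a by auto
    then have "v' c ` {..<n} = insert (v' c j) (v' c ` ({..<n} - {j}))" by (metis image_insert)
    also have "v' c ` ({..<n} - {j}) = v a0 ` ({..<n} - {j})"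
        by (intro image_cong) (auto simp: v'_def)
    finally show ?thesis using a x0s by (auto simp: v'_def)
  qed
  have injc: "inj_on (v' c) {..<n}" using v'c \<sigma> by (intro eq_card_imp_inj_on) auto
  have "address_system n (K \<union> Pow \<sigma>) (insert c A) v'"
    unfolding address_system_def
  proof (intro conjI)
    show "[] \<in> insert c A" using S by (auto simp: address_system_def)
    show "\<forall>k b. k # b \<in> insert c A \<longrightarrow> b \<in> insert c A \<and> k < n"
      using S a by (auto simp: address_system_def c_def)
    show "\<forall>b\<in>insert c A. inj_on (v' b) {..<n}" using S injc v'A by (auto simp: address_system_def)
    show "\<forall>k b p. k # b \<in> insert c A \<and> p < n \<and> p \<noteq> k \<longrightarrow> v' (k # b) p = v' b p"
    proof (intro allI impI, elim conjE)
      fix k b p assume h: "k # b \<in> insert c A" "p < n" "p \<noteq> k"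
      show "v' (k # b) p = v' b p"
      proof (cases "k # b = c")
        case True
        then show ?thesis using h v'A[OF a(1)] by (auto simp: c_def v'_def)
      next
        case False
        then have kb: "k # b \<in> A" using h by auto
        then have "b \<in> A" using S by (auto simp: address_system_def)
        then show ?thesis using S kb h v'A by (auto simp: address_system_def)
      qed
    qed
    have imA: "(\<lambda>a. v' a ` {..<n}) ` A = facets n K"
      unfolding im[symmetric] by (rule image_cong[OF refl]) (simp only: v'A)
    have "inj_on (\<lambda>a. v' a ` {..<n}) A"
      using injA by (subst inj_on_cong[of A _ "\<lambda>a. v a ` {..<n}"]) (simp_all add: v'A)
    moreover have "\<sigma> \<notin> (\<lambda>a. v' a ` {..<n}) ` A"
      unfolding imA using \<open>\<sigma> \<notin> K\<close> by (simp add: facets_def)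
    ultimately have "inj_on (\<lambda>a. v' a ` {..<n}) (insert c A)"
      using cA v'c by simp
    moreover have "(\<lambda>a. v' a ` {..<n}) ` insert c A = insert \<sigma> (facets n K)"
      using imA v'c by simp
    ultimately show "bij_betw (\<lambda>a. v' a ` {..<n}) (insert c A) (facets n (K \<union> Pow \<sigma>))"
      by (simp add: bij_betw_def facets_attach[OF K \<sigma>])
  qed
  then show thesis using that[OF a(1,2) _ a(3)] cA by (simp add: c_def v'_def)
qed

text \<open>The last two clauses strengthen the induction: they allow \<open>fold_unique\<close> to
  show that the face of a new fold does not yet occur in \<open>\<Phi>\<close>, so
  \<open>\<Phi>\<close> stays single-valued.\<close>

lemma code_exists_aux:
  assumes "shelled n K" "thin n K"
  shows "\<exists>A v M \<Phi>. address_system n K A v \<and> fold_marks n A v M \<Phi> \<and> complete_code n A v M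
     \<and> fst ` \<Phi> \<subseteq> K \<and> fold_bound n K (fst ` \<Phi>)"
  using assms
proof (induction rule: shelled.induct)
  case (simplex \<sigma>)
  obtain b where b: "bij_betw b {..<n} \<sigma>"
    using ex_bij_betw_nat_finite[OF simplex(1)] simplex(2) by (auto simp: atLeast0LessThan)
  have "facets n (Pow \<sigma>) = {\<sigma>}" using simplex by (auto simp: facets_def dest: card_subset_eq)
  then have "address_system n (Pow \<sigma>) {[]} (\<lambda>_. b)"
    using b by (auto simp: address_system_def bij_betw_def)
  moreover have "fold_marks n {[]} (\<lambda>_. b) (\<lambda>_. {}) {}" by (simp add: fold_marks_def)
  moreover have "complete_code n {[]} (\<lambda>_. b) (\<lambda>_. {})"
    using b by (auto simp: complete_code_def bij_betw_def inj_on_def intro: ident_refl)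
  ultimately show ?case using fold_bound_Pow[OF simplex(1,2)]
    by (intro exI[of _ "{[]}"] exI[of _ "\<lambda>_. b"] exI[of _ "\<lambda>_. {}"] exI[of _ "{}"]) simp
next
  case (attach K \<sigma> R)
  note ctx = attach.hyps(1-6) attach.prems
  have "thin n K" using attach.prems thin_subset by blast
  then obtain A v M \<Phi> where S: "address_system n K A v" and M: "fold_marks n A v M \<Phi>"
    and C: "complete_code n A v M" and \<Phi>: "fst ` \<Phi> \<subseteq> K" and B: "fold_bound n K (fst ` \<Phi>)"
    using attach.IH by blast
  obtain x0 where x0: "x0 \<in> R" using attach.hyps by auto
  have x0s: "x0 \<in> \<sigma>" using x0 attach.hyps by auto
  obtain j a0 where a: "a0 \<in> A" "j < n" "j # a0 \<notin> A" "v a0 ` ({..<n} - {j}) = \<sigma> - {x0}"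
    and S': "address_system n (K \<union> Pow \<sigma>) (insert (j # a0) A) (v(j # a0 := (v a0)(j := x0)))"
    using address_system_attach[OF attach.hyps(1-4,6) attach.prems S x0] by metis
  define c where "c = j # a0"
  define v' where "v' = v(c := (v a0)(j := x0))"
  note S' = S'[folded c_def, folded v'_def]
  have cA: "c \<notin> A" using a by (simp add: c_def)
  have v'A: "v' b = v b" if "b \<in> A" for b using that cA by (auto simp: v'_def)
  have injc: "inj_on (v' c) {..<n}" using S' by (auto simp: address_system_def)
  have v'c0: "v' c ` ({..<n} - {j}) = \<sigma> - {x0}"
  proof -
    have "v' c ` ({..<n} - {j}) = v a0 ` ({..<n} - {j})" by (intro image_cong) (auto simp: v'_def)
    then show ?thesis using a by simp
  qed
  have v'cj: "v' c j = x0" by (simp add: v'_def)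
  have v'c: "v' c ` {..<n} = \<sigma>"
  proof -
    have "{..<n} = insert j ({..<n} - {j})" using a by auto
    then have "v' c ` {..<n} = insert (v' c j) (v' c ` ({..<n} - {j}))" by (metis image_insert)
    then show ?thesis using v'c0 v'cj x0s by auto
  qed
  show ?case
  proof (cases "R = {x0}")
    case True
    define M' where "M' = M(c := {})"
    have M': "fold_marks n (insert c A) v' M' \<Phi>"
      using M cA v'A by (auto simp: fold_marks_def M'_def)
    \<comment> \<open>When \<open>R = {x0}\<close>, all old faces of \<open>\<sigma>\<close> omit
      \<open>x0\<close>; it is a new vertex, and no identification is due.\<close>
    have "x0 \<notin> \<Union>K"
    proof
      assume "x0 \<in> \<Union>K"
      then have "{x0} \<in> K" using shelled_subset[OF attach.hyps(1)] by blast
      then show False using attach_in_iff[OF ctx, of "{x0}"] True x0s by simp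
    qed
    moreover have "ident n (insert c A) M' x y" if "ident n A M x y" for x y
      by (rule ident_mono[OF that]) (use cA in \<open>auto simp: M'_def\<close>)
    ultimately have "complete_code n (insert c A) v' M'"
      by (intro ident_new_vertices[OF S c_def a(1,2) v'_def _ _ C cA injc]) auto
    moreover have "fold_bound n (K \<union> Pow \<sigma>) (fst ` \<Phi>)"
      by (rule fold_bound_attach[OF ctx B \<Phi>]) auto
    ultimately show ?thesis using S' M' \<Phi> by blast
  next
    case False
    then obtain x1 where x1: "x1 \<in> R" "x1 \<noteq> x0" using x0 by blast
    have x1s: "x1 \<in> \<sigma>" using x1 attach.hyps by auto
    \<comment> \<open>The tree glues \<open>\<sigma>\<close> along the ridge opposite
      \<open>x0\<close>. The second old ridge, opposite \<open>x1\<close>, contains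
      \<open>x0\<close>, and \<open>F\<close> is the face common to both.\<close>
    define F where "F = \<sigma> - {x0, x1}"
    have \<rho>: "\<sigma> - {x1} \<in> K" "Suc (card (\<sigma> - {x1})) = n"
      using ridge_in_iff[OF ctx x1s] x1 x1s attach.hyps
      by (auto simp: card_Suc_Diff1 simp del: card_Diff_insert)
    obtain b i where b: "b \<in> A" "i < n" "v b ` ({..<n} - {i}) = \<sigma> - {x1}" "v b i \<notin> \<sigma> - {x1}"
      using facet_address[OF S attach.hyps(1) \<rho>] by metis
    have "x0 \<in> v b ` ({..<n} - {i})" using b x0s x1 by auto
    then obtain l where l: "l < n" "l \<noteq> i" "v b l = x0" by auto
    have "x1 \<in> v' c ` ({..<n} - {j})" using v'c0 x1s x1 by auto
    then obtain k where k: "k < n" "k \<noteq> j" "v' c k = x1" by auto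
    have Fc: "v' c ` ({..<n} - {k, j}) = F"
      using image_remove[OF injc k(1) a(2)] v'c v'cj k by (auto simp: F_def)
    have injb: "inj_on (v b) {..<n}" using S b by (auto simp: address_system_def)
    have Fb: "v b ` ({..<n} - {i, l}) = F"
    proof -
      have "v b ` {..<n} - {v b i} = v b ` ({..<n} - {i})"
        using injb b by (subst inj_on_image_set_diff[of _ "{..<n}"]) auto
      then show ?thesis
        using image_remove[OF injb b(2) l(1)] b l by (auto simp: F_def)
    qed
    \<comment> \<open>Both marks denote the ridge \<open>\<sigma> - {x1}\<close> with
      \<open>x0\<close> taken away, once as seen from the old facet \<open>b\<close>, once from the
      new facet \<open>c\<close>. Earlier marks of \<open>b\<close> are kept, since one facet may be
      met by several folds.\<close>
    define M' where "M' = M(b := insert (i, l) (M b), c := {(k, j)})"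
    have bc: "b \<noteq> c" using b cA by auto
    define \<Phi>' where "\<Phi>' = insert (F, x0) \<Phi>"
    have FD: "F \<notin> fst ` \<Phi>" unfolding F_def by (rule fold_unique[OF ctx B]) (use x0 x1 in auto)
    have M': "fold_marks n (insert c A) v' M' \<Phi>'"
      unfolding fold_marks_def
    proof
      show "\<forall>a\<in>insert c A. \<forall>(i, k)\<in>M' a. i < n \<and> k < n \<and> i \<noteq> k
          \<and> (v' a ` ({..<n} - {i, k}), v' a k) \<in> \<Phi>'"
      proof (intro ballI, clarify)
        fix d p q assume d: "d \<in> insert c A" and pq: "(p, q) \<in> M' d"
        consider "d = c" | "d = b" "p = i" "q = l" | "d \<in> A" "(p, q) \<in> M d"
          using d pq by (auto simp: M'_def split: if_splits)
        then show "p < n \<and> q < n \<and> p \<noteq> q \<and> (v' d ` ({..<n} - {p, q}), v' d q) \<in> \<Phi>'"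
        proof cases
          case 1
          then show ?thesis using pq k a(2) Fc v'cj by (auto simp: M'_def \<Phi>'_def)
        next
          case 2
          then show ?thesis using b l Fb v'A by (auto simp: \<Phi>'_def)
        next
          case 3
          then show ?thesis using M v'A by (auto simp: fold_marks_def \<Phi>'_def)
        qed
      qed
      show "\<forall>F x y. (F, x) \<in> \<Phi>' \<and> (F, y) \<in> \<Phi>' \<longrightarrow> x = y"
        using M FD by (force simp: fold_marks_def \<Phi>'_def)
    qed
    have mono: "ident n (insert c A) M' x y" if "ident n A M x y" for x y
      by (rule ident_mono[OF that]) (use cA in \<open>auto simp: M'_def\<close>)
    \<comment> \<open>The vertices of \<open>F\<close> at \<open>c\<close> come from the parent
      \<open>a0\<close>, and the old complete code already links them to \<open>b\<close>; the
      premise of the fold rule thus involves no copy of \<open>x0\<close>.\<close>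
    have "ident n (insert c A) M' (c, j) (b, l)"
    proof (rule ident_fold)
      show "(k, j) \<in> M' c" "(i, l) \<in> M' b" using bc by (auto simp: M'_def)
      show "\<forall>p\<in>{..<n} - {k, j}. \<exists>q\<in>{..<n} - {i, l}. ident n (insert c A) M' (c, p) (b, q)"
      proof
        fix p assume p: "p \<in> {..<n} - {k, j}"
        then have "v' c p \<in> v b ` ({..<n} - {i, l})" using Fc Fb by blast
        then obtain q where q: "q \<in> {..<n} - {i, l}" "v b q = v' c p" by (metis imageE)
        then have "v a0 p = v b q" using p by (auto simp: v'_def)
        then have "ident n A M (a0, p) (b, q)" using C a b p q by (auto simp: complete_code_def)
        moreover have "ident n (insert c A) M' (c, p) (a0, p)"
          unfolding c_def by (rule ident_tree) (use p in auto)
        ultimately show "\<exists>q\<in>{..<n} - {i, l}. ident n (insert c A) M' (c, p) (b, q)"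
          using q mono ident_trans by metis
      qed
    qed (use b in auto)
    then have "complete_code n (insert c A) v' M'"
      using b l by (intro ident_new_vertices[OF S c_def a(1,2) v'_def mono _ C cA injc]) auto
    moreover have "fold_bound n (K \<union> Pow \<sigma>) (fst ` \<Phi>')"
      by (rule fold_bound_attach[OF ctx B \<Phi>]) (use x0 x1 in \<open>auto simp: \<Phi>'_def F_def\<close>)
    moreover have "fst ` \<Phi>' \<subseteq> K \<union> Pow \<sigma>" using \<Phi> by (auto simp: \<Phi>'_def F_def)
    ultimately show ?thesis using S' M' by blast
  qed
qed

lemma code_exists:
  assumes "shelled n K" "thin n K"
  obtains A M where "coded n K A M"
  using code_exists_aux[OF assms] unfolding coded_def by blast

lemma address_system_cover:
  assumes K: "shelled n K" "address_system n K A v"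
  shows "\<tau> \<in> K \<longleftrightarrow> (\<exists>a\<in>A. \<tau> \<subseteq> v a ` {..<n})"
proof -
  have im: "(\<lambda>a. v a ` {..<n}) ` A = facets n K"
      using K by (auto simp: address_system_def bij_betw_def)
  have "\<tau> \<in> K \<longleftrightarrow> (\<exists>\<sigma>\<in>facets n K. \<tau> \<subseteq> \<sigma>)"
    using shelled_in_facet[OF K(1)] shelled_subset[OF K(1)] by (auto simp: facets_def)
  then show ?thesis by (simp flip: im)
qed

text \<open>Soundness and completeness equate coincidence of two positions with
  \<open>ident\<close>, both in \<open>K\<close> and in \<open>L\<close>. Hence sending
  \<open>v a p\<close> to \<open>w a p\<close> is well defined and injective, and it carries facets
  to facets.\<close>

lemma coded_iso:
  assumes K: "shelled n K" "coded n K A M" and L: "shelled n L" "coded n L A' M'"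
    and eq: "A = A'" "\<And>a. a \<in> A \<Longrightarrow> M a = M' a"
  shows "cplx_iso K L"
proof -
  obtain v \<Phi> where v: "address_system n K A v" "fold_marks n A v M \<Phi>" "complete_code n A v M"
    using K by (auto simp: coded_def)
  obtain w \<Psi> where w: "address_system n L A w" "fold_marks n A w M' \<Psi>" "complete_code n A w M'"
    using L eq by (auto simp: coded_def)
  have MM: "ident n A M x y \<longleftrightarrow> ident n A M' x y" for x y
    using eq by (auto intro: ident_mono)
  have iff: "v a p = v b q \<longleftrightarrow> w a p = w b q" if "a \<in> A" "b \<in> A" "p < n" "q < n" for a b p q
    using that v(3) w(3) ident_sound[OF v(1,2)] ident_sound[OF w(1,2)] MM
    unfolding complete_code_def by (metis fst_conv snd_conv)
  have coverK: "\<tau> \<in> K \<longleftrightarrow> (\<exists>a\<in>A. \<tau> \<subseteq> v a ` {..<n})" for \<tau>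
    by (rule address_system_cover[OF K(1) v(1)])
  have coverL: "\<tau> \<in> L \<longleftrightarrow> (\<exists>a\<in>A. \<tau> \<subseteq> w a ` {..<n})" for \<tau>
    by (rule address_system_cover[OF L(1) w(1)])
  define f where "f x = (case (SOME (a, p). a \<in> A \<and> p < n \<and> v a p = x) of (a, p) \<Rightarrow> w a p)" for x
  have f: "f (v a p) = w a p" if "a \<in> A" "p < n" for a p
  proof -
    obtain b q where bq: "(SOME (b, q). b \<in> A \<and> q < n \<and> v b q = v a p) = (b, q)"
        by (meson surj_pair)
    have "case (SOME (b, q). b \<in> A \<and> q < n \<and> v b q = v a p) of (b, q) \<Rightarrow> b \<in> A \<and> q < n
        \<and> v b q = v a p"
      by (rule someI[of _ "(a, p)"]) (use that in simp)
    then show ?thesis using iff[of b a q p] that bq by (auto simp: f_def)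
  qed
  have fim: "f ` v a ` {..<n} = w a ` {..<n}" if "a \<in> A" for a
    unfolding image_image using f that by (intro image_cong) auto
  have vK: "x \<in> vertices K \<longleftrightarrow> (\<exists>a\<in>A. \<exists>p<n. x = v a p)" for x
    unfolding vertices_def Union_iff using coverK by blast
  have vL: "x \<in> vertices L \<longleftrightarrow> (\<exists>a\<in>A. \<exists>p<n. x = w a p)" for x
    unfolding vertices_def Union_iff using coverL by blast
  have "bij_betw f (vertices K) (vertices L)"
  proof (rule bij_betwI')
    fix x y assume "x \<in> vertices K" "y \<in> vertices K"
    then obtain a p b q where "a \<in> A" "p < n" "x = v a p" "b \<in> A" "q < n" "y = v b q"
        by (auto simp: vK)
    then show "f x = f y \<longleftrightarrow> x = y" using f iff by simp
  next
    fix x assume "x \<in> vertices K"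
    then show "f x \<in> vertices L" using f by (auto simp: vK vL)
  next
    fix y assume "y \<in> vertices L"
    then obtain a p where "a \<in> A" "p < n" "y = w a p" by (auto simp: vL)
    then show "\<exists>x\<in>vertices K. y = f x" using f by (intro bexI[of _ "v a p"]) (auto simp: vK)
  qed
  moreover have "L = (\<lambda>\<sigma>. f ` \<sigma>) ` K"
  proof (intro equalityI subsetI)
    fix \<tau> assume "\<tau> \<in> L"
    then obtain a where a: "a \<in> A" "\<tau> \<subseteq> f ` v a ` {..<n}" using coverL fim by metis
    then obtain \<sigma> where "\<sigma> \<subseteq> v a ` {..<n}" "\<tau> = f ` \<sigma>" by (meson subset_image_iff)
    then show "\<tau> \<in> (\<lambda>\<sigma>. f ` \<sigma>) ` K" using coverK a by blast
  next
    fix \<tau> assume "\<tau> \<in> (\<lambda>\<sigma>. f ` \<sigma>) ` K"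
    then obtain \<sigma> a where "\<tau> = f ` \<sigma>" "a \<in> A" "\<sigma> \<subseteq> v a ` {..<n}" using coverK by auto
    then have "\<tau> \<subseteq> w a ` {..<n}" using fim by blast
    then show "\<tau> \<in> L" using coverL \<open>a \<in> A\<close> by blast
  qed
  ultimately show ?thesis by (auto simp: cplx_iso_def)
qed

section \<open>The upper bound\<close>

text \<open>
  Depth-first reading of a tree: \<open>Q\<close> is the stack of nodes still to be visited, and a label lists
      the
  children of the node on top of the stack.
\<close>

fun decode :: "(nat set \<times> 'm) list \<Rightarrow> nat list list \<Rightarrow> (nat list \<times> 'm) set" where
  "decode [] Q = {}"
| "decode (x # ls) [] = {}"
| "decode ((S, m) # ls) (q # Q) = insert (q, m) (decode ls (map (\<lambda>j. j # q) (sorted_list_of_set S)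
    @ Q))"

lemma suffix_closed:
  assumes "\<And>j a. j # a \<in> A \<Longrightarrow> a \<in> A" "a \<in> A" "suffix b a"
  shows "b \<in> A"
proof -
  obtain w where "a = w @ b" using assms(3) by (auto simp: suffix_def)
  then show ?thesis using assms(2)
    by (induction w arbitrary: a) (auto dest: assms(1))
qed

lemma suffix_step: "suffix q a \<longleftrightarrow> a = q \<or> (\<exists>j. suffix (j # q) a)"
proof
  assume "suffix q a"
  then obtain w where w: "a = w @ q" by (auto simp: suffix_def)
  show "a = q \<or> (\<exists>j. suffix (j # q) a)"
    using w by (cases w rule: rev_cases) (auto simp: suffix_def)
next
  assume "a = q \<or> (\<exists>j. suffix (j # q) a)"
  then show "suffix q a" by (auto simp: suffix_def)
qed

text \<open>Nodes grow at the head, so \<open>suffix\<close> is the ancestor order and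
  \<open>D Q\<close> consists of the subtrees rooted at the stack. The roots are pairwise
  incomparable, hence these subtrees are disjoint and each node uses exactly one label; induction is
  on the number of nodes left.\<close>

lemma decode_exists:
  assumes A: "finite A" "\<And>j a. j # a \<in> A \<Longrightarrow> a \<in> A \<and> j < n" and M: "M ` A \<subseteq> \<M>"
    and Q: "set Q \<subseteq> A" "distinct Q" "\<And>q q'. \<lbrakk>q \<in> set Q; q' \<in> set Q; suffix q q'\<rbrakk> \<Longrightarrow> q = q'"
  defines "D \<equiv> \<lambda>Q. {a\<in>A. \<exists>q\<in>set Q. suffix q a}"
  shows "\<exists>ls. length ls = card (D Q) \<and> set ls \<subseteq> Pow {..<n} \<times> \<M> \<and> decode ls Q = (\<lambda>a. (a, M a)) ` D Q"
  using Q
proof (induction "card (D Q)" arbitrary: Q rule: less_induct)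
  case less
  have fD: "finite (D Q)" for Q using A(1) by (auto simp: D_def)
  show ?case
  proof (cases Q)
    case Nil
    then show ?thesis by (intro exI[of _ "[]"]) (simp add: D_def)
  next
    case (Cons q Q')
    define S where "S = {j. j # q \<in> A}"
    define Q2 where "Q2 = map (\<lambda>j. j # q) (sorted_list_of_set S) @ Q'"
    have S: "S \<subseteq> {..<n}" using A(2) by (auto simp: S_def)
    then have fS: "finite S" using finite_subset by blast
    have q: "q \<in> A" using less.prems(1) Cons by simp
    have pre: "\<not> suffix q q'" "\<not> suffix q' q" if "q' \<in> set Q'" for q'
      using that less.prems(2,3) Cons by auto
    have D: "D Q = insert q (D Q2)"
    proof (intro equalityI subsetI)
      fix a assume a: "a \<in> D Q"
      then consider "a = q" | j where "suffix (j # q) a" | q' where "q' \<in> set Q'" "suffix q' a"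
        using Cons suffix_step[of q a] by (auto simp: D_def)
      then show "a \<in> insert q (D Q2)"
      proof cases
        case 2
        then have "j # q \<in> A" using a A(2) suffix_closed[of A a "j # q"] by (auto simp: D_def)
        then show ?thesis using 2 a fS by (auto simp: D_def Q2_def S_def)
      qed (use a in \<open>auto simp: D_def Q2_def\<close>)
    next
      fix a assume "a \<in> insert q (D Q2)"
      then show "a \<in> D Q"
        using q fS Cons suffix_step[of q a] by (auto simp: D_def Q2_def)
    qed
    have nD: "q \<notin> D Q2"
    proof
      assume "q \<in> D Q2"
      then obtain q' where q': "q' \<in> set Q2" "suffix q' q" by (auto simp: D_def)
      then show False using pre fS by (auto simp: Q2_def dest: suffix_length_le)
    qed
    have card: "card (D Q) = Suc (card (D Q2))" using D nD fD by simp
    have "\<exists>ls. length ls = card (D Q2) \<and> set ls \<subseteq> Pow {..<n} \<times> \<M>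
        \<and> decode ls Q2 = (\<lambda>a. (a, M a)) ` D Q2"
    proof (rule less.hyps)
      show "card (D Q2) < card (D Q)" using card by simp
      show "set Q2 \<subseteq> A" using fS less.prems(1) Cons by (auto simp: Q2_def S_def)
      have "j # q \<notin> set Q'" for j using pre(1)[of "j # q"] by (auto simp: suffix_def)
      then show "distinct Q2" using less.prems(2) Cons fS
          by (auto simp: Q2_def distinct_map inj_on_def)
      fix p p' assume p: "p \<in> set Q2" "p' \<in> set Q2" "suffix p p'"
      consider j j' where "p = j # q" "p' = j' # q" | j where "p = j # q" "p' \<in> set Q'"
        | j where "p' = j # q" "p \<in> set Q'" | "p \<in> set Q'" "p' \<in> set Q'"
        using p fS by (auto simp: Q2_def)
      then show "p = p'"
      proof cases
        case 1
        then show ?thesis using p(3) by (auto simp: suffix_Cons dest: suffix_length_le)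
      next
        case 2
        then have "suffix q p'" using p(3) suffix_step by blast
        then show ?thesis using pre 2 by blast
      next
        case 3
        then have "p = j # q \<or> suffix p q" using p(3) by (auto simp: suffix_Cons)
        then show ?thesis using pre 3 by auto
      next
        case 4
        then show ?thesis using less.prems(3) p Cons by auto
      qed
    qed
    then obtain ls where ls: "length ls = card (D Q2)" "set ls \<subseteq> Pow {..<n} \<times> \<M>"
      "decode ls Q2 = (\<lambda>a. (a, M a)) ` D Q2" by blast
    have "decode ((S, M q) # ls) Q = (\<lambda>a. (a, M a)) ` D Q"
      using ls(3) D Cons by (simp add: Q2_def)
    moreover have "set ((S, M q) # ls) \<subseteq> Pow {..<n} \<times> \<M>" using ls(2) S M q by auto
    ultimately show ?thesis using ls(1) card by (intro exI[of _ "(S, M q) # ls"]) simp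
  qed
qed

section \<open>Counting isomorphism classes by their codes\<close>

lemma quotient_card_le:
  assumes "finite B" "\<And>x. x \<in> S \<Longrightarrow> \<exists>b\<in>B. P x b"
    and "\<And>x y b. \<lbrakk>x \<in> S; y \<in> S; P x b; P y b\<rbrakk> \<Longrightarrow> r `` {x} = r `` {y}"
  shows "finite (S // r) \<and> card (S // r) \<le> card B"
proof -
  have "S // r \<subseteq> (\<lambda>b. r `` {SOME x. x \<in> S \<and> P x b}) ` B"
  proof
    fix c assume "c \<in> S // r"
    then obtain x where x: "x \<in> S" "c = r `` {x}" by (auto simp: quotient_def)
    obtain b where b: "b \<in> B" "P x b" using assms(2) x by blast
    have "(SOME x. x \<in> S \<and> P x b) \<in> S \<and> P (SOME x. x \<in> S \<and> P x b) b"
      by (rule someI[of _ x]) (use x b in simp)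
    then have "c = r `` {SOME x. x \<in> S \<and> P x b}" using assms(3) x b by blast
    then show "c \<in> (\<lambda>b. r `` {SOME x. x \<in> S \<and> P x b}) ` B" using b by blast
  qed
  then show ?thesis
    using assms(1) by (meson card_image_le card_mono finite_imageI finite_subset order_trans)
qed

lemma cplx_iso_class:
  fixes K L :: "nat set set"
  assumes "simplicial_cplx K" "simplicial_cplx L" "cplx_iso K L"
  shows "iso_rel `` {K} = iso_rel `` {L}"
  using assms by (intro equiv_class_eq[OF equiv_iso_rel]) (auto simp: iso_rel_def)

lemma shellable_sphere_shelled:
  assumes "K \<in> shellable_spheres d" "d > 0"
  shows "shelled (Suc d) K" "thin (Suc d) K"
proof -
  obtain n where n: "shelled n K" using assms shellable_imp_shelled
      by (auto simp: shellable_spheres_def)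
  have s: "simplicial_sphere d K" using assms by (simp add: shellable_spheres_def)
  show "shelled (Suc d) K" "thin (Suc d) K" using shelled_sphere[OF n s assms(2)] n by auto
qed

text \<open>The children of a node together with its fold marks. For \<open>n = d + 1\<close> the
  number of labels is the exponential base of the upper bound.\<close>

definition labels :: "nat \<Rightarrow> (nat set \<times> (nat \<times> nat) set) set" where
  "labels n = Pow {..<n} \<times> Pow ({..<n} \<times> {..<n})"

lemma finite_labels: "finite (labels n)"
  by (simp add: labels_def)

definition encodes :: "nat \<Rightarrow> 'a set set \<Rightarrow> (nat set \<times> (nat \<times> nat) set) list \<Rightarrow> bool" where
  "encodes n K ls \<longleftrightarrow> (\<exists>A M. coded n K A M \<and> decode ls [[]] = (\<lambda>a. (a, M a)) ` A)"

lemma encodes_exists: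
  assumes K: "shelled n K" "thin n K"
  shows "\<exists>ls. set ls \<subseteq> labels n \<and> length ls = card (facets n K) \<and> encodes n K ls"
proof -
  obtain A M where c: "coded n K A M" using code_exists[OF K] by blast
  then obtain v \<Phi> where v: "address_system n K A v" "fold_marks n A v M \<Phi>"
    by (auto simp: coded_def)
  have b: "bij_betw (\<lambda>a. v a ` {..<n}) A (facets n K)" using v by (simp add: address_system_def)
  have "finite (facets n K)" using shelled_finite[OF K(1)] by (auto simp: facets_def)
  then have fA: "finite A" using b bij_betw_finite by blast
  have cl: "a \<in> A \<and> j < n" if "j # a \<in> A" for j a using v(1) that by (simp add: address_system_def)
  have A: "[] \<in> A" using v(1) by (simp add: address_system_def)
  have "M ` A \<subseteq> Pow ({..<n} \<times> {..<n})" using v(2) by (force simp: fold_marks_def)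
  from decode_exists[OF fA cl this, of "[[]]"] A
  obtain ls where "length ls = card A" "set ls \<subseteq> labels n" "decode ls [[]] = (\<lambda>a. (a, M a)) ` A"
    by (auto simp: labels_def)
  then show ?thesis using c bij_betw_same_card[OF b] by (auto simp: encodes_def)
qed

lemma encodes_iso:
  assumes "shelled n K" "shelled n L" "encodes n K ls" "encodes n L ls"
  shows "cplx_iso K L"
proof -
  obtain A M where A: "coded n K A M" "decode ls [[]] = (\<lambda>a. (a, M a)) ` A"
    using assms(3) by (auto simp: encodes_def)
  obtain A' M' where A': "coded n L A' M'" "decode ls [[]] = (\<lambda>a. (a, M' a)) ` A'"
    using assms(4) by (auto simp: encodes_def)
  have eq: "(\<lambda>a. (a, M a)) ` A = (\<lambda>a. (a, M' a)) ` A'" using A A' by simp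
  then have "fst ` (\<lambda>a. (a, M a)) ` A = fst ` (\<lambda>a. (a, M' a)) ` A'" by simp
  then have "A = A'" by (simp add: image_image)
  moreover have "M a = M' a" if "a \<in> A" for a using eq that by blast
  ultimately show ?thesis using coded_iso[OF assms(1) A(1) assms(2) A'(1)] by blast
qed

theorem card_types_with_facets:
  assumes "d > 0"
  shows "finite (types_with_facets d N) \<and> card (types_with_facets d N) \<le> card (labels (Suc d)) ^ N"
proof -
  let ?B = "{ls. set ls \<subseteq> labels (Suc d) \<and> length ls = N}"
  have "finite (types_with_facets d N) \<and> card (types_with_facets d N) \<le> card ?B"
    unfolding types_with_facets_def
  proof (rule quotient_card_le)
    show "finite ?B" by (rule finite_lists_length_eq[OF finite_labels])
    fix K assume K: "K \<in> {K \<in> shellable_spheres d. card (faces_of_dim (int d) K) = N}"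
    then have s: "shelled (Suc d) K" "thin (Suc d) K" using shellable_sphere_shelled assms by auto
    have "facets (Suc d) K = faces_of_dim (int d) K" by (auto simp: facets_def faces_of_dim_def)
    then show "\<exists>ls\<in>?B. encodes (Suc d) K ls"
      using encodes_exists[OF s] K by auto
  next
    fix K L ls assume "K \<in> {K \<in> shellable_spheres d. card (faces_of_dim (int d) K) = N}"
      "L \<in> {K \<in> shellable_spheres d. card (faces_of_dim (int d) K) = N}"
      "encodes (Suc d) K ls" "encodes (Suc d) L ls"
    then show "iso_rel `` {K} = iso_rel `` {L}"
      using shellable_sphere_shelled(1)[of _ d] assms
      by (intro cplx_iso_class encodes_iso shelled_cplx) auto
  qed
  then show ?thesis by (simp add: card_lists_length_eq[OF finite_labels])
qed

section \<open>The lower bound\<close>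

lemma sphere_stellar:
  assumes "simplicial_sphere d K" "F \<in> K" "F \<noteq> {}" "w \<notin> \<Union>K"
  shows "simplicial_sphere d (stellar F w K)"
  using assms geom_stellar[OF _ assms(2-4)] cplx_stellar[OF _ assms(3)]
  by (auto simp: simplicial_sphere_iff intro: homeomorphic_trans)

lemma Union_stellar:
  assumes "simplicial_cplx K" "F \<in> K" "2 \<le> card F"
  shows "\<Union>(stellar F w K) = insert w (\<Union>K)"
proof (intro equalityI subsetI)
  fix x assume "x \<in> \<Union>(stellar F w K)"
  then obtain \<sigma> where "\<sigma> \<in> K \<or> (\<exists>\<tau>\<in>K. \<sigma> = insert w \<tau>)" "x \<in> \<sigma>"
    unfolding stellar_def by blast
  then show "x \<in> insert w (\<Union>K)" by blast
next
  fix x assume x: "x \<in> insert w (\<Union>K)"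
  have n: "\<not> F \<subseteq> {y}" for y
    using assms(3) card_mono[of "{y}" F] by auto
  show "x \<in> \<Union>(stellar F w K)"
  proof (cases "x = w")
    case True
    have "{} \<in> K" "\<not> F \<subseteq> {}" using assms by (auto simp: simplicial_cplx_def)
    then have "{w} \<in> stellar F w K" using assms by (auto simp: stellar_def)
    then show ?thesis using True by blast
  next
    case False
    then have "{x} \<in> K" using x cplx_subset[OF assms(1), of _ "{x}"] by auto
    then have "{x} \<in> stellar F w K" using n by (auto simp: stellar_def)
    then show ?thesis by blast
  qed
qed

section \<open>Edge subdivisions and spheres with quadratically many facets\<close>

lemma finite_star: "shelled n K \<Longrightarrow> finite (star n K G)"
  using shelled_finite[of n K] by (simp add: star_def facets_def)

lemma stellar_edge_facet:
  assumes "shelled n K" "u \<noteq> v" "w \<notin> \<Union>K" "\<sigma> \<in> facets n K" "u \<in> \<sigma>" "v \<in> \<sigma>"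
  shows "insert w (\<sigma> - {v}) \<in> facets n (stellar {u, v} w K)"
proof -
  have s: "\<sigma> \<in> K" "card \<sigma> = n" "finite \<sigma>"
    using assms(4) shelled_finite_face[OF assms(1)] by (auto simp: facets_def)
  have "\<sigma> - {v} \<in> K" using shelled_subset[OF assms(1) s(1)] by auto
  moreover have "\<sigma> - {v} \<union> {u, v} = \<sigma>" using assms(5,6) by auto
  ultimately have "insert w (\<sigma> - {v}) \<in> stellar {u, v} w K" using s by (auto simp: stellar_def)
  moreover have "w \<notin> \<sigma>" using assms(3) s by auto
  ultimately show ?thesis using s assms(6) card_swap[of \<sigma> v w] by (simp add: facets_def)
qed

lemma inj_on_replace:
  assumes "\<And>\<sigma>. \<sigma> \<in> S \<Longrightarrow> v \<in> \<sigma> \<and> w \<notin> \<sigma>"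
  shows "inj_on (\<lambda>\<sigma>. insert w (\<sigma> - {v})) S"
proof (rule inj_onI)
  fix \<sigma> \<tau> assume a: "\<sigma> \<in> S" "\<tau> \<in> S" "insert w (\<sigma> - {v}) = insert w (\<tau> - {v})"
  then have "\<sigma> - {v} = \<tau> - {v}" using assms by (metis Diff_iff insert_ident)
  then show "\<sigma> = \<tau>" using a assms by (metis insert_Diff)
qed

text \<open>Exchanging \<open>v\<close> for \<open>w\<close> is injective on these facets. With
  \<open>G\<close> empty, the half edge from \<open>u\<close> to \<open>w\<close> inherits the
  degree of the subdivided edge; with \<open>G\<close> a disjoint edge, a facet containing both
  edges survives.\<close>

lemma star_stellar_new_edge:
  assumes K: "shelled n K" and uv: "u \<noteq> v" "v \<notin> G" and w: "w \<notin> \<Union>K"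
  shows "card (star n K (G \<union> {u, v})) \<le> card (star n (stellar {u, v} w K) (G \<union> {u, w}))"
proof -
  have "(\<lambda>\<sigma>. insert w (\<sigma> - {v})) ` star n K (G \<union> {u, v}) \<subseteq> star n (stellar {u, v} w K) (G \<union> {u, w})"
  proof (rule image_subsetI)
    fix \<sigma> assume s: "\<sigma> \<in> star n K (G \<union> {u, v})"
    then have "insert w (\<sigma> - {v}) \<in> facets n (stellar {u, v} w K)"
      by (intro stellar_edge_facet[OF K uv(1) w]) (auto simp: star_def)
    then show "insert w (\<sigma> - {v}) \<in> star n (stellar {u, v} w K) (G \<union> {u, w})"
      using s uv by (auto simp: star_def)
  qed
  moreover have "inj_on (\<lambda>\<sigma>. insert w (\<sigma> - {v})) (star n K (G \<union> {u, v}))"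
    by (rule inj_on_replace) (use w in \<open>auto simp: star_def facets_def\<close>)
  moreover have "finite (star n (stellar {u, v} w K) (G \<union> {u, w}))"
    by (intro finite_star shelled_stellar[OF K _ w]) auto
  ultimately show ?thesis by (metis card_image card_mono)
qed

text \<open>Each facet through the subdivided edge splits into two, both still containing
  \<open>G\<close>; the others are untouched. With \<open>G\<close> empty this counts all
  facets.\<close>

lemma star_stellar_add:
  assumes K: "shelled n K" and uv: "u \<noteq> v" "u \<notin> G" "v \<notin> G" and w: "w \<notin> \<Union>K"
  shows "card (star n K G) + card (star n K (G \<union> {u, v})) \<le> card (star n (stellar {u, v} w K) G)"
proof -
  let ?K' = "stellar {u, v} w K"
  let ?A = "star n K G - star n K (G \<union> {u, v})"
  let ?r = "\<lambda>x \<sigma>. insert w (\<sigma> - {x})"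
  let ?S = "star n K (G \<union> {u, v})"
  have ws: "w \<notin> \<sigma>" if "\<sigma> \<in> star n K H" for \<sigma> H using that w by (auto simp: star_def facets_def)
  have inj: "inj_on (?r u) ?S" "inj_on (?r v) ?S"
    using ws by (auto intro!: inj_on_replace simp: star_def)
  have sub: "?A \<union> (?r u ` ?S \<union> ?r v ` ?S) \<subseteq> star n ?K' G"
  proof (intro Un_least image_subsetI subsetI)
    fix \<sigma> assume "\<sigma> \<in> ?A"
    then show "\<sigma> \<in> star n ?K' G" by (auto simp: star_def facets_def stellar_def)
  next
    fix \<sigma> assume s: "\<sigma> \<in> ?S"
    have "?r v \<sigma> \<in> facets n ?K'"
      using s by (intro stellar_edge_facet[OF K uv(1) w]) (auto simp: star_def)
    then show "?r v \<sigma> \<in> star n ?K' G" using s uv by (auto simp: star_def)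
    have "?r u \<sigma> \<in> facets n (stellar {v, u} w K)"
      using s uv by (intro stellar_edge_facet[OF K _ w]) (auto simp: star_def)
    then show "?r u \<sigma> \<in> star n ?K' G" using s uv by (auto simp: star_def insert_commute)
  qed
  have fin: "finite ?A" "finite ?S" "finite (star n K G)" using finite_star[OF K] by auto
  have disj1: "?A \<inter> (?r u ` ?S \<union> ?r v ` ?S) = {}" using ws by blast
  have disj2: "?r u ` ?S \<inter> ?r v ` ?S = {}"
  proof -
    have "u \<notin> ?r u \<sigma>" "u \<in> ?r v \<sigma>" if "\<sigma> \<in> ?S" for \<sigma>
      using that ws[OF that] uv by (auto simp: star_def)
    then show ?thesis by blast
  qed
  have "?S \<subseteq> star n K G" by (auto simp: star_def)
  then have "card ?A + card ?S = card (star n K G)"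
    using fin by (simp add: card_Diff_subset card_mono)
  then have "card (star n K G) + card ?S = card ?A + (card ?S + card ?S)" by simp
  also have "\<dots> = card (?A \<union> (?r u ` ?S \<union> ?r v ` ?S))"
    using fin disj1 disj2 inj by (simp add: card_Un_disjoint card_image)
  also have "\<dots> \<le> card (star n ?K' G)"
    by (intro card_mono sub finite_star shelled_stellar[OF K _ w]) auto
  finally show ?thesis .
qed

lemma star_face:
  assumes "shelled n K" "0 < card (star n K G)"
  shows "G \<in> K"
proof -
  obtain \<sigma> where "\<sigma> \<in> star n K G" using assms(2) by (metis card.empty ex_in_conv less_irrefl)
  then show ?thesis using shelled_subset[OF assms(1), of \<sigma> G] by (auto simp: star_def facets_def)
qed

text \<open>With an initial segment as vertex set, \<open>b\<close> is always the next fresh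
  vertex.\<close>

definition shelled_sphere_on :: "nat \<Rightarrow> nat \<Rightarrow> nat set set \<Rightarrow> bool" where
  "shelled_sphere_on d b K \<longleftrightarrow> shelled (Suc d) K \<and> simplicial_sphere d K \<and> \<Union>K = {..<b}"

lemma shelled_sphere_on_stellar:
  assumes "shelled_sphere_on d b K" "F \<in> K" "2 \<le> card F"
  shows "shelled_sphere_on d (Suc b) (stellar F b K)"
proof -
  have K: "shelled (Suc d) K" "simplicial_sphere d K" "\<Union>K = {..<b}"
      using assms by (auto simp: shelled_sphere_on_def)
  have F: "F \<noteq> {}" "b \<notin> \<Union>K" using assms(3) K(3) by auto
  have "\<Union>(stellar F b K) = {..<Suc b}"
    using Union_stellar[OF shelled_cplx[OF K(1)] assms(2,3)] K(3) by auto
  then show ?thesis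
    using shelled_stellar[OF K(1) F] sphere_stellar[OF K(2) assms(2) F]
        by (simp add: shelled_sphere_on_def)
qed

text \<open>A facet containing both disjoint edges is maintained. Subdividing the
  \<open>f\<close>-edge splits that facet, which raises the degree of the \<open>e\<close>-edge, and
  one half of the \<open>f\<close>-edge takes over. The offset \<open>d + 2\<close> counts the
  vertices of the initial simplex boundary.\<close>

lemma exists_edge_of_large_degree:
  assumes "4 \<le> d"
  shows "\<exists>K e1 e2 f1 f2. shelled_sphere_on d (d + 2 + k) K \<and> card {e1, e2, f1, f2} = 4
    \<and> 1 \<le> card (star (Suc d) K {e1, e2, f1, f2}) \<and> Suc k \<le> card (star (Suc d) K {e1, e2})"
proof (induction k)
  case 0
  let ?K = "simplex_boundary {..Suc d}"
  have sh: "shelled (Suc d) ?K" using shelled_simplex_boundary[of "{..Suc d}"] by simp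
  have sp: "simplicial_sphere d ?K"
    using geom_simplex_boundary shelled_cplx[OF sh] by (simp add: simplicial_sphere_iff)
  have "x \<in> \<Union>?K" if "x < d + 2" for x
  proof -
    have "{x} \<noteq> {..Suc d}" by (metis card_atMost card_1_singleton_iff nat.inject nat.distinct(1)
        One_nat_def)
    then have "{x} \<in> ?K" using that by (auto simp: simplex_boundary_def)
    then show ?thesis by blast
  qed
  then have "\<Union>?K = {..<d + 2}" by (auto simp: simplex_boundary_def)
  then have K: "shelled_sphere_on d (d + 2 + 0) ?K" using sh sp by (simp add: shelled_sphere_on_def)
  have "{..d} \<in> star (Suc d) ?K {0, 1, 2, 3}"
      using assms by (auto simp: star_def facets_def simplex_boundary_def)
  then have "1 \<le> card (star (Suc d) ?K {0, 1, 2, 3})"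
      using finite_star[OF sh] by (simp add: Suc_le_eq card_gt_0_iff) blast
  moreover have "card (star (Suc d) ?K {0, 1, 2, 3}) \<le> card (star (Suc d) ?K {0, 1})"
    by (intro card_mono finite_star[OF sh]) (auto simp: star_def)
  ultimately show ?case using K
    by (intro exI[of _ ?K] exI[of _ 0] exI[of _ 1] exI[of _ 2] exI[of _ 3]) simp
next
  case (Suc k)
  then obtain K e1 e2 f1 f2 where K: "shelled_sphere_on d (d + 2 + k) K" and c: "card {e1, e2, f1,
      f2} = 4"
    and ef: "1 \<le> card (star (Suc d) K {e1, e2, f1, f2})" and e: "Suc k
        \<le> card (star (Suc d) K {e1, e2})"
    by blast
  have dist: "e1 \<noteq> e2" "e1 \<noteq> f1" "e1 \<noteq> f2" "e2 \<noteq> f1" "e2 \<noteq> f2" "f1 \<noteq> f2"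
    using c by (auto simp: card_insert_if split: if_splits)
  let ?w = "d + 2 + k"
  have sh: "shelled (Suc d) K" and U: "\<Union>K = {..<?w}" using K by (auto simp: shelled_sphere_on_def)
  have face: "{e1, e2, f1, f2} \<in> K" using star_face[OF sh] ef by simp
  then have f: "{f1, f2} \<in> K" using shelled_subset[OF sh] by blast
  have w: "?w \<notin> \<Union>K" using U by simp
  have less: "e1 < ?w" "e2 < ?w" "f1 < ?w" using face U by blast+
  let ?K' = "stellar {f1, f2} ?w K"
  have 1: "shelled_sphere_on d (d + 2 + Suc k) ?K'"
    using shelled_sphere_on_stellar[OF K f] dist by simp
  have 2: "1 \<le> card (star (Suc d) ?K' {e1, e2, f1, ?w})"
    using star_stellar_new_edge[OF sh dist(6) _ w, of "{e1, e2}"] dist ef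
        by (simp add: insert_commute)
  have 3: "Suc (Suc k) \<le> card (star (Suc d) ?K' {e1, e2})"
  proof -
    have "card (star (Suc d) K {e1, e2}) + card (star (Suc d) K ({e1, e2} \<union> {f1, f2}))
        \<le> card (star (Suc d) ?K' {e1, e2})"
      by (rule star_stellar_add[OF sh dist(6) _ _ w]) (use dist in auto)
    moreover have "{e1, e2} \<union> {f1, f2} = {e1, e2, f1, f2}" by auto
    ultimately show ?thesis using ef e by simp
  qed
  have "card {e1, e2, f1, ?w} = 4" using dist less by (simp add: card_insert_if)
  then show ?case using 1 2 3 by blast
qed

text \<open>Every subdivision of the edge of degree at least \<open>k + 1\<close> creates that many
  additional facets, and a half of the edge keeps the degree, so the step can be repeated.\<close>

lemma exists_many_facets_aux:
  assumes "4 \<le> d"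
  shows "\<exists>K e1 e2. shelled_sphere_on d (d + 2 + k + j) K \<and> e1 \<noteq> e2
    \<and> Suc k \<le> card (star (Suc d) K {e1, e2}) \<and> k * j \<le> card (facets (Suc d) K)"
proof (induction j)
  case 0
  obtain K e1 e2 f1 f2 where K: "shelled_sphere_on d (d + 2 + k) K" "card {e1, e2, f1, f2} = 4"
    "Suc k \<le> card (star (Suc d) K {e1, e2})"
    using exists_edge_of_large_degree[OF assms, of k] by blast
  then have "e1 \<noteq> e2" by (auto simp: card_insert_if split: if_splits)
  then show ?case using K by auto
next
  case (Suc j)
  then obtain K e1 e2 where K: "shelled_sphere_on d (d + 2 + k + j) K" and ne: "e1 \<noteq> e2"
    and e: "Suc k \<le> card (star (Suc d) K {e1, e2})" and f: "k * j \<le> card (facets (Suc d) K)"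
        by blast
  let ?w = "d + 2 + k + j"
  have sh: "shelled (Suc d) K" and U: "\<Union>K = {..<?w}" using K by (auto simp: shelled_sphere_on_def)
  have face: "{e1, e2} \<in> K" using star_face[OF sh] e by simp
  have w: "?w \<notin> \<Union>K" using U by simp
  have less: "e1 < ?w" using face U by blast
  let ?K' = "stellar {e1, e2} ?w K"
  have 1: "shelled_sphere_on d (d + 2 + k + Suc j) ?K'"
    using shelled_sphere_on_stellar[OF K face] ne by simp
  have 2: "Suc k \<le> card (star (Suc d) ?K' {e1, ?w})"
    using star_stellar_new_edge[OF sh ne _ w, of "{}"] e by simp
  have fs: "facets (Suc d) L = star (Suc d) L {}" for L :: "nat set set" by (simp add: star_def)
  have 3: "k * Suc j \<le> card (facets (Suc d) ?K')"
    using star_stellar_add[OF sh ne _ _ w, of "{}"] e f unfolding fs by simp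
  show ?case using 1 2 3 less by (metis less_irrefl)
qed

lemma exists_many_facets:
  assumes "4 \<le> d"
  shows "\<exists>K. shelled_sphere_on d (d + 2 + 2 * k) K \<and> k\<^sup>2 \<le> card (facets (Suc d) K)"
  using exists_many_facets_aux[OF assms, of k k] by (auto simp: power2_eq_square mult_2 add.assoc)

section \<open>Stacked spheres and their isomorphisms\<close>

definition link_vertices :: "'a set set \<Rightarrow> 'a \<Rightarrow> 'a set" where
  "link_vertices K w = \<Union>{\<sigma>\<in>K. w \<in> \<sigma>} - {w}"

text \<open>
  \<open>L\<close> arises from \<open>K\<close> by stacking the facets in \<open>A\<close>, with the new vertices \<open>b, b + 1, \<dots>\<close>. The last
  clause lets \<open>A\<close> be read off from \<open>L\<close> once it is known which vertices are new.
\<close>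

definition stacked :: "nat \<Rightarrow> nat \<Rightarrow> nat set set \<Rightarrow> nat set set \<Rightarrow> nat set set \<Rightarrow> bool" where
  "stacked d b K A L \<longleftrightarrow> shelled_sphere_on d (b + card A) L
     \<and> (\<forall>\<phi>\<in>facets (Suc d) K. \<phi> \<in> L \<longleftrightarrow> \<phi> \<notin> A)
     \<and> (\<forall>\<tau>\<in>L. \<tau> \<subseteq> {..<b} \<longrightarrow> \<tau> \<in> K)
     \<and> link_vertices L ` {b..<b + card A} = A"

lemma facet_maximal:
  assumes "shelled n K" "\<phi> \<in> facets n K" "\<tau> \<in> K" "\<phi> \<subseteq> \<tau>"
  shows "\<tau> = \<phi>"
  using assms shelled_card_le[OF assms(1,3)] shelled_finite_face[OF assms(1,3)]
  by (auto simp: facets_def dest: card_seteq)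

text \<open>A facet is maximal, so stacking it deletes only that face and gives the new vertex a
  link with just its vertices. Earlier new vertices lie outside \<open>{..<b}\<close>, hence outside
  the facet, and the faces through them do not change.\<close>

lemma stacked_exists:
  assumes K: "shelled_sphere_on d b K" and d: "d \<ge> 1" and A: "finite A" "A \<subseteq> facets (Suc d) K"
  shows "\<exists>L. stacked d b K A L"
  using A
proof (induction A rule: finite_induct)
  case empty
  then show ?case using K by (auto simp: stacked_def facets_def intro!: exI[of _ K])
next
  case (insert \<phi> A)
  then obtain L where L: "shelled_sphere_on d (b + card A) L"
    "\<forall>\<phi>\<in>facets (Suc d) K. \<phi> \<in> L \<longleftrightarrow> \<phi> \<notin> A" "\<forall>\<tau>\<in>L. \<tau> \<subseteq> {..<b} \<longrightarrow> \<tau> \<in> K"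
    "link_vertices L ` {b..<b + card A} = A" by (auto simp: stacked_def)
  let ?w = "b + card A"
  let ?L = "stellar \<phi> ?w L"
  have sh: "shelled (Suc d) L" and U: "\<Union>L = {..<?w}"
      using L(1) by (auto simp: shelled_sphere_on_def)
  have \<phi>K: "\<phi> \<in> facets (Suc d) K" and \<phi>L: "\<phi> \<in> L" and c\<phi>: "card \<phi> = Suc d"
    using insert L(2) by (auto simp: facets_def)
  have \<phi>F: "\<phi> \<in> facets (Suc d) L" using \<phi>L c\<phi> by (simp add: facets_def)
  have max: "\<tau> = \<phi>" if "\<tau> \<in> L" "\<phi> \<subseteq> \<tau>" for \<tau> using facet_maximal[OF sh \<phi>F that] .
  have sub: "\<phi>' \<subseteq> {..<b}" if "\<phi>' \<in> K" for \<phi>' using that K by (auto simp: shelled_sphere_on_def)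
  have \<phi>b: "\<phi> \<subseteq> {..<b}" using sub \<phi>K by (auto simp: facets_def)
  have w: "?w \<notin> \<tau>" if "\<tau> \<in> L" for \<tau> using that U by blast
  have mem: "\<tau> \<in> ?L \<longleftrightarrow> \<tau> \<in> L \<and> \<not> \<phi> \<subseteq> \<tau>" if "?w \<notin> \<tau>" for \<tau> using that by (auto simp: stellar_def)
  have 1: "shelled_sphere_on d (b + card (insert \<phi> A)) ?L"
    using shelled_sphere_on_stellar[OF L(1) \<phi>L] c\<phi> d insert.hyps by simp
  have 2: "\<phi>' \<in> ?L \<longleftrightarrow> \<phi>' \<notin> insert \<phi> A" if \<phi>': "\<phi>' \<in> facets (Suc d) K" for \<phi>'
  proof -
    have "?w \<notin> \<phi>'" using sub[of \<phi>'] \<phi>' by (auto simp: facets_def)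
    moreover have "\<phi> \<subseteq> \<phi>' \<longleftrightarrow> \<phi>' = \<phi>"
      using facet_maximal[OF _ \<phi>K, of \<phi>'] \<phi>' K by (auto simp: facets_def shelled_sphere_on_def)
    ultimately show ?thesis using mem L(2) \<phi>' by auto
  qed
  have 3: "\<tau> \<in> K" if "\<tau> \<in> ?L" "\<tau> \<subseteq> {..<b}" for \<tau>
  proof -
    have "?w \<notin> \<tau>" using that by auto
    then show ?thesis using mem L(3) that by auto
  qed
  have old: "link_vertices ?L u = link_vertices L u" if "u \<in> {b..<?w}" for u
  proof -
    have u: "u \<notin> \<phi>" using that \<phi>b by auto
    have "{\<sigma>\<in>?L. u \<in> \<sigma>} = {\<sigma>\<in>L. u \<in> \<sigma>}"
    proof (intro equalityI subsetI)
      fix \<sigma> assume s: "\<sigma> \<in> {\<sigma>\<in>?L. u \<in> \<sigma>}"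
      then consider "\<sigma> \<in> L" | \<tau> where "\<sigma> = insert ?w \<tau>" "\<tau> \<union> \<phi> \<in> L" by (auto simp: stellar_def)
      then show "\<sigma> \<in> {\<sigma>\<in>L. u \<in> \<sigma>}"
      proof cases
        case 2
        then have "\<tau> \<subseteq> \<phi>" using max[of "\<tau> \<union> \<phi>"] by auto
        then show ?thesis using s 2 u that by auto
      qed (use s in auto)
    next
      fix \<sigma> assume s: "\<sigma> \<in> {\<sigma>\<in>L. u \<in> \<sigma>}"
      then have "\<not> \<phi> \<subseteq> \<sigma>" using max u by auto
      then show "\<sigma> \<in> {\<sigma>\<in>?L. u \<in> \<sigma>}" using s by (auto simp: stellar_def)
    qed
    then show ?thesis by (simp add: link_vertices_def)
  qed
  have new: "link_vertices ?L ?w = \<phi>"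
  proof (intro equalityI subsetI)
    fix x assume "x \<in> link_vertices ?L ?w"
    then obtain \<sigma> where s: "\<sigma> \<in> ?L" "?w \<in> \<sigma>" "x \<in> \<sigma>" "x \<noteq> ?w" by (auto simp: link_vertices_def)
    then obtain \<tau> where t: "\<sigma> = insert ?w \<tau>" "\<tau> \<union> \<phi> \<in> L" using w by (auto simp: stellar_def)
    then have "\<tau> \<subseteq> \<phi>" using max[of "\<tau> \<union> \<phi>"] by auto
    then show "x \<in> \<phi>" using s t by auto
  next
    fix x assume x: "x \<in> \<phi>"
    have "\<not> \<phi> \<subseteq> {x}" using c\<phi> d card_mono[of "{x}" \<phi>] by auto
    moreover have "{x} \<in> L" "{x} \<union> \<phi> \<in> L" using x \<phi>L shelled_subset[OF sh \<phi>L, of "{x}"]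
        by (auto simp: insert_absorb)
    ultimately have "insert ?w {x} \<in> ?L" unfolding stellar_def by blast
    moreover have "x \<noteq> ?w" using x \<phi>b by auto
    ultimately show "x \<in> link_vertices ?L ?w" unfolding link_vertices_def by blast
  qed
  have "{b..<b + card (insert \<phi> A)} = insert ?w {b..<?w}" using insert.hyps by auto
  then have "link_vertices ?L ` {b..<b + card (insert \<phi> A)}
      = insert \<phi> (link_vertices ?L ` {b..<?w})"
    using new by simp
  also have "link_vertices ?L ` {b..<?w} = link_vertices L ` {b..<?w}"
    by (rule image_cong[OF refl old])
  also have "\<dots> = A" by (rule L(4))
  finally have "link_vertices ?L ` {b..<b + card (insert \<phi> A)} = insert \<phi> A" .
  then show ?case using 1 2 3 unfolding stacked_def by blast
qed

text \<open>The fixed vertices spread along the shelling: the image of \<open>\<sigma>\<close>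
  contains the fixed ridge, by injectivity it is not the fixed neighbour \<open>\<tau>\<close>, so
  thinness leaves only \<open>\<sigma>\<close> itself, and the last vertex must be fixed. The
  ambient \<open>N\<close> is separate from \<open>K\<close> because \<open>g\<close> preserves the
  facets of the whole complex, not those of a partial one.\<close>

lemma flag_rigid:
  assumes "shelled n K"
  shows "\<exists>\<sigma>0\<in>facets n K. \<forall>N g. thin n N \<longrightarrow> K \<subseteq> N \<longrightarrow> inj_on g (\<Union>N)
      \<longrightarrow> (\<forall>\<sigma>\<in>facets n N. g ` \<sigma> \<in> facets n N)
    \<longrightarrow> (\<forall>x\<in>\<sigma>0. g x = x) \<longrightarrow> (\<forall>x\<in>\<Union>K. g x = x)"
  using assms
proof (induction rule: shelled.induct)
  case (simplex \<sigma>)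
  then show ?case by (intro bexI[of _ \<sigma>]) (auto simp: facets_def)
next
  case (attach K \<sigma> R)
  obtain \<sigma>0 where s0: "\<sigma>0 \<in> facets n K" and IH: "\<And>N g x. \<lbrakk>thin n N; K \<subseteq> N; inj_on g (\<Union>N);
     \<forall>\<sigma>\<in>facets n N. g ` \<sigma> \<in> facets n N; \<forall>x\<in>\<sigma>0. g x = x; x \<in> \<Union>K\<rbrakk> \<Longrightarrow> g x = x"
    using attach.IH by metis
  show ?case
  proof (intro bexI[of _ \<sigma>0] allI impI)
    show "\<sigma>0 \<in> facets n (K \<union> Pow \<sigma>)" using s0 by (auto simp: facets_def)
    fix N and g :: "'a \<Rightarrow> 'a"
    assume N: "thin n N" "K \<union> Pow \<sigma> \<subseteq> N" and inj: "inj_on g (\<Union>N)"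
      and g: "\<forall>\<sigma>\<in>facets n N. g ` \<sigma> \<in> facets n N" and id: "\<forall>x\<in>\<sigma>0. g x = x"
    have gid: "g x = x" if "x \<in> \<Union>K" for x using IH[OF N(1) _ inj g id that] N(2) by blast
    obtain x0 where x0: "x0 \<in> R" using attach.hyps by auto
    then have x0s: "x0 \<in> \<sigma>" using attach.hyps by auto
    let ?\<rho> = "\<sigma> - {x0}"
    have \<rho>: "?\<rho> \<in> K" "Suc (card ?\<rho>) = n"
      using attach.hyps x0 x0s by (auto simp: card_Suc_Diff1 simp del: card_Diff_insert)
    obtain \<tau> where t: "\<tau> \<in> facets n K" "?\<rho> \<subseteq> \<tau>"
        using shelled_in_facet[OF attach.hyps(1) \<rho>(1)] by blast
    have "\<sigma> \<notin> K" using attach_notin attach.hyps by metis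
    then have ts: "\<tau> \<noteq> \<sigma>" using t by (auto simp: facets_def)
    have idim: "g ` S = S" if "S \<subseteq> \<Union>K" for S
    proof -
      have "g ` S = id ` S" by (rule image_cong[OF refl]) (use gid subsetD[OF that] in simp)
      then show ?thesis by simp
    qed
    have \<tau>K: "\<tau> \<subseteq> \<Union>K" using t by (auto simp: facets_def)
    have sN: "\<sigma> \<in> facets n N" "\<tau> \<in> facets n N" using N t attach.hyps by (auto simp: facets_def)
    have gs: "g ` \<sigma> \<in> facets n N" using g sN by auto
    have g\<rho>: "g ` ?\<rho> = ?\<rho>" using idim \<rho> by blast
    then have "?\<rho> \<subseteq> g ` \<sigma>" by blast
    then have "\<sigma> = \<tau> \<or> \<sigma> = g ` \<sigma> \<or> \<tau> = g ` \<sigma>"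
      by (intro N(1)[unfolded thin_def, rule_format, of ?\<rho>]) (use t sN gs \<rho> in auto)
    moreover have "\<tau> \<noteq> g ` \<sigma>"
    proof
      assume "\<tau> = g ` \<sigma>"
      then have "g ` \<tau> = g ` \<sigma>" using idim[OF \<tau>K] by simp
      moreover have "\<tau> \<subseteq> \<Union>N" "\<sigma> \<subseteq> \<Union>N" using sN by (auto simp: facets_def)
      ultimately show False using inj ts by (metis inj_on_image_eq_iff)
    qed
    ultimately have gss: "g ` \<sigma> = \<sigma>" using ts by auto
    have "g x0 \<notin> ?\<rho>"
    proof
      assume a: "g x0 \<in> ?\<rho>"
      then have "g (g x0) = g x0" using gid \<rho> by blast
      moreover have "x0 \<in> \<Union>N" "g x0 \<in> \<Union>N" using a x0s N(2) by blast+
      ultimately have "g x0 = x0" using inj by (auto simp: inj_on_def)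
      then show False using a by simp
    qed
    moreover have "g x0 \<in> \<sigma>" using gss x0s by blast
    ultimately have "g x0 = x0" by blast
    moreover have "g x = x" if "x \<in> \<sigma>" "x \<noteq> x0" for x using gid \<rho> that by blast
    ultimately show "\<forall>x\<in>\<Union>(K \<union> Pow \<sigma>). g x = x" using gid by auto
  qed
qed

lemma link_vertices_image:
  assumes g: "inj_on g (\<Union>L)" and "w \<in> \<Union>L"
  shows "link_vertices ((\<lambda>\<sigma>. g ` \<sigma>) ` L) (g w) = g ` link_vertices L w"
proof -
  have "g w \<in> g ` \<sigma> \<longleftrightarrow> w \<in> \<sigma>" if "\<sigma> \<in> L" for \<sigma>
    using inj_on_image_mem_iff[OF g assms(2)] that by blast
  then have "{\<tau> \<in> (\<lambda>\<sigma>. g ` \<sigma>) ` L. g w \<in> \<tau>} = (\<lambda>\<sigma>. g ` \<sigma>) ` {\<sigma>\<in>L. w \<in> \<sigma>}" by auto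
  then have "link_vertices ((\<lambda>\<sigma>. g ` \<sigma>) ` L) (g w) = g ` \<Union>{\<sigma>\<in>L. w \<in> \<sigma>} - g ` {w}"
    by (auto simp: link_vertices_def)
  also have "\<dots> = g ` (\<Union>{\<sigma>\<in>L. w \<in> \<sigma>} - {w})"
    by (rule inj_on_image_set_diff[OF g, symmetric]) (use assms(2) in auto)
  finally show ?thesis by (simp add: link_vertices_def)
qed

text \<open>\<open>g\<close> permutes the new vertices and so maps their links, the stacked facets,
  into \<open>B\<close>; a facet not in \<open>A\<close> is still a face of \<open>L\<close> and
  goes to a face on old vertices. Thus \<open>g\<close> preserves the facets of \<open>K\<close>,
  and rigidity makes it the identity on old vertices.\<close>

lemma stacked_rigid:
  assumes K: "shelled_sphere_on d b K" "d > 0"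
    and rigid: "\<forall>g. inj_on g (\<Union>K) \<longrightarrow> (\<forall>\<sigma>\<in>facets (Suc d) K. g ` \<sigma> \<in> facets (Suc d) K)
      \<longrightarrow> (\<forall>x\<in>\<sigma>0. g x = x) \<longrightarrow> (\<forall>x\<in>\<Union>K. g x = x)"
    and A: "stacked d b K A L" "A \<subseteq> facets (Suc d) K" and B: "stacked d b K B L'" "B
        \<subseteq> facets (Suc d) K"
    and m: "card A = m" "card B = m"
    and g: "bij_betw g {..<b + m} {..<b + m}" "L' = (\<lambda>\<sigma>. g ` \<sigma>) ` L" "g ` {..<b}
        = {..<b}" "\<forall>x\<in>\<sigma>0. g x = x"
  shows "A \<subseteq> B"
proof -
  have U: "\<Union>K = {..<b}" "\<Union>L = {..<b + m}" using K A m
      by (auto simp: shelled_sphere_on_def stacked_def)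
  have inj: "inj_on g {..<b + m}" using g by (auto simp: bij_betw_def)
  then have injb: "inj_on g (\<Union>K)" unfolding U by (rule inj_on_subset) auto
  have inB: "g ` \<phi> \<in> B" if "\<phi> \<in> A" for \<phi>
  proof -
    have "\<phi> \<in> link_vertices L ` {b..<b + m}" using A(1) that m by (simp add: stacked_def)
    then obtain w where w: "b \<le> w" "w < b + m" "\<phi> = link_vertices L w" by auto
    have "g w < b + m" using g(1) w by (auto simp: bij_betw_def)
    moreover have "\<not> g w < b"
    proof
      assume "g w < b"
      then obtain u where u: "u < b" "g w = g u" using g(3) by (metis imageE lessThan_iff)
      then have "w = u" using w by (intro inj_onD[OF inj u(2)]) auto
      then show False using u w by simp
    qed
    ultimately have "link_vertices L' (g w) \<in> B" using B(1) m by (auto simp: stacked_def)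
    then show ?thesis using link_vertices_image[of g L w] inj U w g(2) by simp
  qed
  have "\<forall>\<sigma>\<in>facets (Suc d) K. g ` \<sigma> \<in> facets (Suc d) K"
  proof
    fix \<sigma> assume s: "\<sigma> \<in> facets (Suc d) K"
    show "g ` \<sigma> \<in> facets (Suc d) K"
    proof (cases "\<sigma> \<in> A")
      case True
      then show ?thesis using inB B by auto
    next
      case False
      then have "\<sigma> \<in> L" using A s by (auto simp: stacked_def)
      have sb: "\<sigma> \<subseteq> {..<b}" using s U by (auto simp: facets_def)
      then have "g ` \<sigma> \<subseteq> {..<b}" using g(3) by blast
      then have "g ` \<sigma> \<in> K" using B(1) \<open>\<sigma> \<in> L\<close> g(2) by (auto simp: stacked_def)
      moreover have "card (g ` \<sigma>) = card \<sigma>" using injb sb U by (metis card_image inj_on_subset)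
      ultimately show ?thesis using s by (simp add: facets_def)
    qed
  qed
  then have gid: "g x = x" if "x \<in> \<Union>K" for x using rigid injb g(4) that by blast
  show ?thesis
  proof
    fix \<phi> assume p: "\<phi> \<in> A"
    then have "\<phi> \<subseteq> \<Union>K" using A(2) by (auto simp: facets_def)
    then have "g ` \<phi> = id ` \<phi>" by (intro image_cong refl) (use gid in auto)
    then show "\<phi> \<in> B" using inB[OF p] by simp
  qed
qed

lemma finite_types_with_vertices: "finite (types_with_vertices d n)"
proof -
  have "finite (types_with_vertices d n) \<and> card (types_with_vertices d n) \<le> card (Pow (Pow {..<n}))"
    unfolding types_with_vertices_def
  proof (rule quotient_card_le[where P = "\<lambda>K (L :: nat set set). simplicial_cplx L \<and> cplx_iso K L"])
    fix K assume "K \<in> {K \<in> shellable_spheres d. card (vertices K) = n}"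
    then have K: "simplicial_cplx K" "card (vertices K) = n"
      by (auto simp: shellable_spheres_def simplicial_sphere_def)
    then have fv: "finite (vertices K)" using finite_vertices by (simp add: vertices_def)
    obtain f where f: "bij_betw f (vertices K) {..<n}"
      using ex_bij_betw_finite_nat[OF fv] K(2) by (auto simp: atLeast0LessThan)
    define L where "L = (\<lambda>\<sigma>. f ` \<sigma>) ` K"
    have sub: "\<sigma> \<subseteq> vertices K" if "\<sigma> \<in> K" for \<sigma> using that by (auto simp: vertices_def)
    have L: "simplicial_cplx L"
      unfolding simplicial_cplx_def
    proof (intro conjI ballI allI impI)
      show "finite L" "{} \<in> L" using K by (auto simp: L_def simplicial_cplx_def)
      fix \<tau> assume "\<tau> \<in> L"
      then obtain \<sigma> where s: "\<sigma> \<in> K" "\<tau> = f ` \<sigma>" by (auto simp: L_def)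
      then show "finite \<tau>" using K by (auto simp: simplicial_cplx_def)
      fix \<tau>' assume "\<tau>' \<subseteq> \<tau>"
      then obtain \<sigma>' where "\<sigma>' \<subseteq> \<sigma>" "\<tau>' = f ` \<sigma>'" using s by (meson subset_image_iff)
      then show "\<tau>' \<in> L" using cplx_subset[OF K(1) s(1)] by (auto simp: L_def)
    qed
    have "vertices L = f ` vertices K" by (auto simp: L_def vertices_def)
    then have v: "vertices L = {..<n}" using f by (simp add: bij_betw_def)
    then have "L \<in> Pow (Pow {..<n})" by (auto simp: vertices_def)
    moreover have "cplx_iso K L" using f v by (auto simp: cplx_iso_def L_def)
    ultimately show "\<exists>L\<in>Pow (Pow {..<n}). simplicial_cplx L \<and> cplx_iso K L" using L by blast
  next
    fix K K' L :: "nat set set" assume "K \<in> {K \<in> shellable_spheres d. card (vertices K) = n}"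
      "K' \<in> {K \<in> shellable_spheres d. card (vertices K) = n}"
      and L: "simplicial_cplx L \<and> cplx_iso K L" "simplicial_cplx L \<and> cplx_iso K' L"
    then have "simplicial_cplx K" "simplicial_cplx K'"
        by (auto simp: shellable_spheres_def simplicial_sphere_def)
    then show "iso_rel `` {K} = iso_rel `` {K'}"
        using L cplx_iso_class[of K L] cplx_iso_class[of K' L] by simp
  qed simp
  then show ?thesis by simp
qed

text \<open>Given the type, a stacking is determined by an isomorphism onto a fixed representative,
  and of this only the image of the old vertices and the values on the facet
  \<open>\<sigma>0\<close> matter. They account for the factors \<open>2 ^ (b + m)\<close> and
  \<open>(b + m) ^ Suc d\<close>.\<close>

lemma choose_le_types:
  assumes K: "shelled_sphere_on d b K" and d: "d > 0"
  shows "card (facets (Suc d) K) choose m \<le> card (types_with_vertices d (b + m)) * (2 ^ (b + m) *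
      (b + m) ^ Suc d)"
proof -
  let ?n = "Suc d" and ?t = "b + m"
  have sh: "shelled ?n K" and U: "\<Union>K = {..<b}" and sp: "simplicial_sphere d K"
    using K by (auto simp: shelled_sphere_on_def)
  have thin: "thin ?n K" using shelled_sphere[OF sh sp d] by simp
  obtain \<sigma>0 where s0: "\<sigma>0 \<in> facets ?n K" and rig: "\<forall>N g. thin ?n N \<longrightarrow> K \<subseteq> N \<longrightarrow> inj_on g (\<Union>N)
      \<longrightarrow> (\<forall>\<sigma>\<in>facets ?n N. g ` \<sigma> \<in> facets ?n N)
    \<longrightarrow> (\<forall>x\<in>\<sigma>0. g x = x) \<longrightarrow> (\<forall>x\<in>\<Union>K. g x = x)" using flag_rigid[OF sh] by blast
  have rigid: "\<forall>g. inj_on g (\<Union>K) \<longrightarrow> (\<forall>\<sigma>\<in>facets ?n K. g ` \<sigma> \<in> facets ?n K)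
      \<longrightarrow> (\<forall>x\<in>\<sigma>0. g x = x) \<longrightarrow> (\<forall>x\<in>\<Union>K. g x = x)"
    using rig[rule_format, OF thin order_refl] by blast
  have s0b: "\<sigma>0 \<subseteq> {..<b}" "card \<sigma>0 = ?n" "finite \<sigma>0"
    using s0 U shelled_finite_face[OF sh] by (auto simp: facets_def)
  have ff: "finite (facets ?n K)" using shelled_finite[OF sh] by (simp add: facets_def)
  define \<A> where "\<A> = {A. A \<subseteq> facets ?n K \<and> card A = m}"
  have "\<exists>L. stacked d b K A L" if "A \<in> \<A>" for A
    using that d ff by (intro stacked_exists[OF K]) (auto simp: \<A>_def intro: finite_subset)
  then obtain L where L: "stacked d b K A (L A)" if "A \<in> \<A>" for A by metis
  have LS: "shelled ?n (L A)" "simplicial_sphere d (L A)" "\<Union>(L A) = {..<?t}" if "A \<in> \<A>" for A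
    using L[OF that] that by (auto simp: stacked_def shelled_sphere_on_def \<A>_def)
  define c where "c A = iso_rel `` {L A}" for A
  have cT: "c A \<in> types_with_vertices d ?t" if "A \<in> \<A>" for A
    using LS[OF that] shelled_imp_shellable[of ?n "L A"]
    unfolding c_def types_with_vertices_def
    by (intro quotientI) (auto simp: shellable_spheres_def vertices_def)
  have isoc: "cplx_iso (L A) (L B)" if "A \<in> \<A>" "B \<in> \<A>" "c A = c B" for A B
  proof -
    have "(L B, L B) \<in> iso_rel"
      using equiv_iso_rel shelled_cplx[OF LS(1)[OF that(2)]] by (auto simp: equiv_def refl_on_def)
    then have "(L A, L B) \<in> iso_rel" using that(3) by (auto simp: c_def)
    then show ?thesis by (simp add: iso_rel_def)
  qed
  \<comment> \<open>One representative per type, so that the isomorphisms of equivalent stackings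
    have a common target and can be composed.\<close>
  define r where "r C = (SOME B. B \<in> \<A> \<and> c B = C)" for C
  have r: "r (c A) \<in> \<A> \<and> c (r (c A)) = c A" if "A \<in> \<A>" for A
    unfolding r_def by (rule someI[of _ A]) (use that in simp)
  have "\<exists>g. bij_betw g {..<?t} {..<?t} \<and> L (r (c A)) = (\<lambda>\<sigma>. g ` \<sigma>) ` L A" if "A \<in> \<A>" for A
    using isoc[OF that, of "r (c A)"] r[OF that] LS(3)[OF that] LS(3)[of "r (c A)"]
    by (auto simp: cplx_iso_def vertices_def)
  then obtain g where g: "bij_betw (g A) {..<?t} {..<?t}" "L (r (c A)) = (\<lambda>\<sigma>. g A ` \<sigma>) ` L A"
      if "A \<in> \<A>" for A
    by metis
  \<comment> \<open>If two values agree, going to the representative with \<open>g A\<close> and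
    back with the inverse of \<open>g B\<close> preserves \<open>{..<b}\<close> and fixes
    \<open>\<sigma>0\<close>, as \<open>stacked_rigid\<close> requires.\<close>
  define \<Psi> where "\<Psi> A = (c A, g A ` {..<b}, restrict (g A) \<sigma>0)" for A
  have sub: "A \<subseteq> B" if AB: "A \<in> \<A>" "B \<in> \<A>" "\<Psi> A = \<Psi> B" for A B
  proof -
    have e: "c A = c B" "g A ` {..<b} = g B ` {..<b}" "restrict (g A) \<sigma>0 = restrict (g B) \<sigma>0"
      using AB(3) by (auto simp: \<Psi>_def)
    define h where "h = inv_into {..<?t} (g B)"
    have inj: "inj_on (g B) {..<?t}" using g(1)[OF AB(2)] by (simp add: bij_betw_def)
    have hb: "bij_betw h {..<?t} {..<?t}" unfolding h_def
        by (rule bij_betw_inv_into[OF g(1)[OF AB(2)]])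
    have hg: "h ` g B ` S = S" if "S \<subseteq> {..<?t}" for S
      unfolding h_def using inj that by (simp add: inv_into_image_cancel)
    show ?thesis
    proof (rule stacked_rigid[OF K d rigid L[OF AB(1)] _ L[OF AB(2)], where g = "h \<circ> g A"])
      show "bij_betw (h \<circ> g A) {..<?t} {..<?t}" by (rule bij_betw_trans[OF g(1)[OF AB(1)] hb])
      show "(h \<circ> g A) ` {..<b} = {..<b}"
        unfolding image_comp[symmetric] e(2) by (rule hg) auto
      show "\<forall>x\<in>\<sigma>0. (h \<circ> g A) x = x"
      proof
        fix x assume x: "x \<in> \<sigma>0"
        then have "g A x = g B x" using fun_cong[OF e(3), of x] by simp
        moreover have "x < ?t" using x s0b by auto
        ultimately show "(h \<circ> g A) x = x" using inj by (simp add: h_def inv_into_f_f)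
      qed
      have "(\<lambda>\<sigma>. (h \<circ> g A) ` \<sigma>) ` L A = (\<lambda>\<sigma>. h ` \<sigma>) ` (\<lambda>\<sigma>. g A ` \<sigma>) ` L A"
        by (simp only: image_image image_comp[symmetric])
      also have "(\<lambda>\<sigma>. g A ` \<sigma>) ` L A = (\<lambda>\<sigma>. g B ` \<sigma>) ` L B"
        using g(2)[OF AB(1)] g(2)[OF AB(2)] e(1) by simp
      also have "(\<lambda>\<sigma>. h ` \<sigma>) ` (\<lambda>\<sigma>. g B ` \<sigma>) ` L B = (\<lambda>\<sigma>. h ` g B ` \<sigma>) ` L B"
        by (rule image_image)
      also have "\<dots> = (\<lambda>\<sigma>. \<sigma>) ` L B"
        by (rule image_cong[OF refl], rule hg) (use LS(3)[OF AB(2)] in blast)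
      finally show "L B = (\<lambda>\<sigma>. (h \<circ> g A) ` \<sigma>) ` L A" by simp
    qed (use AB(1,2) in \<open>simp_all add: \<A>_def\<close>)
  qed
  have "inj_on \<Psi> \<A>" by (intro inj_onI equalityI sub) simp_all
  moreover have "\<Psi> ` \<A> \<subseteq> types_with_vertices d ?t \<times> (Pow {..<?t} \<times> (\<sigma>0 \<rightarrow>\<^sub>E {..<?t}))"
  proof (rule image_subsetI)
    fix A assume A: "A \<in> \<A>"
    have im: "g A x < ?t" if "x < ?t" for x using g(1)[OF A] that by (auto simp: bij_betw_def)
    have "restrict (g A) \<sigma>0 \<in> \<sigma>0 \<rightarrow>\<^sub>E {..<?t}"
        using im s0b by (intro restrict_PiE_iff[THEN iffD2]) auto
    moreover have "g A ` {..<b} \<in> Pow {..<?t}" using im by auto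
    ultimately show "\<Psi> A \<in> types_with_vertices d ?t \<times> (Pow {..<?t} \<times> (\<sigma>0 \<rightarrow>\<^sub>E {..<?t}))"
      using cT[OF A] by (simp add: \<Psi>_def)
  qed
  moreover have "finite (types_with_vertices d ?t \<times> (Pow {..<?t} \<times> (\<sigma>0 \<rightarrow>\<^sub>E {..<?t})))"
    using finite_types_with_vertices s0b by (intro finite_cartesian_product finite_PiE) auto
  ultimately have "card \<A> \<le> card (types_with_vertices d ?t \<times> (Pow {..<?t} \<times> (\<sigma>0 \<rightarrow>\<^sub>E {..<?t})))"
    by (metis card_image card_mono)
  also have "\<dots> = card (types_with_vertices d ?t) * (2 ^ ?t * ?t ^ ?n)"
    using s0b by (simp add: card_cartesian_product card_Pow card_PiE)
  finally show ?thesis unfolding \<A>_def using n_subsets[OF ff, of m] by simp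
qed

section \<open>Numerical estimates and the final bounds\<close>

lemma eventually_superexponential:
  fixes c :: real
  assumes "1 \<le> c"
  shows "\<exists>n0. \<forall>n\<ge>n0. c ^ n * real n ^ k < (real n / 64) powr (real n / 4)"
proof -
  \<comment> \<open>After taking logarithms and bounding \<open>ln n\<close> by \<open>n\<close>,
    the claim reduces to \<open>ln c + k < ln (n / 64) / 4\<close>, that is, to
    \<open>E < n / 64\<close>.\<close>
  define E where "E = exp (4 * (ln c + real k))"
  obtain n0 :: nat where n0: "64 * (E + 1) < real n0" using reals_Archimedean2 by blast
  have "c ^ n * real n ^ k < (real n / 64) powr (real n / 4)" if "n0 \<le> n" for n
  proof -
    have n: "64 * (E + 1) < real n" using n0 that by linarith
    have E: "0 < E" by (simp add: E_def)
    have "1 \<le> 64 * (E + 1)" using E by simp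
    then have n1: "1 \<le> real n" using n by (meson less_imp_le order_trans)
    have "E < real n / 64" using n by simp
    then have "ln E < ln (real n / 64)" using E by simp
    then have l: "ln c + real k < ln (real n / 64) / 4" by (simp add: E_def)
    have "ln (c ^ n * real n ^ k) = real n * ln c + real k * ln (real n)"
      using assms n1 by (simp add: ln_mult ln_realpow)
    also have "\<dots> \<le> real n * ln c + real k * real n"
      using n1 by (intro add_left_mono mult_left_mono) (auto intro: ln_bound)
    also have "\<dots> = real n * (ln c + real k)" by (simp add: algebra_simps)
    also have "\<dots> < real n * (ln (real n / 64) / 4)" using l n1 by (intro mult_strict_left_mono) auto
    also have "\<dots> = ln ((real n / 64) powr (real n / 4))" using n1 by (simp add: ln_powr)
    finally show ?thesis using assms n1 by (subst (asm) ln_less_cancel_iff) auto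
  qed
  then show ?thesis by blast
qed

theorem types_with_vertices_superexponential:
  assumes "4 \<le> d"
  shows "\<exists>n0. \<forall>n\<ge>n0. C ^ n < real (card (types_with_vertices d n))"
proof -
  \<comment> \<open>The factor 2 absorbs the \<open>2 ^ n\<close> of \<open>choose_le_types\<close>;
    the maximum also covers negative and small \<open>C\<close>.\<close>
  define c where "c = 2 * max 1 \<bar>C\<bar>"
  have "1 \<le> c" by (simp add: c_def max_def)
  then obtain n1 where n1: "\<forall>n\<ge>n1. c ^ n * real n ^ Suc d < (real n / 64) powr (real n / 4)"
    using eventually_superexponential by blast
  have "C ^ n < real (card (types_with_vertices d n))" if n: "max n1 (4 * (d + 2) + 64) \<le> n" for n
  proof -
    \<comment> \<open>With this \<open>k\<close> the base sphere uses \<open>d + 2\<close> vertices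
      and about half of \<open>n\<close> more, so for \<open>n\<close> above the threshold at least
      \<open>n / 4\<close> remain for stacking. Also \<open>k \<ge> n / 8\<close>, whence at least
      \<open>n^2 / 64\<close> facets.\<close>
    define k where "k = n div 4"
    define b where "b = d + 2 + 2 * k"
    define m where "m = n - b"
    have k: "n \<le> 8 * k" "4 * k \<le> n" unfolding k_def using n by linarith+
    have n4: "4 * d + 72 \<le> n" using n by simp
    have "b \<le> n" unfolding b_def using n4 k(2) by presburger
    then have bm: "b + m = n" by (simp add: m_def)
    then have m: "b + m = n" "n \<le> 4 * m" "m \<le> n" "m > 0" using n4 k(2) b_def by presburger+
    obtain K where K: "shelled_sphere_on d b K" "k\<^sup>2 \<le> card (facets (Suc d) K)"
      using exists_many_facets[OF assms, of k] by (auto simp: b_def)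
    define N where "N = card (facets (Suc d) K)"
    have "n\<^sup>2 \<le> (8 * k)\<^sup>2" using k by (intro power_mono) auto
    then have N64: "n\<^sup>2 \<le> 64 * N" using K(2) by (simp add: N_def power_mult_distrib)
    have "64 * m \<le> n * n" using n m by (intro mult_mono) auto
    then have mN: "m \<le> N" using N64 by (simp add: power2_eq_square)
    have "real n * real m \<le> 64 * real N"
    proof -
      have "n * m \<le> n\<^sup>2" using m by (simp add: power2_eq_square)
      then have "n * m \<le> 64 * N" using N64 by linarith
      then have "real (n * m) \<le> real (64 * N)" by (rule of_nat_mono)
      then show ?thesis by simp
    qed
    then have q: "real n / 64 \<le> real N / real m" using m by (simp add: field_simps)
    have n64: "1 \<le> real n / 64" using n by simp
    have "c ^ n * real n ^ Suc d < (real n / 64) powr (real n / 4)"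
        using n1[rule_format, of n] n by simp
    also have "\<dots> \<le> (real n / 64) powr real m" using n64 m by (intro powr_mono) auto
    also have "\<dots> = (real n / 64) ^ m" using n64 by (simp add: powr_realpow)
    also have "\<dots> \<le> (real N / real m) ^ m" using q by (intro power_mono) auto
    also have "\<dots> \<le> real (N choose m)" using binomial_ge_n_over_k_pow_k[OF mN] by simp
    also have "\<dots> \<le> real (card (types_with_vertices d n) * (2 ^ n * n ^ Suc d))"
      using choose_le_types[OF K(1), of m] assms m by (intro of_nat_mono) (simp add: N_def)
    finally have "(max 1 \<bar>C\<bar>) ^ n * (2 ^ n * real n ^ Suc d) < real (card (types_with_vertices d
        n)) * (2 ^ n * real n ^ Suc d)"
      by (simp add: c_def power_mult_distrib mult_ac)
    then have "(max 1 \<bar>C\<bar>) ^ n < real (card (types_with_vertices d n))"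
      by (rule mult_right_less_imp_less) simp
    moreover have "C ^ n \<le> (max 1 \<bar>C\<bar>) ^ n"
    proof -
      have "C ^ n \<le> \<bar>C\<bar> ^ n" by (metis abs_ge_self power_abs)
      also have "\<dots> \<le> (max 1 \<bar>C\<bar>) ^ n" by (intro power_mono) auto
      finally show ?thesis .
    qed
    ultimately show ?thesis by linarith
  qed
  then show ?thesis by blast
qed

theorem mainTheorem4:
  fixes d :: nat
  assumes "4 \<le> d"
  shows "(\<forall>C::real. \<exists>n0. \<forall>n\<ge>n0.
            finite (types_with_vertices d n) \<and>
            C ^ n < real (card (types_with_vertices d n)))
       \<and> (\<exists>C'::real. \<forall>N.
            finite (types_with_facets d N) \<and>
            real (card (types_with_facets d N)) \<le> C' ^ N)"
proof (intro conjI allI)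
  fix C :: real
  show "\<exists>n0. \<forall>n\<ge>n0. finite (types_with_vertices d n)
      \<and> C ^ n < real (card (types_with_vertices d n))"
    using types_with_vertices_superexponential[OF assms, of C] finite_types_with_vertices by blast
next
  show "\<exists>C'::real. \<forall>N. finite (types_with_facets d N)
      \<and> real (card (types_with_facets d N)) \<le> C' ^ N"
  proof (intro exI[of _ "real (card (labels (Suc d)))"] allI)
    fix N
    have "finite (types_with_facets d N) \<and> card (types_with_facets d N) \<le> card (labels (Suc d)) ^ N"
      using assms by (intro card_types_with_facets) simp
    then show "finite (types_with_facets d N)
        \<and> real (card (types_with_facets d N)) \<le> real (card (labels (Suc d))) ^ N"
      by (metis of_nat_le_iff of_nat_power)
  qed
qed

end
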